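(* Let $d_0$ be the smallest dimension of a non-diffuse Bieberbach group which does not contain a subgroup isomorphic to \[ \Delta_P=\langle x,y\mid x^{-1}y^{2}x=y^{-2},\ y^{-1}x^{2}y=x^{-2}\rangle . \] Then $d_0=5$.
   Context: A crystallographic group of dimension $n$ is a discrete and cocompact subgroup of the group $O(n)\ltimes\mathbb{R}^n$ of isometries of the Euclidean space $\mathbb{R}^n$. A Bieberbach group of dimension $n$ is a torsion-free crystallographic group of dimension $n$. A group $\Gamma$ is diffuse if every finite non-empty subset $A\subset\Gamma$ has an extremal point, i.e. an element $a\in A$ such that for every $g\in\Gamma\setminus\{1\}$ at least one of $ga$, $g^{-1}a$ is not in $A$. A group is non-diffuse if it is not diffuse. The group $\Delta_P$ is the three-dimensional Hantzsche-Wendt group. *)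

theory Defs
  imports
    "HOL-Analysis.Function_Topology"
    "HOL-Analysis.Product_Topology"
    "HOL-Algebra.Coset"
    "Jordan_Normal_Form.Matrix"
begin

section \<open>The isometry group of Euclidean space\<close>

definition orthogonal_group_carrier :: "nat \<Rightarrow> real mat set" where
  "orthogonal_group_carrier n =
     {A \<in> carrier_mat n n. transpose_mat A * A = 1\<^sub>m n \<and> A * transpose_mat A = 1\<^sub>m n}"

text \<open>The semidirect product of O(n) and R^n; the pair (A, v) is the isometry x \<mapsto> A x + v.\<close>

definition isometry_group :: "nat \<Rightarrow> (real mat \<times> real vec) monoid" where
  "isometry_group n =
     \<lparr>carrier = orthogonal_group_carrier n \<times> carrier_vec n,
      monoid.mult = (\<lambda>(A, v) (B, w). (A * B, v + A *\<^sub>v w)),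
      monoid.one = (1\<^sub>m n, 0\<^sub>v n)\<rparr>"

lemma isometry_group_simps:
  "carrier (isometry_group n) = orthogonal_group_carrier n \<times> carrier_vec n"
  "(A, v) \<otimes>\<^bsub>isometry_group n\<^esub> (B, w) = (A * B, v + A *\<^sub>v w)"
  "\<one>\<^bsub>isometry_group n\<^esub> = (1\<^sub>m n, 0\<^sub>v n)"
  by (simp_all add: isometry_group_def)

lemma orthogonal_group_carrier_mult:
  assumes "A \<in> orthogonal_group_carrier n" "B \<in> orthogonal_group_carrier n"
  shows "A * B \<in> orthogonal_group_carrier n"
proof -
  have A: "A \<in> carrier_mat n n" "transpose_mat A * A = 1\<^sub>m n" "A * transpose_mat A = 1\<^sub>m n"
    and B: "B \<in> carrier_mat n n" "transpose_mat B * B = 1\<^sub>m n" "B * transpose_mat B = 1\<^sub>m n"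
    using assms by (auto simp: orthogonal_group_carrier_def)
  have tA: "transpose_mat A \<in> carrier_mat n n" and tB: "transpose_mat B \<in> carrier_mat n n"
    using A B by auto
  have t: "transpose_mat (A * B) = transpose_mat B * transpose_mat A"
    using A(1) B(1) by (rule transpose_mult)
  have "transpose_mat B * transpose_mat A * (A * B) = transpose_mat B * ((transpose_mat A * A) * B)"
    using A(1) B(1) tA tB by (simp add: assoc_mult_mat[of _ n n _ n _ n])
  moreover have "A * B * (transpose_mat B * transpose_mat A) = A * ((B * transpose_mat B) * transpose_mat A)"
    using A(1) B(1) tA tB by (simp add: assoc_mult_mat[of _ n n _ n _ n])
  ultimately show ?thesis
    using A B tA tB t by (auto simp: orthogonal_group_carrier_def)
qed

lemma group_isometry_group: "group (isometry_group n)"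
proof (rule groupI)
  fix x y assume "x \<in> carrier (isometry_group n)" "y \<in> carrier (isometry_group n)"
  then show "x \<otimes>\<^bsub>isometry_group n\<^esub> y \<in> carrier (isometry_group n)"
    by (cases x; cases y)
       (auto simp: isometry_group_simps orthogonal_group_carrier_mult,
        auto simp: orthogonal_group_carrier_def)
next
  show "\<one>\<^bsub>isometry_group n\<^esub> \<in> carrier (isometry_group n)"
    by (auto simp: isometry_group_simps orthogonal_group_carrier_def)
next
  fix x y z assume h: "x \<in> carrier (isometry_group n)" "y \<in> carrier (isometry_group n)"
    "z \<in> carrier (isometry_group n)"
  obtain A u B v C w where p: "x = (A, u)" "y = (B, v)" "z = (C, w)"
    by (metis surj_pair)
  have c: "A \<in> carrier_mat n n" "B \<in> carrier_mat n n" "C \<in> carrier_mat n n"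
    "u \<in> carrier_vec n" "v \<in> carrier_vec n" "w \<in> carrier_vec n"
    using h by (auto simp: p isometry_group_simps orthogonal_group_carrier_def)
  have "u + A *\<^sub>v (v + B *\<^sub>v w) = u + A *\<^sub>v v + (A * B) *\<^sub>v w"
    using c by (simp add: mult_add_distrib_mat_vec[of _ n n] assoc_mult_mat_vec[of _ n n]
        assoc_add_vec[of _ n])
  then show "x \<otimes>\<^bsub>isometry_group n\<^esub> y \<otimes>\<^bsub>isometry_group n\<^esub> z
      = x \<otimes>\<^bsub>isometry_group n\<^esub> (y \<otimes>\<^bsub>isometry_group n\<^esub> z)"
    using c by (simp add: p isometry_group_simps assoc_mult_mat[of _ n n _ n _ n])
next
  fix x assume "x \<in> carrier (isometry_group n)"
  then show "\<one>\<^bsub>isometry_group n\<^esub> \<otimes>\<^bsub>isometry_group n\<^esub> x = x"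
    by (cases x) (auto simp: isometry_group_simps orthogonal_group_carrier_def)
next
  fix x assume h: "x \<in> carrier (isometry_group n)"
  obtain A u where p: "x = (A, u)" by (metis surj_pair)
  have c: "A \<in> carrier_mat n n" "transpose_mat A * A = 1\<^sub>m n" "A * transpose_mat A = 1\<^sub>m n"
    "u \<in> carrier_vec n"
    using h by (auto simp: p isometry_group_simps orthogonal_group_carrier_def)
  let ?y = "(transpose_mat A, - (transpose_mat A *\<^sub>v u))"
  have "?y \<in> carrier (isometry_group n)"
    using c by (auto simp: isometry_group_simps orthogonal_group_carrier_def)
  moreover have "?y \<otimes>\<^bsub>isometry_group n\<^esub> x = \<one>\<^bsub>isometry_group n\<^esub>"
    using c by (auto simp: p isometry_group_simps)
  ultimately show "\<exists>y\<in>carrier (isometry_group n). y \<otimes>\<^bsub>isometry_group n\<^esub> x = \<one>\<^bsub>isometry_group n\<^esub>"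
    by blast
qed

text \<open>The subspace topology of the standard topology on the space of n x n matrices times R^n.\<close>

definition isometry_topology :: "nat \<Rightarrow> (real mat \<times> real vec) topology" where
  "isometry_topology n =
     pullback_topology (carrier (isometry_group n))
       (\<lambda>(A, v). (\<lambda>ij\<in>{..<n} \<times> {..<n}. A $$ ij, \<lambda>i\<in>{..<n}. v $ i))
       (prod_topology
         (product_topology (\<lambda>_. euclideanreal) ({..<n} \<times> {..<n}))
         (product_topology (\<lambda>_. euclideanreal) {..<n}))"

lemma topspace_isometry_topology: "topspace (isometry_topology n) = carrier (isometry_group n)"
  by (auto simp: isometry_topology_def topspace_pullback_topology split: prod.splits)


section \<open>Crystallographic and Bieberbach groups\<close>

definition discrete_in_isometries :: "nat \<Rightarrow> (real mat \<times> real vec) set \<Rightarrow> bool" where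
  "discrete_in_isometries n \<Gamma> \<longleftrightarrow> subtopology (isometry_topology n) \<Gamma> = discrete_topology \<Gamma>"

text \<open>The coset space with the quotient topology is compact. The topology \<open>Q\<close> on the set of
  cosets is uniquely determined by the requirement that the projection is a quotient map.\<close>

definition cocompact_in_isometries :: "nat \<Rightarrow> (real mat \<times> real vec) set \<Rightarrow> bool" where
  "cocompact_in_isometries n \<Gamma> \<longleftrightarrow>
     (\<exists>Q. quotient_map (isometry_topology n) Q (\<lambda>g. \<Gamma> #>\<^bsub>isometry_group n\<^esub> g) \<and> compact_space Q)"

definition crystallographic_group :: "nat \<Rightarrow> (real mat \<times> real vec) set \<Rightarrow> bool" where
  "crystallographic_group n \<Gamma> \<longleftrightarrow>
     subgroup \<Gamma> (isometry_group n) \<and> discrete_in_isometries n \<Gamma> \<and> cocompact_in_isometries n \<Gamma>"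

definition torsion_free_group :: "('a, 'b) monoid_scheme \<Rightarrow> bool" where
  "torsion_free_group G \<longleftrightarrow>
     (\<forall>g\<in>carrier G. \<forall>k::nat. k > 0 \<longrightarrow> g [^]\<^bsub>G\<^esub> k = \<one>\<^bsub>G\<^esub> \<longrightarrow> g = \<one>\<^bsub>G\<^esub>)"

definition Bieberbach_group :: "nat \<Rightarrow> (real mat \<times> real vec) set \<Rightarrow> bool" where
  "Bieberbach_group n \<Gamma> \<longleftrightarrow>
     crystallographic_group n \<Gamma> \<and> torsion_free_group ((isometry_group n)\<lparr>carrier := \<Gamma>\<rparr>)"


section \<open>Diffuse groups\<close>

definition extremal_point :: "('a, 'b) monoid_scheme \<Rightarrow> 'a set \<Rightarrow> 'a \<Rightarrow> bool" where
  "extremal_point G A a \<longleftrightarrow>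
     a \<in> A \<and> (\<forall>g\<in>carrier G - {\<one>\<^bsub>G\<^esub>}. g \<otimes>\<^bsub>G\<^esub> a \<notin> A \<or> inv\<^bsub>G\<^esub> g \<otimes>\<^bsub>G\<^esub> a \<notin> A)"

definition diffuse_group :: "('a, 'b) monoid_scheme \<Rightarrow> bool" where
  "diffuse_group G \<longleftrightarrow>
     (\<forall>A. A \<subseteq> carrier G \<and> finite A \<and> A \<noteq> {} \<longrightarrow> (\<exists>a. extremal_point G A a))"


section \<open>Groups given by presentations\<close>

text \<open>A word is a list of letters; \<open>(x, True)\<close> stands for the generator \<open>x\<close> and \<open>(x, False)\<close>
  for its inverse. All elements of the type \<open>'g\<close> are generators.\<close>

type_synonym 'g word = "('g \<times> bool) list"

inductive word_cong :: "('g word \<times> 'g word) set \<Rightarrow> 'g word \<Rightarrow> 'g word \<Rightarrow> bool"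
  for R where
  refl: "word_cong R u u"
| sym: "word_cong R u v \<Longrightarrow> word_cong R v u"
| trans: "word_cong R u v \<Longrightarrow> word_cong R v w \<Longrightarrow> word_cong R u w"
| append: "word_cong R u u' \<Longrightarrow> word_cong R v v' \<Longrightarrow> word_cong R (u @ v) (u' @ v')"
| cancel: "word_cong R [(x, b), (x, \<not> b)] []"
| relation: "(u, v) \<in> R \<Longrightarrow> word_cong R u v"

definition presented_group :: "('g word \<times> 'g word) set \<Rightarrow> 'g word set monoid" where
  "presented_group R =
     \<lparr>carrier = UNIV // {(u, v). word_cong R u v},
      monoid.mult = (\<lambda>U V. {w. \<exists>u\<in>U. \<exists>v\<in>V. word_cong R (u @ v) w}),
      monoid.one = {w. word_cong R [] w}\<rparr>"

lemma presented_group_simps: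
  "carrier (presented_group R) = range (\<lambda>u. {w. word_cong R u w})"
  "{w. word_cong R u w} \<otimes>\<^bsub>presented_group R\<^esub> {w. word_cong R v w} = {w. word_cong R (u @ v) w}"
  "\<one>\<^bsub>presented_group R\<^esub> = {w. word_cong R [] w}"
  by (auto simp: presented_group_def quotient_def
        intro: word_cong.refl word_cong.trans[OF word_cong.append])

lemma word_cong_inverse: "\<exists>v. word_cong R (v @ u) []"
proof (induction u)
  case Nil
  show ?case by (rule exI[of _ "[]"]) (simp add: word_cong.refl)
next
  case (Cons a u)
  obtain v where v: "word_cong R (v @ u) []" using Cons by blast
  obtain x b where a: "a = (x, b)" by (cases a)
  have "word_cong R ([(x, \<not> b), (x, b)] @ u) ([] @ u)"
    using word_cong.cancel[of R x "\<not> b"] by (intro word_cong.append word_cong.refl) simp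
  then have "word_cong R (v @ [(x, \<not> b), (x, b)] @ u) (v @ [] @ u)"
    by (intro word_cong.append[OF word_cong.refl])
  then have "word_cong R ((v @ [(x, \<not> b)]) @ a # u) []"
    using v by (auto simp: a intro: word_cong.trans)
  then show ?case by blast
qed

lemma group_presented_group: "group (presented_group R)"
proof (rule groupI)
  fix x assume "x \<in> carrier (presented_group R)"
  then obtain u where x: "x = {w. word_cong R u w}" by (auto simp: presented_group_simps)
  obtain v where v: "word_cong R (v @ u) []" using word_cong_inverse by blast
  have "{w. word_cong R (v @ u) w} = {w. word_cong R [] w}"
    using v by (auto intro: word_cong.trans word_cong.sym)
  then show "\<exists>y\<in>carrier (presented_group R). y \<otimes>\<^bsub>presented_group R\<^esub> x = \<one>\<^bsub>presented_group R\<^esub>"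
    by (auto simp: x presented_group_simps)
qed (auto simp: presented_group_simps)

datatype HW_generator = X | Y

text \<open>The presentation \<open>\<langle>x, y | x\<inverse> y\<^sup>2 x = y\<^sup>-\<^sup>2, y\<inverse> x\<^sup>2 y = x\<^sup>-\<^sup>2\<rangle>\<close>.\<close>

definition Hantzsche_Wendt_group :: "HW_generator word set monoid" where
  "Hantzsche_Wendt_group =
     presented_group
       {([(X, False), (Y, True), (Y, True), (X, True)], [(Y, False), (Y, False)]),
        ([(Y, False), (X, True), (X, True), (Y, True)], [(X, False), (X, False)])}"

definition contains_subgroup_isomorphic ::
    "('a, 'b) monoid_scheme \<Rightarrow> ('c, 'd) monoid_scheme \<Rightarrow> bool" where
  "contains_subgroup_isomorphic G D \<longleftrightarrow> (\<exists>H. subgroup H G \<and> G\<lparr>carrier := H\<rparr> \<cong> D)"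


definition nondiffuse_Bieberbach_dimension :: "nat \<Rightarrow> bool" where
  "nondiffuse_Bieberbach_dimension n \<longleftrightarrow>
     (\<exists>\<Gamma>. Bieberbach_group n \<Gamma> \<and>
          \<not> diffuse_group ((isometry_group n)\<lparr>carrier := \<Gamma>\<rparr>) \<and>
          \<not> contains_subgroup_isomorphic ((isometry_group n)\<lparr>carrier := \<Gamma>\<rparr>) Hantzsche_Wendt_group)"

end

theory Submission
  imports Defs "HOL-Analysis.Analysis"
begin

text \<open>Lower bound. A group with a homomorphism to the reals with diffuse kernel is diffuse. For a
  torsion-free discrete group of isometries in dimension at most 4, induct over its subgroups, on the
  dimension of the span of their translations: a common fixed vector of the holonomy in this span gives
  such a homomorphism, whose kernel has a smaller span. If there is no common fixed vector, the traces
  of the holonomy sum to zero, so some element has negative trace. As torsion-freeness makes every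
  element fix a vector, that element is either a half turn or, in dimension 4, a rotation by a third of
  a turn combined with a reflection; the other rotation angles are excluded by the discreteness of the
  translations. The second kind alone cannot compensate the trace 4 of the identity, since its squares
  have positive trace. From a half turn one finds a second element with which it satisfies the
  relations of the Hantzsche-Wendt group, and in a torsion-free group these relations force an
  isomorphic copy of that group.

  Dimension 5. In an extension of a lattice by \<open>\<int>/4 \<times> \<int>/2\<close> the parities of the holonomy rule
  out a pair of elements with the Hantzsche-Wendt relations, while the elements translating by a
  vector in a box form a finite set without extremal point.\<close>

section \<open>The Hantzsche-Wendt relations\<close>

text \<open>The kernel of a homomorphism to the reals is no longer cocompact, so cocompactness is
  spent once, on the finiteness of the holonomy (Bieberbach's first theorem). Finite holonomy and
  discreteness pass to all subgroups, and each subgroup is made to act on the span of its own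
  translations.

  The bound 4 enters twice. Next to a fixed vector and a rotated plane at most a line is left, which
  gives the list of negative traces. For a half turn \<open>y\<close> about \<open>w\<close> and an
  \<open>x\<close> with \<open>x w = - w\<close>, fixed vectors of \<open>x\<close> and of
  \<open>x y\<close> form with \<open>w\<close> three orthogonal eigenvectors of \<open>x\<close>,
  so \<open>x\<close> acts by a sign on what is left and its square is a translation, as the
  relations demand. In dimension 5 a plane is left, and \<open>x\<close> may turn it by a right
  angle: this is the origin of the block \<open>J\<close> in the five-dimensional group. That group
  does contain a half turn and such an \<open>x\<close>, but the square of \<open>x\<close> is not a
  translation.\<close>

no_notation scalar_prod (infix "\<bullet>" 70)

lemma (in group) inv_cancel:
  assumes "g \<in> carrier G" "u \<in> carrier G"
  shows "inv g \<otimes> (g \<otimes> u) = u" "g \<otimes> (inv g \<otimes> u) = u"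
  using assms by (simp_all add: m_assoc[symmetric])

text \<open>Conjugation by \<open>g\<close> is an endomorphism and so respects integer powers; the
  equation without inverses of \<open>g\<close> is the form in which letters are moved through words
  below.\<close>

lemma (in group) conj_int_pow:
  assumes g: "g \<in> carrier G" and u: "u \<in> carrier G" and v: "v \<in> carrier G"
    and eq: "g \<otimes> u = v \<otimes> g"
  shows "g \<otimes> u [^] (i::int) = v [^] i \<otimes> g"
proof -
  define h where "h z = g \<otimes> z \<otimes> inv g" for z
  have hom: "h \<in> hom G G"
    unfolding h_def by (rule homI) (use g in \<open>simp_all add: m_assoc inv_cancel\<close>)
  have "h u = v"
    unfolding h_def using g u v eq by (simp add: m_assoc)
  have "h (u [^] i) = h u [^] i"
    using hom_int_pow[OF hom u] group_axioms by blast
  hence "g \<otimes> u [^] i \<otimes> inv g = v [^] i"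
    unfolding \<open>h u = v\<close> by (simp add: h_def)
  thus ?thesis
    using g u v by (metis int_pow_closed inv_closed inv_solve_right m_closed)
qed

lemma (in group) inv_pow_comm:
  assumes "u \<in> carrier G" "v \<in> carrier G" "u \<otimes> v = v \<otimes> u"
  shows "u \<otimes> inv v = inv v \<otimes> u"
  using assms by (metis inv_closed inv_solve_left inv_solve_right m_assoc m_closed)

abbreviation (input) HW_relations where "HW_relations \<equiv>
  {([(X, False), (Y, True), (Y, True), (X, True)], [(Y, False), (Y, False)]),
   ([(Y, False), (X, True), (X, True), (Y, True)], [(X, False), (X, False)])}"

text \<open>Only the relations are assumed, so the presented group and any candidate group are both
  instances, and the normal form computed here serves on both sides of the homomorphism between
  them.\<close>

locale HW_pair = group G for G (structure) +
  fixes x y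
  assumes x [simp]: "x \<in> carrier G" and y [simp]: "y \<in> carrier G"
    and rel1: "inv x \<otimes> (y \<otimes> y) \<otimes> x = inv (y \<otimes> y)"
    and rel2: "inv y \<otimes> (x \<otimes> x) \<otimes> y = inv (x \<otimes> x)"
begin

text \<open>The squares of \<open>x\<close>, \<open>y\<close> and \<open>x \<otimes> y\<close>
  generate the translation lattice of the Hantzsche-Wendt group; \<open>c\<close> is the third of
  them.\<close>

definition a where "a = x \<otimes> x"
definition b where "b = y \<otimes> y"
definition c where "c = x \<otimes> (y \<otimes> (x \<otimes> y))"

lemma abc [simp]: "a \<in> carrier G" "b \<in> carrier G" "c \<in> carrier G"
  by (simp_all add: a_def b_def c_def)

lemma xa: "x \<otimes> a = a \<otimes> x" and yb: "y \<otimes> b = b \<otimes> y"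
  by (simp_all add: a_def b_def m_assoc)

lemma xb: "x \<otimes> b = inv b \<otimes> x" and xib: "x \<otimes> inv b = b \<otimes> x"
proof -
  have "b \<otimes> x = x \<otimes> inv b"
    using rel1 by (simp add: b_def[symmetric] m_assoc inv_solve_left')
  thus 1: "x \<otimes> inv b = b \<otimes> x" by simp
  have "inv b \<otimes> (b \<otimes> x) \<otimes> b = inv b \<otimes> (x \<otimes> inv b) \<otimes> b" using 1 by simp
  thus "x \<otimes> b = inv b \<otimes> x" by (simp add: m_assoc inv_cancel)
qed

lemma ya: "y \<otimes> a = inv a \<otimes> y" and yia: "y \<otimes> inv a = a \<otimes> y"
proof -
  have "a \<otimes> y = y \<otimes> inv a"
    using rel2 by (simp add: a_def[symmetric] m_assoc inv_solve_left')
  thus 1: "y \<otimes> inv a = a \<otimes> y" by simp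
  have "inv a \<otimes> (a \<otimes> y) \<otimes> a = inv a \<otimes> (y \<otimes> inv a) \<otimes> a" using 1 by simp
  thus "y \<otimes> a = inv a \<otimes> y" by (simp add: m_assoc inv_cancel)
qed

text \<open>Passing \<open>x\<close> inverts \<open>b\<close>, and two inversions cancel. The same
  argument with \<open>x \<otimes> y\<close> in place of \<open>x\<close> gives \<open>ac\<close>
  and \<open>bc\<close>.\<close>

lemma ab: "a \<otimes> b = b \<otimes> a"
proof -
  have "a \<otimes> b = x \<otimes> (x \<otimes> b)" by (simp add: a_def m_assoc)
  also have "\<dots> = (x \<otimes> inv b) \<otimes> x" by (simp add: xb m_assoc)
  also have "\<dots> = b \<otimes> a" unfolding xib by (simp add: a_def m_assoc)
  finally show ?thesis .
qed

lemma ac: "a \<otimes> c = c \<otimes> a"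
proof -
  have 1: "x \<otimes> y \<otimes> a = inv a \<otimes> (x \<otimes> y)"
  proof -
    have "x \<otimes> y \<otimes> a = x \<otimes> inv a \<otimes> y" by (simp add: m_assoc ya)
    also have "x \<otimes> inv a = inv a \<otimes> x" using inv_pow_comm[OF x abc(1) xa] .
    finally show ?thesis by (simp add: m_assoc)
  qed
  have c': "c = (x \<otimes> y) \<otimes> (x \<otimes> y)" by (simp add: c_def m_assoc)
  have 2: "x \<otimes> y \<otimes> inv a = a \<otimes> (x \<otimes> y)"
  proof -
    have "x \<otimes> y \<otimes> inv a = (x \<otimes> a) \<otimes> y" by (simp add: m_assoc yia)
    thus ?thesis by (simp add: xa m_assoc)
  qed
  have "c \<otimes> a = (x \<otimes> y) \<otimes> (x \<otimes> y \<otimes> a)" by (simp add: c' m_assoc)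
  also have "\<dots> = (x \<otimes> y \<otimes> inv a) \<otimes> (x \<otimes> y)" unfolding 1 by (simp add: m_assoc)
  also have "\<dots> = a \<otimes> c" unfolding 2 by (simp add: c' m_assoc)
  finally show ?thesis by simp
qed

lemma bc: "b \<otimes> c = c \<otimes> b"
proof -
  have c': "c = (x \<otimes> y) \<otimes> (x \<otimes> y)" by (simp add: c_def m_assoc)
  have 1: "x \<otimes> y \<otimes> b = inv b \<otimes> (x \<otimes> y)"
  proof -
    have "x \<otimes> y \<otimes> b = (x \<otimes> b) \<otimes> y" by (simp add: m_assoc yb)
    thus ?thesis by (simp add: xb m_assoc)
  qed
  have 2: "x \<otimes> y \<otimes> inv b = b \<otimes> (x \<otimes> y)"
  proof -
    have "x \<otimes> y \<otimes> inv b = (x \<otimes> inv b) \<otimes> y" by (simp add: m_assoc inv_pow_comm[OF y abc(2) yb])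
    thus ?thesis by (simp add: xib m_assoc)
  qed
  have "c \<otimes> b = (x \<otimes> y) \<otimes> (x \<otimes> y \<otimes> b)" by (simp add: c' m_assoc)
  also have "\<dots> = (x \<otimes> y \<otimes> inv b) \<otimes> (x \<otimes> y)" unfolding 1 by (simp add: m_assoc)
  also have "\<dots> = b \<otimes> c" unfolding 2 by (simp add: c' m_assoc)
  finally show ?thesis by simp
qed

text \<open>This is what inverts \<open>c\<close>: moving \<open>x\<close> to the left through
  \<open>c = (x y)^2\<close> turns it into \<open>(y x)^2\<close>.\<close>

lemma yx_squared: "y \<otimes> (x \<otimes> (y \<otimes> x)) = inv c"
proof -
  have "c \<otimes> (y \<otimes> (x \<otimes> (y \<otimes> x))) = x \<otimes> y \<otimes> (x \<otimes> b) \<otimes> (x \<otimes> (y \<otimes> x))"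
    by (simp add: c_def b_def m_assoc)
  also have "\<dots> = x \<otimes> (y \<otimes> inv b) \<otimes> (x \<otimes> x) \<otimes> (y \<otimes> x)"
    unfolding xb by (simp add: m_assoc)
  also have "\<dots> = x \<otimes> inv b \<otimes> (y \<otimes> a) \<otimes> (y \<otimes> x)"
    unfolding inv_pow_comm[OF y abc(2) yb] by (simp add: a_def m_assoc)
  also have "\<dots> = x \<otimes> (inv b \<otimes> inv a) \<otimes> (y \<otimes> y) \<otimes> x"
    unfolding ya by (simp add: m_assoc)
  also have "\<dots> = x \<otimes> (inv (a \<otimes> b) \<otimes> b) \<otimes> x"
    by (simp add: inv_mult_group b_def[symmetric] m_assoc)
  also have "inv (a \<otimes> b) \<otimes> b = inv a"
    unfolding ab by (simp add: inv_mult_group m_assoc)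
  also have "x \<otimes> inv a \<otimes> x = \<one>"
    using inv_pow_comm[OF x abc(1) xa] by (simp add: m_assoc a_def[symmetric])
  finally have "inv c \<otimes> (c \<otimes> (y \<otimes> (x \<otimes> (y \<otimes> x)))) = inv c \<otimes> \<one>" by (simp only:)
  thus ?thesis by (simp add: inv_cancel)
qed

lemma xc: "x \<otimes> c = inv c \<otimes> x" and yc: "y \<otimes> c = inv c \<otimes> y"
proof -
  have "y \<otimes> c = y \<otimes> (x \<otimes> (y \<otimes> x)) \<otimes> y" by (simp add: c_def m_assoc)
  hence 1: "y \<otimes> c = inv c \<otimes> y" unfolding yx_squared .
  have "c \<otimes> x = x \<otimes> (y \<otimes> (x \<otimes> (y \<otimes> x)))" by (simp add: c_def m_assoc)
  hence "c \<otimes> x = x \<otimes> inv c" unfolding yx_squared .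
  hence "inv c \<otimes> (c \<otimes> x) \<otimes> c = inv c \<otimes> (x \<otimes> inv c) \<otimes> c" by simp
  thus "x \<otimes> c = inv c \<otimes> x" by (simp add: m_assoc inv_cancel)
  show "y \<otimes> c = inv c \<otimes> y" by fact
qed

definition n where "n i j k = a [^] (i::int) \<otimes> (b [^] (j::int) \<otimes> c [^] (k::int))"

lemma n_closed [simp]: "n i j k \<in> carrier G"
  by (simp add: n_def)

lemma int_pow_comm:
  assumes "u \<in> carrier G" "v \<in> carrier G" "u \<otimes> v = v \<otimes> u"
  shows "u [^] (i::int) \<otimes> v [^] (j::int) = v [^] j \<otimes> u [^] i"
  using conj_int_pow[OF _ assms(2,2), of "u [^] i" j] conj_int_pow[OF assms(2,1,1), of i] assms
  by simp

lemma n_add: "n i j k \<otimes> n i' j' k' = n (i + i') (j + j') (k + k')"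
proof -
  have "n i j k \<otimes> n i' j' k' = a [^] i \<otimes> b [^] j \<otimes> (c [^] k \<otimes> a [^] i') \<otimes> b [^] j' \<otimes> c [^] k'"
    by (simp add: n_def m_assoc)
  also have "c [^] k \<otimes> a [^] i' = a [^] i' \<otimes> c [^] k" by (rule int_pow_comm) (simp_all add: ac)
  also have "a [^] i \<otimes> b [^] j \<otimes> (a [^] i' \<otimes> c [^] k) \<otimes> b [^] j' \<otimes> c [^] k'
      = a [^] i \<otimes> (b [^] j \<otimes> a [^] i') \<otimes> (c [^] k \<otimes> b [^] j') \<otimes> c [^] k'"
    by (simp add: m_assoc)
  also have "b [^] j \<otimes> a [^] i' = a [^] i' \<otimes> b [^] j" by (rule int_pow_comm) (simp_all add: ab)
  also have "c [^] k \<otimes> b [^] j' = b [^] j' \<otimes> c [^] k" by (rule int_pow_comm) (simp_all add: bc)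
  finally show ?thesis by (simp add: n_def m_assoc int_pow_mult)
qed

lemma n_unit: "n 1 0 0 = a" "n 0 1 0 = b" "n 0 0 1 = c" "n 0 0 0 = \<one>"
  by (simp_all add: n_def)

lemma n_inv: "inv (n i j k) = n (- i) (- j) (- k)"
  by (rule inv_equality) (simp_all add: n_add n_unit)

lemma n_unit_inv: "n (-1) 0 0 = inv a" "n 0 (-1) 0 = inv b" "n 0 0 (-1) = inv c"
  using n_inv[of 1 0 0] n_inv[of 0 1 0] n_inv[of 0 0 1] by (simp_all add: n_unit)

text \<open>On the exponents of \<open>a\<close>, \<open>b\<close>, \<open>c\<close>, conjugation by
  \<open>x\<close> is \<open>diag(1, -1, -1)\<close>, and by \<open>y\<close> it is
  \<open>diag(-1, 1, -1)\<close>: the half turns of the Hantzsche-Wendt manifold.\<close>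

lemma x_n: "x \<otimes> n i j k = n i (- j) (- k) \<otimes> x"
proof -
  have "x \<otimes> n i j k = (x \<otimes> a [^] i) \<otimes> b [^] j \<otimes> c [^] k" by (simp add: n_def m_assoc)
  also have "x \<otimes> a [^] i = a [^] i \<otimes> x" by (rule conj_int_pow) (simp_all add: xa)
  also have "a [^] i \<otimes> x \<otimes> b [^] j \<otimes> c [^] k = a [^] i \<otimes> (x \<otimes> b [^] j) \<otimes> c [^] k" by (simp add: m_assoc)
  also have "x \<otimes> b [^] j = inv b [^] j \<otimes> x" by (rule conj_int_pow) (simp_all add: xb)
  also have "a [^] i \<otimes> (inv b [^] j \<otimes> x) \<otimes> c [^] k = a [^] i \<otimes> inv b [^] j \<otimes> (x \<otimes> c [^] k)"
    by (simp add: m_assoc)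
  also have "x \<otimes> c [^] k = inv c [^] k \<otimes> x" by (rule conj_int_pow) (simp_all add: xc)
  finally show ?thesis by (simp add: n_def m_assoc int_pow_inv int_pow_neg)
qed

lemma y_n: "y \<otimes> n i j k = n (- i) j (- k) \<otimes> y"
proof -
  have "y \<otimes> n i j k = (y \<otimes> a [^] i) \<otimes> b [^] j \<otimes> c [^] k" by (simp add: n_def m_assoc)
  also have "y \<otimes> a [^] i = inv a [^] i \<otimes> y" by (rule conj_int_pow) (simp_all add: ya)
  also have "inv a [^] i \<otimes> y \<otimes> b [^] j \<otimes> c [^] k = inv a [^] i \<otimes> (y \<otimes> b [^] j) \<otimes> c [^] k" by (simp add: m_assoc)
  also have "y \<otimes> b [^] j = b [^] j \<otimes> y" by (rule conj_int_pow) (simp_all add: yb)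
  also have "inv a [^] i \<otimes> (b [^] j \<otimes> y) \<otimes> c [^] k = inv a [^] i \<otimes> b [^] j \<otimes> (y \<otimes> c [^] k)"
    by (simp add: m_assoc)
  also have "y \<otimes> c [^] k = inv c [^] k \<otimes> y" by (rule conj_int_pow) (simp_all add: yc)
  finally show ?thesis by (simp add: n_def m_assoc int_pow_inv int_pow_neg)
qed

text \<open>Modulo \<open>a\<close>, \<open>b\<close>, \<open>c\<close> the elements
  \<open>x\<close> and \<open>y\<close> commute and have trivial squares, so four representatives
  suffice.\<close>

definition normal_forms where
  "normal_forms = {n i j k \<otimes> e |i j k e. e \<in> {\<one>, x, y, x \<otimes> y}}"

text \<open>The price of swapping the two letters, as a lattice vector. Besides the squares and the
  action on exponents this is the rule that keeps products in normal form.\<close>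

lemma yx: "y \<otimes> x = n (-1) 1 (-1) \<otimes> (x \<otimes> y)"
proof -
  have "c \<otimes> (y \<otimes> x) = x \<otimes> (y \<otimes> x) \<otimes> (b \<otimes> x)" by (simp add: c_def b_def m_assoc)
  also have "\<dots> = x \<otimes> y \<otimes> (x \<otimes> b) \<otimes> x" by (simp add: m_assoc)
  also have "\<dots> = x \<otimes> (y \<otimes> inv b) \<otimes> a" unfolding xb by (simp add: a_def m_assoc)
  also have "\<dots> = (x \<otimes> inv b) \<otimes> (y \<otimes> a)"
    unfolding inv_pow_comm[OF y abc(2) yb] by (simp add: m_assoc)
  also have "\<dots> = b \<otimes> (x \<otimes> inv a) \<otimes> y" unfolding xib ya by (simp add: m_assoc)
  also have "\<dots> = b \<otimes> inv a \<otimes> (x \<otimes> y)" unfolding inv_pow_comm[OF x abc(1) xa] by (simp add: m_assoc)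
  also have "b \<otimes> inv a = n (-1) 1 0"
    unfolding n_unit(2)[symmetric] n_unit_inv(1)[symmetric] by (simp add: n_add)
  finally have "y \<otimes> x = inv c \<otimes> (n (-1) 1 0 \<otimes> (x \<otimes> y))" by (simp add: inv_solve_left)
  also have "\<dots> = inv c \<otimes> n (-1) 1 0 \<otimes> (x \<otimes> y)" by (simp add: m_assoc)
  also have "inv c \<otimes> n (-1) 1 0 = n (-1) 1 (-1)"
    unfolding n_unit_inv(3)[symmetric] by (simp add: n_add)
  finally show ?thesis .
qed

lemma normal_forms_n: "w \<in> normal_forms \<Longrightarrow> n i j k \<otimes> w \<in> normal_forms"
  unfolding normal_forms_def
  by (clarsimp, smt (verit) n_add n_closed m_assoc one_closed x y m_closed)

lemma normal_formsI: "e \<in> {\<one>, x, y, x \<otimes> y} \<Longrightarrow> n i j k \<otimes> e \<in> normal_forms"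
  unfolding normal_forms_def by blast

lemma normal_forms_x: assumes "w \<in> normal_forms" shows "x \<otimes> w \<in> normal_forms"
proof -
  obtain i j k e where w: "w = n i j k \<otimes> e" and e: "e \<in> {\<one>, x, y, x \<otimes> y}"
    using assms unfolding normal_forms_def by blast
  have ec: "e \<in> carrier G" using e by auto
  have 1: "x \<otimes> w = n i (- j) (- k) \<otimes> (x \<otimes> e)"
    using ec by (simp add: w m_assoc[symmetric] x_n)
  have "x \<otimes> e \<in> normal_forms"
    using e normal_formsI[of x 0 0 0] normal_formsI[of "x \<otimes> y" 0 0 0]
      normal_formsI[of \<one> 1 0 0] normal_formsI[of y 1 0 0]
    by (auto simp: n_unit a_def m_assoc)
  thus ?thesis unfolding 1 by (rule normal_forms_n)
qed

lemma normal_forms_y: assumes "w \<in> normal_forms" shows "y \<otimes> w \<in> normal_forms"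
proof -
  obtain i j k e where w: "w = n i j k \<otimes> e" and e: "e \<in> {\<one>, x, y, x \<otimes> y}"
    using assms unfolding normal_forms_def by blast
  have ec: "e \<in> carrier G" using e by auto
  have 1: "y \<otimes> w = n (- i) j (- k) \<otimes> (y \<otimes> e)"
    using ec by (simp add: w m_assoc[symmetric] y_n)
  have 2: "y \<otimes> (x \<otimes> y) \<in> normal_forms"
  proof -
    have "y \<otimes> (x \<otimes> y) = n (-1) 1 (-1) \<otimes> (x \<otimes> b)"
      by (simp add: m_assoc[symmetric] yx) (simp add: m_assoc b_def)
    also have "\<dots> = n (-1) 1 (-1) \<otimes> n 0 (-1) 0 \<otimes> x" by (simp add: xb n_unit_inv m_assoc)
    also have "\<dots> = n (-1) 0 (-1) \<otimes> x" by (simp add: n_add)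
    finally show ?thesis by (simp add: normal_formsI)
  qed
  have "y \<otimes> e \<in> normal_forms"
    using e 2 normal_formsI[of y 0 0 0] normal_formsI[of \<one> 0 1 0]
      normal_formsI[of "x \<otimes> y" "-1" 1 "-1"]
    by (auto simp: n_unit b_def m_assoc yx)
  thus ?thesis unfolding 1 by (rule normal_forms_n)
qed

lemma normal_forms_inv:
  assumes "w \<in> normal_forms" shows "inv x \<otimes> w \<in> normal_forms" "inv y \<otimes> w \<in> normal_forms"
proof -
  have w: "w \<in> carrier G" using assms unfolding normal_forms_def by auto
  have "inv x \<otimes> w = inv a \<otimes> (x \<otimes> w)" using w by (simp add: a_def inv_mult_group m_assoc inv_cancel)
  also have "\<dots> \<in> normal_forms"
    unfolding n_unit_inv[symmetric] by (intro normal_forms_n normal_forms_x assms)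
  finally show "inv x \<otimes> w \<in> normal_forms" .
  have "inv y \<otimes> w = inv b \<otimes> (y \<otimes> w)" using w by (simp add: b_def inv_mult_group m_assoc inv_cancel)
  also have "\<dots> \<in> normal_forms"
    unfolding n_unit_inv[symmetric] by (intro normal_forms_n normal_forms_y assms)
  finally show "inv y \<otimes> w \<in> normal_forms" .
qed


text \<open>An element of the abelian subgroup commutes with \<open>a\<close> and \<open>b\<close>,
  while \<open>x\<close> inverts \<open>b\<close> and both \<open>y\<close> and
  \<open>x \<otimes> y\<close> invert \<open>a\<close>. Membership would make \<open>a\<close> or
  \<open>b\<close> its own inverse, hence trivial for lack of 2-torsion.\<close>

lemma nontrivial_facts:
  assumes tf: "torsion_free_group G" and "x \<noteq> \<one>" "y \<noteq> \<one>"
  shows "u \<in> carrier G \<Longrightarrow> u \<otimes> u = \<one> \<Longrightarrow> u = \<one>"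
    and "a \<noteq> \<one>" "b \<noteq> \<one>" "c \<noteq> \<one>"
    and "x \<noteq> n i j k" "y \<noteq> n i j k" "x \<otimes> y \<noteq> n i j k"
proof -
  show sq: "u = \<one>" if "u \<in> carrier G" "u \<otimes> u = \<one>" for u
    using tf[unfolded torsion_free_group_def, rule_format, of u 2] that by (simp add: numeral_2_eq_2)
  show a1: "a \<noteq> \<one>" and b1: "b \<noteq> \<one>" using sq[OF x] sq[OF y] assms(2,3) by (auto simp only: a_def b_def)
  have inv1: "u = \<one>" if "u \<in> carrier G" "inv u = u" for u
    using sq[of u] that by (metis r_inv)
  have comm: "n i j k \<otimes> a = a \<otimes> n i j k" "n i j k \<otimes> b = b \<otimes> n i j k" for i j k
    unfolding n_unit(1,2)[symmetric] by (simp_all add: n_add add.commute)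
  show "x \<noteq> n i j k" for i j k
  proof
    assume eq: "x = n i j k"
    have "x \<otimes> b = b \<otimes> x" using comm(2)[of i j k] unfolding eq[symmetric] .
    hence "inv b \<otimes> x = b \<otimes> x" using xb by simp
    thus False using inv1[of b] b1 by simp
  qed
  show "y \<noteq> n i j k" for i j k
  proof
    assume eq: "y = n i j k"
    have "y \<otimes> a = a \<otimes> y" using comm(1)[of i j k] unfolding eq[symmetric] .
    hence "inv a \<otimes> y = a \<otimes> y" using ya by simp
    thus False using inv1[of a] a1 by simp
  qed
  show xy: "x \<otimes> y \<noteq> n i j k" for i j k
  proof
    assume eq: "x \<otimes> y = n i j k"
    have "x \<otimes> y \<otimes> a = a \<otimes> (x \<otimes> y)" using comm(1)[of i j k] unfolding eq[symmetric] .
    moreover have "x \<otimes> y \<otimes> a = (x \<otimes> inv a) \<otimes> y" by (simp add: m_assoc ya)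
    hence "x \<otimes> y \<otimes> a = inv a \<otimes> (x \<otimes> y)"
      by (simp add: inv_pow_comm[OF x abc(1) xa] m_assoc)
    ultimately have "inv a \<otimes> (x \<otimes> y) = a \<otimes> (x \<otimes> y)" by simp
    thus False using inv1[of a] a1 by simp
  qed
  show "c \<noteq> \<one>"
  proof
    assume "c = \<one>"
    hence "(x \<otimes> y) \<otimes> (x \<otimes> y) = \<one>" by (simp add: c_def m_assoc)
    hence "x \<otimes> y = n 0 0 0" using sq[of "x \<otimes> y"] by (simp add: n_unit)
    thus False using xy by blast
  qed
qed

lemma int_pow_eq_one:
  assumes tf: "torsion_free_group G" and u: "u \<in> carrier G" "u \<noteq> \<one>" and "u [^] (i::int) = \<one>"
  shows "i = 0"
proof (rule ccontr)
  assume i: "i \<noteq> 0"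
  have "u [^] \<bar>i\<bar> = \<one>"
    using assms(4) u by (cases "i \<ge> 0") (simp_all add: int_pow_neg)
  hence "u [^] nat \<bar>i\<bar> = \<one>"
    using int_pow_int[of G u "nat \<bar>i\<bar>"] by simp
  moreover have "nat \<bar>i\<bar> > 0" using i by simp
  ultimately show False using tf u unfolding torsion_free_group_def by blast
qed

text \<open>Conjugating \<open>n i j k = \<one>\<close> by \<open>x\<close> and by \<open>y\<close>
  changes two signs each time. The product of any two of the three equations is an even power of a
  single generator, and the generators have infinite order.\<close>

lemma normal_form_eq_one:
  assumes tf: "torsion_free_group G" and nt: "x \<noteq> \<one>" "y \<noteq> \<one>"
    and e: "e \<in> {\<one>, x, y, x \<otimes> y}" and one: "n i j k \<otimes> e = \<one>"
  shows "i = 0 \<and> j = 0 \<and> k = 0 \<and> e = \<one>"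
proof -
  note facts = nontrivial_facts[OF tf nt]
  have "e \<in> carrier G" using e by auto
  hence "e = n (-i) (-j) (-k)" using one by (metis inv_equality inv_inv n_closed n_inv)
  hence e1: "e = \<one>" using e facts(5-7)[symmetric] by auto
  hence one: "n i j k = \<one>" using one by simp
  have "n i (-j) (-k) \<otimes> x = x" "n (-i) j (-k) \<otimes> y = y"
    using x_n[of i j k] y_n[of i j k] by (simp_all add: one)
  hence xy1: "n i (-j) (-k) = \<one>" "n (-i) j (-k) = \<one>" by simp_all
  have "n i j k \<otimes> n i (-j) (-k) = \<one>" "n i j k \<otimes> n (-i) j (-k) = \<one>"
    "n i (-j) (-k) \<otimes> n (-i) j (-k) = \<one>"
    by (simp_all only: one xy1 r_one one_closed)
  hence "a [^] (i + i) = \<one>" "b [^] (j + j) = \<one>" "c [^] (- k + - k) = \<one>"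
    unfolding n_add by (simp_all add: n_def)
  hence "i + i = 0" "j + j = 0" "- k + - k = 0"
    using int_pow_eq_one[OF tf abc(1) facts(2)] int_pow_eq_one[OF tf abc(2) facts(3)]
      int_pow_eq_one[OF tf abc(3) facts(4)] by blast+
  thus ?thesis using e1 by simp
qed

fun letter where "letter (g, s) = (let u = (case g of X \<Rightarrow> x | Y \<Rightarrow> y) in if s then u else inv u)"

definition word where "word w = foldr (\<lambda>l u. letter l \<otimes> u) w \<one>"

lemma letter_closed [simp]: "letter l \<in> carrier G"
  by (cases l) (auto simp: Let_def split: HW_generator.splits)

lemma word_Cons [simp]: "word [] = \<one>" "word (l # w) = letter l \<otimes> word w"
  by (simp_all add: word_def)

lemma word_closed [simp]: "word w \<in> carrier G"
  by (induction w) simp_all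

lemma word_append: "word (u @ v) = word u \<otimes> word v"
  by (induction u) (simp_all add: m_assoc)

lemma word_cong_word: "word_cong HW_relations u v \<Longrightarrow> word u = word v"
proof (induction rule: word_cong.induct)
  case (cancel l s)
  show ?case by (cases l; cases s) (simp_all add: Let_def)
next
  case (relation u v)
  thus ?case using rel1 rel2 by (auto simp: Let_def m_assoc inv_mult_group)
qed (simp_all add: word_append)

lemma word_normal_form: "word w \<in> normal_forms"
proof (induction w)
  case Nil show ?case using normal_formsI[of \<one> 0 0 0] by (simp add: n_unit)
next
  case (Cons l w)
  thus ?case by (cases l) (auto simp: Let_def normal_forms_x normal_forms_y normal_forms_inv split: HW_generator.splits)
qed

end

section \<open>The presented group as an instance and as a subgroup\<close>

lemma Hantzsche_Wendt_pair:
  fixes C :: "HW_generator word \<Rightarrow> HW_generator word set"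
  defines "C \<equiv> \<lambda>u. {w. word_cong HW_relations u w}"
  shows "HW_pair Hantzsche_Wendt_group (C [(X, True)]) (C [(Y, True)])"
    and "inv\<^bsub>Hantzsche_Wendt_group\<^esub> (C [(X, True)]) = C [(X, False)]"
    and "inv\<^bsub>Hantzsche_Wendt_group\<^esub> (C [(Y, True)]) = C [(Y, False)]"
    and "carrier Hantzsche_Wendt_group = range C"
    and "C u \<otimes>\<^bsub>Hantzsche_Wendt_group\<^esub> C v = C (u @ v)"
    and "\<one>\<^bsub>Hantzsche_Wendt_group\<^esub> = C []"
    and "C u = C v \<longleftrightarrow> word_cong HW_relations u v"
proof -
  note P = Hantzsche_Wendt_group_def
  interpret P: group Hantzsche_Wendt_group unfolding P by (rule group_presented_group)
  show car: "carrier Hantzsche_Wendt_group = range C"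
    unfolding P C_def by (rule presented_group_simps)
  show mult: "C u \<otimes>\<^bsub>Hantzsche_Wendt_group\<^esub> C v = C (u @ v)" for u v
    unfolding P C_def by (rule presented_group_simps)
  show one: "\<one>\<^bsub>Hantzsche_Wendt_group\<^esub> = C []"
    unfolding P C_def by (rule presented_group_simps)
  show eq: "C u = C v \<longleftrightarrow> word_cong HW_relations u v" for u v
    unfolding C_def by (auto intro: word_cong.trans word_cong.sym word_cong.refl)
  have inv: "inv\<^bsub>Hantzsche_Wendt_group\<^esub> (C [(g, True)]) = C [(g, False)]" for g
  proof (rule P.inv_equality)
    have "C [(g, False), (g, True)] = C []"
      unfolding eq using word_cong.cancel[of _ g False] by simp
    thus "C [(g, False)] \<otimes>\<^bsub>Hantzsche_Wendt_group\<^esub> C [(g, True)] = \<one>\<^bsub>Hantzsche_Wendt_group\<^esub>"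
      by (simp add: mult one)
  qed (simp_all add: car)
  thus "inv\<^bsub>Hantzsche_Wendt_group\<^esub> (C [(X, True)]) = C [(X, False)]"
    "inv\<^bsub>Hantzsche_Wendt_group\<^esub> (C [(Y, True)]) = C [(Y, False)]" by blast+
  show "HW_pair Hantzsche_Wendt_group (C [(X, True)]) (C [(Y, True)])"
  proof
    have 2: "inv\<^bsub>Hantzsche_Wendt_group\<^esub> (C [(g, True), (g, True)]) = C [(g, False), (g, False)]" for g
      using P.inv_mult_group[of "C [(g, True)]" "C [(g, True)]"] by (simp add: car inv mult)
    show "C [(X, True)] \<in> carrier Hantzsche_Wendt_group" "C [(Y, True)] \<in> carrier Hantzsche_Wendt_group"
      by (simp_all add: car)
    show "inv\<^bsub>Hantzsche_Wendt_group\<^esub> C [(X, True)] \<otimes>\<^bsub>Hantzsche_Wendt_group\<^esub>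
        (C [(Y, True)] \<otimes>\<^bsub>Hantzsche_Wendt_group\<^esub> C [(Y, True)]) \<otimes>\<^bsub>Hantzsche_Wendt_group\<^esub> C [(X, True)]
      = inv\<^bsub>Hantzsche_Wendt_group\<^esub> (C [(Y, True)] \<otimes>\<^bsub>Hantzsche_Wendt_group\<^esub> C [(Y, True)])"
      "inv\<^bsub>Hantzsche_Wendt_group\<^esub> C [(Y, True)] \<otimes>\<^bsub>Hantzsche_Wendt_group\<^esub>
        (C [(X, True)] \<otimes>\<^bsub>Hantzsche_Wendt_group\<^esub> C [(X, True)]) \<otimes>\<^bsub>Hantzsche_Wendt_group\<^esub> C [(Y, True)]
      = inv\<^bsub>Hantzsche_Wendt_group\<^esub> (C [(X, True)] \<otimes>\<^bsub>Hantzsche_Wendt_group\<^esub> C [(X, True)])"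
      by (simp_all add: mult inv 2 eq word_cong.relation)
  qed
qed

text \<open>For injectivity, an element of the presented group is put into normal form there. The
  homomorphism keeps the exponents, and in \<open>G\<close> torsion-freeness forces a trivial normal
  form to have zero exponents.\<close>

lemma (in HW_pair) contains_Hantzsche_Wendt_group:
  assumes tf: "torsion_free_group G" and nt: "x \<noteq> \<one>" "y \<noteq> \<one>"
  shows "contains_subgroup_isomorphic G Hantzsche_Wendt_group"
proof -
  let ?P = "Hantzsche_Wendt_group"
  define C where "C u = {w. word_cong HW_relations u w}" for u
  note P = Hantzsche_Wendt_pair[folded C_def]
  interpret P: HW_pair ?P "C [(X, True)]" "C [(Y, True)]" by (rule P(1))
  have wordP: "P.word u = C u" for u
  proof (induction u)
    case (Cons l u)
    have "P.letter l = C [l]" by (cases l) (auto simp: Let_def P(2,3) split: HW_generator.splits)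
    thus ?case using Cons by (simp add: P(5))
  qed (simp add: P(6))
  \<comment> \<open>The value does not depend on the representative picked by \<open>SOME\<close>,
    because congruent words have equal values (\<open>word_cong_word\<close>).\<close>
  define \<phi> where "\<phi> A = word (SOME u. C u = A)" for A
  have \<phi>: "\<phi> (C u) = word u" for u
  proof -
    have "C (SOME v. C v = C u) = C u" by (rule someI) simp
    thus ?thesis unfolding \<phi>_def using word_cong_word P(7) by blast
  qed
  have hom: "\<phi> \<in> hom ?P G"
    by (rule homI) (auto simp: P(4,5) \<phi> word_append)
  interpret \<phi>: group_hom ?P G \<phi>
    by unfold_locales (rule hom)
  have \<phi>xy: "\<phi> (C [(X, True)]) = x" "\<phi> (C [(Y, True)]) = y"
    by (simp_all add: \<phi> Let_def)
  have \<phi>n: "\<phi> (P.n i j k) = n i j k" for i j k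
    by (simp add: P.n_def P.a_def P.b_def P.c_def n_def a_def b_def c_def \<phi>xy \<phi>.hom_int_pow)
  have "A = \<one>\<^bsub>?P\<^esub>" if A: "A \<in> carrier ?P" "\<phi> A = \<one>" for A
  proof -
    obtain u where "A = P.word u" using A(1) wordP P(4) by auto
    then obtain i j k e where nf: "A = P.n i j k \<otimes>\<^bsub>?P\<^esub> e"
      and e: "e \<in> {\<one>\<^bsub>?P\<^esub>, C [(X, True)], C [(Y, True)], C [(X, True)] \<otimes>\<^bsub>?P\<^esub> C [(Y, True)]}"
      using P.word_normal_form[of u] unfolding P.normal_forms_def by blast
    have ec: "e \<in> carrier ?P" using e by auto
    have "n i j k \<otimes> \<phi> e = \<one>" using A(2) ec by (simp add: nf \<phi>n)
    moreover have e': "\<phi> e \<in> {\<one>, x, y, x \<otimes> y}" using e by (auto simp: \<phi>xy)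
    ultimately have z: "i = 0" "j = 0" "k = 0" "\<phi> e = \<one>"
      using normal_form_eq_one[OF tf nt e'] by blast+
    have "x \<otimes> y \<noteq> \<one>" using nontrivial_facts(7)[OF tf nt, of 0 0 0] by (simp add: n_unit)
    hence "e = \<one>\<^bsub>?P\<^esub>" using e z(4) nt by (auto simp: \<phi>xy)
    thus ?thesis by (simp add: nf z P.n_unit)
  qed
  hence inj: "inj_on \<phi> (carrier ?P)" by (simp add: \<phi>.inj_on_one_iff)
  let ?H = "\<phi> ` carrier ?P"
  have "\<phi> \<in> iso ?P (G\<lparr>carrier := ?H\<rparr>)"
    unfolding iso_def bij_betw_def using inj hom by (auto simp: hom_def)
  hence "G\<lparr>carrier := ?H\<rparr> \<cong> ?P"
    by (intro P.iso_sym) (rule is_isoI)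
  thus ?thesis
    unfolding contains_subgroup_isomorphic_def using \<phi>.img_is_subgroup by blast
qed

text \<open>The converse, for the five-dimensional group: excluding the subgroup reduces to
  excluding a pair of elements.\<close>

lemma Hantzsche_Wendt_pair_of_subgroup:
  assumes "group G" "contains_subgroup_isomorphic G Hantzsche_Wendt_group"
  obtains x y where "HW_pair G x y" "x \<noteq> \<one>\<^bsub>G\<^esub>" "y \<noteq> \<one>\<^bsub>G\<^esub>"
proof -
  let ?P = "Hantzsche_Wendt_group"
  define C where "C u = {w. word_cong HW_relations u w}" for u
  note P = Hantzsche_Wendt_pair[folded C_def]
  interpret P: HW_pair ?P "C [(X, True)]" "C [(Y, True)]" by (rule P(1))
  interpret G: group G by fact
  obtain H where H: "subgroup H G" "G\<lparr>carrier := H\<rparr> \<cong> ?P"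
    using assms(2) unfolding contains_subgroup_isomorphic_def by blast
  interpret H: group "G\<lparr>carrier := H\<rparr>" using H(1) by (rule G.subgroup_imp_group)
  obtain \<phi> where iso: "\<phi> \<in> iso ?P (G\<lparr>carrier := H\<rparr>)"
    using H.iso_sym[OF H(2)] unfolding is_iso_def by blast
  hence "\<phi> \<in> hom ?P (G\<lparr>carrier := H\<rparr>)" and inj: "inj_on \<phi> (carrier ?P)"
    by (auto simp: iso_def bij_betw_def)
  moreover have "H \<subseteq> carrier G" using H(1) subgroup.subset by blast
  ultimately have hom: "\<phi> \<in> hom ?P G" unfolding hom_def by auto
  interpret \<phi>: group_hom ?P G \<phi> by unfold_locales (rule hom)
  let ?x = "C [(X, True)]" and ?y = "C [(Y, True)]"
  \<comment> \<open>The sum of the exponents modulo 4 is invariant, so the generators are nontrivial.\<close>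
  define ex where "ex u = (\<Sum>l\<leftarrow>u. if snd l then 1 else -1 :: int)" for u :: "HW_generator word"
  have ex: "ex u mod 4 = ex v mod 4" if "word_cong HW_relations u v" for u v
    using that
  proof (induction rule: word_cong.induct)
    case (append u u' v v')
    have "ex (u @ v) = ex u + ex v" "ex (u' @ v') = ex u' + ex v'" by (simp_all add: ex_def)
    thus ?case using mod_add_cong[OF append.IH] by simp
  qed (auto simp: ex_def)
  have "\<not> word_cong HW_relations [(g, True)] []" for g
    using ex[of "[(g, True)]" "[]"] by (auto simp: ex_def)
  hence "?x \<noteq> \<one>\<^bsub>?P\<^esub>" "?y \<noteq> \<one>\<^bsub>?P\<^esub>" by (simp_all add: P(6,7))
  hence ne: "\<phi> ?x \<noteq> \<one>\<^bsub>G\<^esub>" "\<phi> ?y \<noteq> \<one>\<^bsub>G\<^esub>"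
    using inj \<phi>.inj_on_one_iff P.x P.y by blast+
  have "HW_pair G (\<phi> ?x) (\<phi> ?y)"
  proof
    note hom = \<phi>.hom_mult \<phi>.hom_inv P.x P.y P.m_closed P.inv_closed
    show "inv\<^bsub>G\<^esub> \<phi> ?x \<otimes>\<^bsub>G\<^esub> (\<phi> ?y \<otimes>\<^bsub>G\<^esub> \<phi> ?y) \<otimes>\<^bsub>G\<^esub> \<phi> ?x = inv\<^bsub>G\<^esub> (\<phi> ?y \<otimes>\<^bsub>G\<^esub> \<phi> ?y)"
      using arg_cong[OF P.rel1, of \<phi>] by (simp only: hom)
    show "inv\<^bsub>G\<^esub> \<phi> ?y \<otimes>\<^bsub>G\<^esub> (\<phi> ?x \<otimes>\<^bsub>G\<^esub> \<phi> ?x) \<otimes>\<^bsub>G\<^esub> \<phi> ?y = inv\<^bsub>G\<^esub> (\<phi> ?x \<otimes>\<^bsub>G\<^esub> \<phi> ?x)"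
      using arg_cong[OF P.rel2, of \<phi>] by (simp only: hom)
  qed (simp_all only: \<phi>.hom_closed P.x P.y)
  thus thesis using that ne by blast
qed

text \<open>Take the points of \<open>A\<close> where \<open>\<phi>\<close> is largest and move them
  into the kernel by a right multiplication, which commutes with the left multiplications of an
  extremal point. If \<open>\<phi> g\<close> is not zero, then \<open>g\<close> or its inverse leads
  above the maximum and out of \<open>A\<close>, so only \<open>g\<close> in the kernel
  matter.\<close>

lemma diffuse_by_ordered_quotient:
  fixes \<phi> :: "'g \<Rightarrow> real"
  assumes "group G" and \<phi>: "\<And>g h. g \<in> carrier G \<Longrightarrow> h \<in> carrier G \<Longrightarrow> \<phi> (g \<otimes>\<^bsub>G\<^esub> h) = \<phi> g + \<phi> h"
    and K: "diffuse_group (G\<lparr>carrier := {g \<in> carrier G. \<phi> g = 0}\<rparr>)"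
  shows "diffuse_group G"
  unfolding diffuse_group_def
proof (intro allI impI)
  interpret group G by fact
  let ?K = "{g \<in> carrier G. \<phi> g = 0}"
  have \<phi>1: "\<phi> \<one>\<^bsub>G\<^esub> = 0" using \<phi>[of "\<one>\<^bsub>G\<^esub>" "\<one>\<^bsub>G\<^esub>"] by simp
  have \<phi>inv: "\<phi> (inv\<^bsub>G\<^esub> g) = - \<phi> g" if "g \<in> carrier G" for g
    using \<phi>[of g "inv\<^bsub>G\<^esub> g"] that by (simp add: \<phi>1)
  have sub: "subgroup ?K G"
  proof (rule subgroupI)
    show "?K \<noteq> {}" using \<phi>1 one_closed by blast
  qed (simp_all add: \<phi> \<phi>inv subset_iff)
  fix A assume A: "A \<subseteq> carrier G \<and> finite A \<and> A \<noteq> {}"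
  define m where "m = Max (\<phi> ` A)"
  have m: "\<phi> a \<le> m" if "a \<in> A" for a using A that by (simp add: m_def)
  have "m \<in> \<phi> ` A" unfolding m_def using A by (intro Max_in) auto
  then obtain a0 where a0: "a0 \<in> A" "\<phi> a0 = m" by blast
  have a0c: "a0 \<in> carrier G" using A a0 by blast
  define B where "B = (\<lambda>a. a \<otimes>\<^bsub>G\<^esub> inv\<^bsub>G\<^esub> a0) ` {a \<in> A. \<phi> a = m}"
  have "B \<subseteq> ?K"
  proof
    fix b assume "b \<in> B"
    then obtain a where a: "a \<in> A" "\<phi> a = m" "b = a \<otimes>\<^bsub>G\<^esub> inv\<^bsub>G\<^esub> a0" by (auto simp: B_def)
    moreover have "a \<in> carrier G" using A a by blast
    ultimately show "b \<in> ?K" using a0 a0c by (simp add: \<phi> \<phi>inv)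
  qed
  moreover have "finite B" "B \<noteq> {}" using A a0 by (auto simp: B_def)
  ultimately have "B \<subseteq> carrier (G\<lparr>carrier := ?K\<rparr>) \<and> finite B \<and> B \<noteq> {}" by simp
  hence "\<exists>b. extremal_point (G\<lparr>carrier := ?K\<rparr>) B b"
    using K unfolding diffuse_group_def by blast
  then obtain b where b: "extremal_point (G\<lparr>carrier := ?K\<rparr>) B b" ..
  have Bmem: "k \<otimes>\<^bsub>G\<^esub> a0 \<in> {a \<in> A. \<phi> a = m} \<longleftrightarrow> k \<in> B" if "k \<in> carrier G" for k
  proof
    assume "k \<otimes>\<^bsub>G\<^esub> a0 \<in> {a \<in> A. \<phi> a = m}"
    moreover have "k = k \<otimes>\<^bsub>G\<^esub> a0 \<otimes>\<^bsub>G\<^esub> inv\<^bsub>G\<^esub> a0" using that a0c by (simp add: m_assoc)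
    ultimately show "k \<in> B" unfolding B_def by blast
  next
    assume "k \<in> B"
    then obtain a where a: "a \<in> A" "\<phi> a = m" "k = a \<otimes>\<^bsub>G\<^esub> inv\<^bsub>G\<^esub> a0" by (auto simp: B_def)
    moreover have "a \<in> carrier G" using A a by blast
    ultimately show "k \<otimes>\<^bsub>G\<^esub> a0 \<in> {a \<in> A. \<phi> a = m}" using a0c by (simp add: m_assoc)
  qed
  have bB: "b \<in> B" and bK: "b \<in> ?K" using b \<open>B \<subseteq> ?K\<close> by (auto simp: extremal_point_def)
  hence bc: "b \<in> carrier G" by simp
  let ?a = "b \<otimes>\<^bsub>G\<^esub> a0"
  have aA: "?a \<in> A" "\<phi> ?a = m" using Bmem[OF bc] bB by auto
  have ac: "?a \<in> carrier G" using bc a0c by simp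
  have "extremal_point G A ?a"
    unfolding extremal_point_def
  proof (intro conjI ballI)
    show "?a \<in> A" by fact
  next
    fix g assume g: "g \<in> carrier G - {\<one>\<^bsub>G\<^esub>}"
    show "g \<otimes>\<^bsub>G\<^esub> ?a \<notin> A \<or> inv\<^bsub>G\<^esub> g \<otimes>\<^bsub>G\<^esub> ?a \<notin> A"
    proof (rule ccontr)
      assume "\<not> ?thesis"
      hence in1: "g \<otimes>\<^bsub>G\<^esub> ?a \<in> A" and in2: "inv\<^bsub>G\<^esub> g \<otimes>\<^bsub>G\<^esub> ?a \<in> A" by auto
      have "\<phi> g + m \<le> m" "- \<phi> g + m \<le> m"
        using m[OF in1] m[OF in2] g \<phi>[OF _ ac] by (simp_all add: \<phi>inv aA(2))
      hence "\<phi> g = 0" by simp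
      hence gK: "g \<in> ?K" "inv\<^bsub>G\<^esub> g \<in> ?K" using g by (auto simp: \<phi>inv)
      hence "g \<otimes>\<^bsub>G\<^esub> b \<in> B" "inv\<^bsub>G\<^esub> g \<otimes>\<^bsub>G\<^esub> b \<in> B"
        using Bmem[of "g \<otimes>\<^bsub>G\<^esub> b"] Bmem[of "inv\<^bsub>G\<^esub> g \<otimes>\<^bsub>G\<^esub> b"] in1 in2 g ac aA bc a0c
        by (simp_all add: m_assoc \<phi>)
      moreover have "inv\<^bsub>G\<lparr>carrier := ?K\<rparr>\<^esub> g = inv\<^bsub>G\<^esub> g"
        using m_inv_consistent[OF sub] gK by simp
      moreover have "g \<in> carrier (G\<lparr>carrier := ?K\<rparr>) - {\<one>\<^bsub>G\<lparr>carrier := ?K\<rparr>\<^esub>}" using g gK by simp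
      hence "g \<otimes>\<^bsub>G\<lparr>carrier := ?K\<rparr>\<^esub> b \<notin> B \<or> inv\<^bsub>G\<lparr>carrier := ?K\<rparr>\<^esub> g \<otimes>\<^bsub>G\<lparr>carrier := ?K\<rparr>\<^esub> b \<notin> B"
        using b unfolding extremal_point_def by blast
      ultimately show False by simp
    qed
  qed
  thus "\<exists>a. extremal_point G A a" ..
qed

section \<open>Finiteness of the holonomy\<close>

text \<open>\<open>\<rho> \<one>\<close> is only a projection, not the identity, so that an action can be restricted to the span of
  its translations without changing the type.\<close>

locale isometric_action = group G for G (structure) +
  fixes \<rho> :: "'g \<Rightarrow> 'a::euclidean_space \<Rightarrow>\<^sub>L 'a" and \<tau> :: "'g \<Rightarrow> 'a"
  assumes \<rho>_mult: "g \<in> carrier G \<Longrightarrow> h \<in> carrier G \<Longrightarrow> \<rho> (g \<otimes> h) = \<rho> g o\<^sub>L \<rho> h"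
    and \<tau>_mult: "g \<in> carrier G \<Longrightarrow> h \<in> carrier G \<Longrightarrow> \<tau> (g \<otimes> h) = \<tau> g + \<rho> g (\<tau> h)"
    and \<rho>_inner: "g \<in> carrier G \<Longrightarrow> \<rho> g v \<bullet> \<rho> g w = \<rho> \<one> v \<bullet> w"
    and \<tau>_fixed: "g \<in> carrier G \<Longrightarrow> \<rho> \<one> (\<tau> g) = \<tau> g"
begin

lemma \<rho>_mult_apply [simp]: "g \<in> carrier G \<Longrightarrow> h \<in> carrier G \<Longrightarrow> \<rho> (g \<otimes> h) v = \<rho> g (\<rho> h v)"
  by (simp add: \<rho>_mult)

lemma \<rho>_one [simp]: "g \<in> carrier G \<Longrightarrow> \<rho> \<one> (\<rho> g v) = \<rho> g v" "g \<in> carrier G \<Longrightarrow> \<rho> g (\<rho> \<one> v) = \<rho> g v"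
  using \<rho>_mult_apply[of \<one> g v] \<rho>_mult_apply[of g \<one> v] by (simp_all del: \<rho>_mult_apply)

lemma \<rho>_inv [simp]:
  "g \<in> carrier G \<Longrightarrow> \<rho> (inv g) (\<rho> g v) = \<rho> \<one> v" "g \<in> carrier G \<Longrightarrow> \<rho> g (\<rho> (inv g) v) = \<rho> \<one> v"
  using \<rho>_mult_apply[of "inv g" g v] \<rho>_mult_apply[of g "inv g" v] by (simp_all del: \<rho>_mult_apply)

lemma inner_projection: "\<rho> \<one> v \<bullet> w = v \<bullet> \<rho> \<one> w"
  using \<rho>_inner[of \<one> v w] \<rho>_inner[of \<one> w v] by (simp add: inner_commute)

lemma inner_adjoint: "g \<in> carrier G \<Longrightarrow> \<rho> g v \<bullet> w = v \<bullet> \<rho> (inv g) w"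
  using \<rho>_inner[of "inv g" "\<rho> g v" w] by (simp add: inner_projection)

lemma norm_\<rho>: "g \<in> carrier G \<Longrightarrow> norm (\<rho> g v) = norm (\<rho> \<one> v)"
  using \<rho>_inner[of g v v] \<rho>_inner[of \<one> v v] by (simp add: norm_eq_sqrt_inner)

lemma norm_\<rho>_le: "g \<in> carrier G \<Longrightarrow> norm (\<rho> g v) \<le> norm v"
proof -
  assume g: "g \<in> carrier G"
  have "norm (\<rho> \<one> v) * norm (\<rho> \<one> v) = \<rho> \<one> v \<bullet> v"
    using \<rho>_inner[of \<one> v v] by (simp flip: power2_eq_square power2_norm_eq_inner)
  also have "\<dots> \<le> norm (\<rho> \<one> v) * norm v" by (rule norm_cauchy_schwarz)
  finally have "norm (\<rho> \<one> v) \<le> norm v" by (cases "\<rho> \<one> v = 0") auto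
  thus ?thesis using norm_\<rho>[OF g] by simp
qed

lemma \<tau>_one [simp]: "\<tau> \<one> = 0"
  using \<tau>_mult[of \<one> \<one>] \<tau>_fixed[of \<one>] by simp

lemma \<tau>_inv: "g \<in> carrier G \<Longrightarrow> \<tau> (inv g) = - \<rho> (inv g) (\<tau> g)"
  using \<tau>_mult[of "inv g" g] by (simp add: eq_neg_iff_add_eq_0)

lemma \<rho>_\<rho>_one [simp]: "g \<in> carrier G \<Longrightarrow> \<rho> g (\<tau> \<one>) = 0"
  by (simp add: blinfun.zero_right)

section \<open>Size of rotations and of their commutators\<close>

definition rot :: "'g \<Rightarrow> real" where "rot g = norm (\<rho> g - \<rho> \<one>)"

lemma rot_nonneg [simp]: "0 \<le> rot g" by (simp add: rot_def)

lemma rot_eq_0: "rot g = 0 \<longleftrightarrow> \<rho> g = \<rho> \<one>" by (simp add: rot_def)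

lemma rot_apply: "norm (\<rho> g v - \<rho> \<one> v) \<le> rot g * norm v"
  using norm_blinfun[of "\<rho> g - \<rho> \<one>" v] by (simp add: rot_def blinfun.diff_left)

lemma rot_bound: "0 \<le> b \<Longrightarrow> (\<And>v. norm (\<rho> g v - \<rho> \<one> v) \<le> b * norm v) \<Longrightarrow> rot g \<le> b"
  unfolding rot_def by (rule norm_blinfun_bound) (simp_all add: blinfun.diff_left)

definition comm where "comm g h = g \<otimes> h \<otimes> inv g \<otimes> inv h"

lemma comm_closed [simp]: "g \<in> carrier G \<Longrightarrow> h \<in> carrier G \<Longrightarrow> comm g h \<in> carrier G"
  by (simp add: comm_def)

lemma rot_conj: assumes "g \<in> carrier G" "h \<in> carrier G" shows "rot (g \<otimes> h \<otimes> inv g) \<le> rot h"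
proof (rule rot_bound)
  fix v
  have "\<rho> (g \<otimes> h \<otimes> inv g) v - \<rho> \<one> v = \<rho> g (\<rho> h (\<rho> (inv g) v) - \<rho> \<one> (\<rho> (inv g) v))"
    using assms by (simp add: blinfun.diff_right)
  hence "norm (\<rho> (g \<otimes> h \<otimes> inv g) v - \<rho> \<one> v) \<le> norm (\<rho> h (\<rho> (inv g) v) - \<rho> \<one> (\<rho> (inv g) v))"
    using norm_\<rho>_le[OF assms(1)] by metis
  also have "\<dots> \<le> rot h * norm (\<rho> (inv g) v)" by (rule rot_apply)
  also have "\<dots> \<le> rot h * norm v" using norm_\<rho>_le[of "inv g" v] assms by (simp add: mult_left_mono)
  finally show "norm (\<rho> (g \<otimes> h \<otimes> inv g) v - \<rho> \<one> v) \<le> rot h * norm v" .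
qed simp

lemma rot_comm_aux:
  assumes gh: "g \<in> carrier G" "h \<in> carrier G" and b: "0 \<le> b"
    and bound: "\<And>v. norm (\<rho> g (\<rho> h v) - \<rho> h (\<rho> g v)) \<le> b * norm v"
  shows "rot (comm g h) \<le> b"
proof (rule rot_bound)
  fix v
  let ?v = "\<rho> (inv g) (\<rho> (inv h) v)"
  have "\<rho> (comm g h) v - \<rho> \<one> v = \<rho> g (\<rho> h ?v) - \<rho> h (\<rho> g ?v)"
    using gh by (simp add: comm_def)
  also have "norm \<dots> \<le> b * norm ?v" by (rule bound)
  also have "norm ?v \<le> norm v"
    using norm_\<rho>_le[of "inv g" "\<rho> (inv h) v"] norm_\<rho>_le[of "inv h" v] gh by simp
  finally show "norm (\<rho> (comm g h) v - \<rho> \<one> v) \<le> b * norm v" using b by (simp add: mult_left_mono)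
qed (rule b)

text \<open>With \<open>A\<close> and \<open>B\<close> for the differences of
  \<open>\<rho> g\<close> and \<open>\<rho> h\<close> from the identity,
  \<open>\<rho> g \<rho> h - \<rho> h \<rho> g = A B - B A\<close>. The first bound gains a factor
  at each iteration; the second does not mention \<open>rot g\<close> and so is uniform over all
  powers of \<open>g\<close>.\<close>

lemma rot_comm:
  assumes gh: "g \<in> carrier G" "h \<in> carrier G"
  shows "rot (comm g h) \<le> 2 * rot g * rot h" "rot (comm g h) \<le> 2 * rot h"
proof -
  show "rot (comm g h) \<le> 2 * rot g * rot h"
  proof (rule rot_comm_aux[OF gh])
    fix v
    let ?A = "\<lambda>v. \<rho> g v - \<rho> \<one> v" and ?B = "\<lambda>v. \<rho> h v - \<rho> \<one> v"
    have "\<rho> g (\<rho> h v) - \<rho> h (\<rho> g v) = ?A (?B v) - ?B (?A v)"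
      using gh by (simp add: blinfun.diff_right)
    also have "norm \<dots> \<le> norm (?A (?B v)) + norm (?B (?A v))" by (rule norm_triangle_ineq4)
    also have "\<dots> \<le> rot g * (rot h * norm v) + rot h * (rot g * norm v)"
      by (intro add_mono order_trans[OF rot_apply] mult_left_mono rot_apply rot_nonneg)
    finally show "norm (\<rho> g (\<rho> h v) - \<rho> h (\<rho> g v)) \<le> 2 * rot g * rot h * norm v" by (simp add: algebra_simps)
  qed simp
  show "rot (comm g h) \<le> 2 * rot h"
  proof (rule rot_comm_aux[OF gh])
    fix v
    let ?B = "\<lambda>v. \<rho> h v - \<rho> \<one> v"
    have "\<rho> g (\<rho> h v) - \<rho> h (\<rho> g v) = \<rho> g (?B v) - ?B (\<rho> g v)"
      using gh by (simp add: blinfun.diff_right)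
    also have "norm \<dots> \<le> norm (\<rho> g (?B v)) + norm (?B (\<rho> g v))" by (rule norm_triangle_ineq4)
    also have "\<dots> \<le> rot h * norm v + rot h * norm v"
      using gh by (intro add_mono order_trans[OF rot_apply] order_trans[OF norm_\<rho>_le] rot_apply mult_left_mono)
        (auto simp: norm_\<rho>_le)
    finally show "norm (\<rho> g (\<rho> h v) - \<rho> h (\<rho> g v)) \<le> 2 * rot h * norm v" by (simp add: algebra_simps)
  qed simp
qed

text \<open>By \<open>2 (d - 1) = (d^2 - 1) - (d - 1)^2\<close>, a rotation of size at most
  \<open>1 / 2\<close> grows at least by the factor \<open>3 / 2\<close> when squared, so the powers
  of a nontrivial rotation cannot all stay small.\<close>

lemma no_small_rotation_subgroups:
  assumes c: "c \<in> carrier G" and small: "\<And>k::nat. rot (c [^] k) \<le> 1 / 2"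
  shows "\<rho> c = \<rho> \<one>"
proof -
  have step: "3 / 2 * rot d \<le> rot (d \<otimes> d)" if d: "d \<in> carrier G" "rot d \<le> 1 / 2" for d
  proof -
    have "rot d \<le> (rot (d \<otimes> d) + rot d * rot d) / 2"
    proof (rule rot_bound)
      fix v
      let ?A = "\<lambda>v. \<rho> d v - \<rho> \<one> v"
      have "2 *\<^sub>R ?A v = (\<rho> (d \<otimes> d) v - \<rho> \<one> v) - ?A (?A v)"
        using d by (simp add: blinfun.diff_right scaleR_2)
      hence "2 * norm (?A v) = norm ((\<rho> (d \<otimes> d) v - \<rho> \<one> v) - ?A (?A v))"
        by (metis norm_scaleR abs_numeral)
      also have "\<dots> \<le> norm (\<rho> (d \<otimes> d) v - \<rho> \<one> v) + norm (?A (?A v))" by (rule norm_triangle_ineq4)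
      also have "\<dots> \<le> rot (d \<otimes> d) * norm v + rot d * (rot d * norm v)"
        by (intro add_mono order_trans[OF rot_apply] rot_apply mult_left_mono rot_nonneg order_refl)
      finally show "norm (?A v) \<le> (rot (d \<otimes> d) + rot d * rot d) / 2 * norm v" by (simp add: algebra_simps)
    qed simp
    moreover have "rot d * rot d \<le> 1 / 2 * rot d" using d by (intro mult_right_mono) auto
    ultimately show ?thesis by simp
  qed
  have pow: "(3 / 2) ^ j * rot c \<le> rot (c [^] (2 ^ j :: nat))" for j
  proof (induction j)
    case (Suc j)
    let ?d = "c [^] (2 ^ j :: nat)"
    have "(3 / 2) ^ Suc j * rot c = 3 / 2 * ((3 / 2) ^ j * rot c)" by simp
    also have "\<dots> \<le> 3 / 2 * rot ?d" using Suc by (intro mult_left_mono) simp_all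
    also have "\<dots> \<le> rot (?d \<otimes> ?d)" by (rule step) (use c small in auto)
    also have "?d \<otimes> ?d = c [^] (2 ^ Suc j :: nat)" using c by (simp add: nat_pow_mult mult_2)
    finally show ?case .
  qed (use c in simp)
  have "rot c = 0"
  proof (rule ccontr)
    assume "rot c \<noteq> 0"
    hence "rot c > 0" using rot_nonneg[of c] by linarith
    obtain j where "1 / rot c < (3 / 2) ^ j" using real_arch_pow[of "3 / 2" "1 / rot c"] by auto
    hence "1 < (3 / 2) ^ j * rot c" using \<open>rot c > 0\<close> by (simp add: field_simps)
    thus False using pow[of j] small[of "2 ^ j"] by linarith
  qed
  thus ?thesis by (simp add: rot_eq_0)
qed

text \<open>If the rotation part of \<open>g\<close> commutes with that of \<open>[g, h]\<close>, then the powers of \<open>[g, h]\<close>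
  have the same rotation parts as the commutators \<open>[g^k, h]\<close>, which all stay close to 1.\<close>

lemma comm_trivial_rotation:
  assumes gh: "g \<in> carrier G" "h \<in> carrier G" and small: "rot h \<le> 1 / 4"
    and comm: "\<And>v. \<rho> g (\<rho> (comm g h) v) = \<rho> (comm g h) (\<rho> g v)"
  shows "\<rho> (comm g h) = \<rho> \<one>"
proof (rule no_small_rotation_subgroups)
  let ?c = "comm g h"
  have cc: "?c \<in> carrier G" using gh by simp
  have commk: "\<rho> g (\<rho> (?c [^] k) v) = \<rho> (?c [^] k) (\<rho> g v)" for v and k :: nat
    by (induction k arbitrary: v) (use gh cc comm in simp_all)
  have "\<rho> (?c [^] k) v = \<rho> (comm (g [^] k) h) v" for v and k :: nat
  proof (induction k arbitrary: v)
    case 0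
    show ?case using gh by (simp add: comm_def)
  next
    case (Suc k)
    have "comm (g [^] Suc k) h = g \<otimes> comm (g [^] k) h \<otimes> inv g \<otimes> ?c"
      unfolding nat_pow_Suc2[OF gh(1)] using gh by (simp add: comm_def inv_mult_group m_assoc inv_cancel)
    hence "\<rho> (comm (g [^] Suc k) h) v = \<rho> g (\<rho> (?c [^] k) (\<rho> (inv g) (\<rho> ?c v)))"
      using gh cc Suc by simp
    also have "\<dots> = \<rho> (?c [^] Suc k) v" unfolding commk using gh cc by simp
    finally show ?case by simp
  qed
  hence "\<rho> (?c [^] k) = \<rho> (comm (g [^] k) h)" for k :: nat by (simp add: blinfun_eqI)
  hence "rot (?c [^] k) = rot (comm (g [^] k) h)" for k :: nat by (simp add: rot_def)
  hence *: "rot (?c [^] k) \<le> 2 * rot h" for k :: nat using rot_comm(2)[of "g [^] k" h] gh by simp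
  show "rot (?c [^] k) \<le> 1 / 2" for k :: nat using *[of k] small by linarith
qed (use gh in simp)

lemma \<tau>_comm:
  assumes gh: "g \<in> carrier G" "h \<in> carrier G"
  shows "\<tau> (comm g h) = (\<rho> g (\<tau> h) - \<rho> (comm g h) (\<tau> h)) + (\<tau> g - \<rho> (g \<otimes> h \<otimes> inv g) (\<tau> g))"
  using gh by (simp add: comm_def \<tau>_mult \<tau>_inv blinfun.minus_right blinfun.add_right blinfun.diff_right \<tau>_fixed)

fun iterated_comm where
  "iterated_comm g h 0 = h"
| "iterated_comm g h (Suc k) = comm g (iterated_comm g h k)"

lemma iterated_comm_closed [simp]: "g \<in> carrier G \<Longrightarrow> h \<in> carrier G \<Longrightarrow> iterated_comm g h k \<in> carrier G"
  by (induction k) simp_all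

text \<open>With rotations of size at most \<open>1 / 4\<close>, one commutation halves the
  rotation, by the factor \<open>2 * rot g\<close>. The translation is at most halved, up to an
  error proportional to the current rotation, which itself decays; the rate \<open>3 / 4\<close>
  lies above both and absorbs this error.\<close>

lemma iterated_comm_bounds:
  assumes gh: "g \<in> carrier G" "h \<in> carrier G" and small: "rot g \<le> 1 / 4" "rot h \<le> 1 / 4"
  shows "rot (iterated_comm g h k) \<le> (1 / 4) * (1 / 2) ^ k"
    and "norm (\<tau> (iterated_comm g h k)) \<le> (norm (\<tau> h) + 4 * norm (\<tau> g)) * (3 / 4) ^ k"
proof -
  show rot: "rot (iterated_comm g h k) \<le> (1 / 4) * (1 / 2) ^ k" for k
  proof (induction k)
    case (Suc k)
    have "rot (comm g (iterated_comm g h k)) \<le> 2 * rot g * rot (iterated_comm g h k)"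
      by (rule rot_comm) (use gh in auto)
    also have "\<dots> \<le> 2 * (1 / 4) * ((1 / 4) * (1 / 2) ^ k)"
      using small Suc by (intro mult_mono) auto
    finally show ?case by simp
  qed (use small in simp)
  show "norm (\<tau> (iterated_comm g h k)) \<le> (norm (\<tau> h) + 4 * norm (\<tau> g)) * (3 / 4) ^ k"
  proof (induction k)
    case (Suc k)
    let ?b = "iterated_comm g h k"
    let ?x = "\<tau> ?b"
    have b: "?b \<in> carrier G" using gh by simp
    have "norm (\<rho> g ?x - \<rho> (comm g ?b) ?x) \<le> norm (\<rho> g ?x - \<rho> \<one> ?x) + norm (\<rho> (comm g ?b) ?x - \<rho> \<one> ?x)"
      using norm_triangle_ineq4[of "\<rho> g ?x - \<rho> \<one> ?x" "\<rho> (comm g ?b) ?x - \<rho> \<one> ?x"] by simp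
    also have "\<dots> \<le> 1 / 4 * norm ?x + 1 / 4 * norm ?x"
    proof (intro add_mono order_trans[OF rot_apply] mult_right_mono small(1) norm_ge_zero)
      have "rot (comm g ?b) \<le> (1 / 4) * (1 / 2) ^ Suc k" using rot[of "Suc k"] by simp
      also have "\<dots> \<le> 1 / 4" using power_le_one[of "1 / 2 :: real" "Suc k"] by simp
      finally show "rot (comm g ?b) \<le> 1 / 4" .
    qed
    finally have 1: "norm (\<rho> g ?x - \<rho> (comm g ?b) ?x) \<le> 1 / 2 * norm ?x" by simp
    have "norm (\<tau> g - \<rho> (g \<otimes> ?b \<otimes> inv g) (\<tau> g)) \<le> rot ?b * norm (\<tau> g)"
    proof -
      have "norm (\<tau> g - \<rho> (g \<otimes> ?b \<otimes> inv g) (\<tau> g)) \<le> rot (g \<otimes> ?b \<otimes> inv g) * norm (\<tau> g)"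
        using rot_apply[of "g \<otimes> ?b \<otimes> inv g" "\<tau> g"] gh(1) by (simp add: norm_minus_commute \<tau>_fixed del: \<rho>_mult_apply)
      also have "\<dots> \<le> rot ?b * norm (\<tau> g)" by (intro mult_right_mono rot_conj gh b) simp
      finally show ?thesis .
    qed
    also have "\<dots> \<le> (1 / 4) * (1 / 2) ^ k * norm (\<tau> g)" by (intro mult_right_mono rot) simp
    also have "\<dots> \<le> (1 / 4) * (3 / 4) ^ k * norm (\<tau> g)"
      by (intro mult_right_mono mult_left_mono power_mono) auto
    finally have 2: "norm (\<tau> g - \<rho> (g \<otimes> ?b \<otimes> inv g) (\<tau> g)) \<le> (1 / 4) * (3 / 4) ^ k * norm (\<tau> g)" .
    have "norm (\<tau> (comm g ?b)) \<le> 1 / 2 * norm ?x + (1 / 4) * (3 / 4) ^ k * norm (\<tau> g)"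
      unfolding \<tau>_comm[OF gh(1) b] by (rule order_trans[OF norm_triangle_ineq]) (intro add_mono 1 2)
    also have "\<dots> \<le> 1 / 2 * ((norm (\<tau> h) + 4 * norm (\<tau> g)) * (3 / 4) ^ k) + (1 / 4) * (3 / 4) ^ k * norm (\<tau> g)"
      using Suc by simp
    also have "\<dots> \<le> (norm (\<tau> h) + 4 * norm (\<tau> g)) * (3 / 4) ^ Suc k"
      by (simp add: algebra_simps)
    finally show ?case by simp
  qed simp
qed

text \<open>For an orthogonal map, the image of its difference from the identity is orthogonal to
  the kernel of that difference.\<close>

lemma range_inter_kernel:
  assumes g: "g \<in> carrier G" and "x = \<rho> g y - \<rho> \<one> y" "\<rho> g x = x"
  shows "x = 0"
proof -
  have Px: "\<rho> \<one> x = x" using assms by (simp add: blinfun.diff_right)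
  have "\<rho> (inv g) x = x" using \<rho>_inv(1)[OF g, of x] assms(3) Px by simp
  hence "\<rho> g y \<bullet> x = y \<bullet> x" using inner_adjoint[OF g, of y x] by simp
  moreover have "\<rho> \<one> y \<bullet> x = y \<bullet> x" using Px by (simp add: inner_projection)
  ultimately have "x \<bullet> x = 0" using assms(2) by (simp add: inner_diff_left)
  thus ?thesis by simp
qed


lemma iterated_comm_eventually_one:
  assumes discrete: "0 < \<epsilon>" "\<And>g. g \<in> carrier G \<Longrightarrow> rot g < \<epsilon> \<Longrightarrow> norm (\<tau> g) < \<epsilon> \<Longrightarrow> g = \<one>"
    and gh: "g \<in> carrier G" "h \<in> carrier G" and small: "rot g \<le> 1 / 4" "rot h \<le> 1 / 4"
  obtains k where "iterated_comm g h (Suc k) = \<one>"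
proof -
  let ?M = "1 + (norm (\<tau> h) + 4 * norm (\<tau> g))"
  have M: "?M > 0" by (smt (verit) norm_ge_zero)
  then obtain k where "(3 / 4) ^ k < \<epsilon> / ?M"
    using real_arch_pow_inv[of "\<epsilon> / ?M" "3 / 4"] discrete(1) by auto
  hence k: "?M * (3 / 4) ^ k < \<epsilon>" using M by (simp add: field_simps)
  let ?b = "iterated_comm g h k"
  have "rot ?b \<le> (1 / 4) * (1 / 2) ^ k" by (rule iterated_comm_bounds) fact+
  also have "\<dots> \<le> 1 * (3 / 4) ^ k" by (intro mult_mono power_mono) auto
  also have "\<dots> \<le> ?M * (3 / 4) ^ k" by (intro mult_right_mono) auto
  finally have 1: "rot ?b < \<epsilon>" using k by simp
  have "norm (\<tau> ?b) \<le> (norm (\<tau> h) + 4 * norm (\<tau> g)) * (3 / 4) ^ k" by (rule iterated_comm_bounds) fact+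
  also have "\<dots> \<le> ?M * (3 / 4) ^ k" by (intro mult_right_mono) auto
  finally have "norm (\<tau> ?b) < \<epsilon>" using k by simp
  hence "?b = \<one>" using discrete(2)[of ?b] 1 gh by simp
  hence "iterated_comm g h (Suc k) = \<one>" using gh by (simp add: comm_def)
  thus thesis by (rule that)
qed

text \<open>The commutator sequence ends in \<open>\<one>\<close>. Descending from there, if the
  linear part of one term commutes with \<open>\<rho> g\<close>, so does that of the preceding term.
  Then each translation is \<open>\<rho> g u - u\<close> for the preceding translation
  \<open>u\<close>; if it is fixed by \<open>g\<close> it vanishes, so \<open>u\<close> is fixed
  too. The vector \<open>x\<close> is the translation of the first commutator.\<close>

lemma almost_commuting:
  assumes discrete: "0 < \<epsilon>" "\<And>g. g \<in> carrier G \<Longrightarrow> rot g < \<epsilon> \<Longrightarrow> norm (\<tau> g) < \<epsilon> \<Longrightarrow> g = \<one>"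
    and gh: "g \<in> carrier G" "h \<in> carrier G" and small: "rot g \<le> 1 / 4" "rot h \<le> 1 / 4"
  defines "x \<equiv> (\<rho> g (\<tau> h) - \<tau> h) + (\<tau> g - \<rho> h (\<tau> g))"
  shows "\<rho> g x = x"
proof -
  let ?b = "iterated_comm g h"
  have bc: "?b k \<in> carrier G" for k using gh by simp
  have b_small: "rot (?b k) \<le> 1 / 4" for k
  proof -
    have "rot (?b k) \<le> (1 / 4) * (1 / 2) ^ k" by (rule iterated_comm_bounds) fact+
    thus ?thesis using power_le_one[of "1 / 2 :: real" k] by simp
  qed
  obtain n where n: "?b (Suc n) = \<one>"
    using iterated_comm_eventually_one[OF discrete gh small] by blast
  have commute: "\<rho> g (\<rho> (?b k) v) = \<rho> (?b k) (\<rho> g v)" if "k \<le> Suc n" for k v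
    using that
  proof (induction k arbitrary: v rule: inc_induct)
    case base
    show ?case using n gh by simp
  next
    case (step k)
    have "\<rho> (comm g (?b k)) = \<rho> \<one>"
      by (rule comm_trivial_rotation) (use gh bc b_small step.IH in simp_all)
    hence "\<rho> (comm g (?b k)) (\<rho> (?b k) (\<rho> g v)) = \<rho> \<one> (\<rho> (?b k) (\<rho> g v))" by simp
    thus ?case using gh bc[of k] by (simp add: comm_def)
  qed
  have trivial: "\<rho> (?b (Suc k)) = \<rho> \<one>" if "k \<le> n" for k
  proof (rule blinfun_eqI)
    fix v
    let ?v = "\<rho> (inv g) (\<rho> (inv (?b k)) v)"
    have "\<rho> (?b (Suc k)) v = \<rho> g (\<rho> (?b k) ?v)" using gh bc[of k] by (simp add: comm_def)
    also have "\<dots> = \<rho> (?b k) (\<rho> g ?v)" using commute that by simp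
    also have "\<dots> = \<rho> \<one> v" using gh bc[of k] by simp
    finally show "\<rho> (?b (Suc k)) v = \<rho> \<one> v" .
  qed
  have \<tau>_step: "\<tau> (?b (Suc (Suc k))) = \<rho> g (\<tau> (?b (Suc k))) - \<tau> (?b (Suc k))" if "Suc k \<le> n" for k
  proof -
    have "\<rho> (g \<otimes> ?b (Suc k) \<otimes> inv g) (\<tau> g) = \<tau> g"
      using gh trivial[of k] that bc[of "Suc k"] by (simp add: \<tau>_fixed del: iterated_comm.simps)
    moreover have "\<rho> (comm g (?b (Suc k))) = \<rho> \<one>" using trivial[of "Suc k"] that by simp
    ultimately show ?thesis
      using \<tau>_comm[OF gh(1) bc[of "Suc k"]] bc[of "Suc k"] by (simp add: \<tau>_fixed del: \<rho>_mult_apply iterated_comm.simps(2)) simp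
  qed
  have "\<rho> g (\<tau> (?b (Suc k))) = \<tau> (?b (Suc k))" if "k \<le> n" for k
    using that
  proof (induction k rule: inc_induct)
    case base
    show ?case using n by simp
  next
    case (step k)
    have "\<tau> (?b (Suc (Suc k))) = 0"
    proof (rule range_inter_kernel[OF gh(1)])
      show "\<tau> (?b (Suc (Suc k))) = \<rho> g (\<tau> (?b (Suc k))) - \<rho> \<one> (\<tau> (?b (Suc k)))"
        using \<tau>_step[of k] step bc[of "Suc k"] by (simp add: \<tau>_fixed del: iterated_comm.simps)
    qed (rule step.IH)
    thus ?case using \<tau>_step[of k] step by simp
  qed
  from this[of 0] have "\<rho> g (\<tau> (comm g h)) = \<tau> (comm g h)" by simp
  moreover have "\<rho> (g \<otimes> h \<otimes> inv g) (\<tau> g) = \<rho> h (\<tau> g)"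
    using gh commute[of 0 "\<rho> (inv g) (\<tau> g)"] by simp
  moreover have "\<rho> (comm g h) (\<tau> h) = \<tau> h"
    using trivial[of 0] gh by (simp add: \<tau>_fixed)
  ultimately show ?thesis
    unfolding x_def using \<tau>_comm[OF gh] by (simp del: \<rho>_mult_apply)
qed

text \<open>By \<open>almost_commuting\<close>, the square \<open>Q\<close> of
  \<open>\<rho> g - \<rho> \<one>\<close> is bounded on the translations of all elements of small
  rotation. Cocompactness supplies such translations near large multiples of any vector, so the
  linear map \<open>Q\<close> vanishes. Then \<open>\<rho> g - \<rho> \<one>\<close> vanishes as
  well, its image meeting its kernel only in zero.\<close>

lemma Bieberbach_small_rotation:
  assumes discrete: "0 < \<epsilon>" "\<And>g. g \<in> carrier G \<Longrightarrow> rot g < \<epsilon> \<Longrightarrow> norm (\<tau> g) < \<epsilon> \<Longrightarrow> g = \<one>"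
    and cocompact: "\<And>v. \<rho> \<one> v = v \<Longrightarrow> \<exists>h\<in>carrier G. norm (\<tau> h - v) \<le> R"
    and g: "g \<in> carrier G" "rot g \<le> 1 / 4"
  shows "\<rho> g = \<rho> \<one>"
proof -
  define Q where "Q v = \<rho> g (\<rho> g v - \<rho> \<one> v) - \<rho> \<one> (\<rho> g v - \<rho> \<one> v)" for v
  have Q_diff: "Q (v - w) = Q v - Q w" for v w
    by (simp only: Q_def blinfun.diff_right) (simp add: algebra_simps)
  have Q_scale: "Q (c *\<^sub>R v) = c *\<^sub>R Q v" for c v
    by (simp add: Q_def blinfun.diff_right blinfun.scaleR_right scaleR_diff_right)
  have Q_le: "norm (Q v) \<le> norm v" for v
  proof -
    have "norm (Q v) \<le> rot g * (rot g * norm v)"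
      unfolding Q_def by (intro order_trans[OF rot_apply] mult_left_mono rot_apply rot_nonneg)
    also have "\<dots> \<le> 1 * (1 * norm v)" using g by (intro mult_mono) auto
    finally show ?thesis by simp
  qed
  have bound: "norm (Q (\<tau> h)) \<le> 2 * norm (\<tau> g)" if h: "h \<in> carrier G" "rot h \<le> 1 / 4" for h
  proof -
    let ?y = "\<tau> g - \<rho> h (\<tau> g)"
    have "\<rho> g (\<rho> g (\<tau> h)) - \<rho> g (\<tau> h) + (\<rho> g (\<tau> g) - \<rho> g (\<rho> h (\<tau> g)))
        = (\<rho> g (\<tau> h) - \<tau> h) + (\<tau> g - \<rho> h (\<tau> g))"
      using almost_commuting[OF discrete g(1) h(1) g(2) h(2)]
      by (simp only: blinfun.diff_right blinfun.add_right)
    hence "Q (\<tau> h) = - (\<rho> g ?y - \<rho> \<one> ?y)"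
      using g h by (simp add: Q_def blinfun.diff_right \<tau>_fixed) (simp add: algebra_simps)
    hence "norm (Q (\<tau> h)) \<le> rot g * norm ?y" using rot_apply[of g ?y] by (simp only: norm_minus_cancel)
    also have "\<dots> \<le> 1 * (norm (\<tau> g) + norm (\<rho> h (\<tau> g)))"
      using g by (intro mult_mono norm_triangle_ineq4) auto
    also have "\<dots> \<le> 2 * norm (\<tau> g)" using norm_\<rho>_le[OF h(1), of "\<tau> g"] by simp
    finally show ?thesis .
  qed
  have Qu: "Q u = 0" if u: "\<rho> \<one> u = u" for u
  proof (rule ccontr)
    assume "Q u \<noteq> 0"
    have "\<exists>h\<in>carrier G. norm (\<tau> h - real k *\<^sub>R u) \<le> R" for k
      using u by (intro cocompact) (simp add: blinfun.scaleR_right)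
    then obtain h where h: "\<And>k. h k \<in> carrier G" "\<And>k. norm (\<tau> (h k) - real k *\<^sub>R u) \<le> R"
      by metis
    have "norm (\<rho> (h k)) \<le> 1" for k
      using norm_\<rho>_le[OF h(1)] by (intro norm_blinfun_bound) auto
    hence "bounded (range (\<lambda>k. \<rho> (h k)))" unfolding bounded_iff by blast
    then obtain l r where r: "strict_mono r" "(\<lambda>k. \<rho> (h (r k))) \<longlonglongrightarrow> l"
      using bounded_imp_convergent_subsequence[of "\<lambda>k. \<rho> (h k)"] by (auto simp: o_def)
    hence "Cauchy (\<lambda>k. \<rho> (h (r k)))" by (intro LIMSEQ_imp_Cauchy)
    then obtain i where i: "\<And>j. j \<ge> i \<Longrightarrow> norm (\<rho> (h (r j)) - \<rho> (h (r i))) < 1 / 4"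
      unfolding Cauchy_iff by (metis order_refl zero_less_divide_1_iff zero_less_numeral)
    let ?C = "2 * norm (\<tau> g) + R + norm (\<tau> (h (r i)))"
    have "real (r j) * norm (Q u) \<le> ?C" if j: "j \<ge> i" for j
    proof -
      \<comment> \<open>An element close to a multiple of \<open>u\<close> need not have small
        rotation. Dividing by one fixed member of the convergent subsequence makes the rotation
        small and changes the translation by a bounded amount only.\<close>
      let ?h = "h (r j) \<otimes> inv (h (r i))"
      have hc: "?h \<in> carrier G" "h (r j) \<in> carrier G" "h (r i) \<in> carrier G" using h by auto
      have "rot ?h \<le> 1 / 4"
      proof (rule rot_bound)
        fix v
        let ?v = "\<rho> (inv (h (r i))) v"
        have "\<rho> ?h v - \<rho> \<one> v = (\<rho> (h (r j)) - \<rho> (h (r i))) ?v"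
          using hc by (simp add: blinfun.diff_left)
        also have "norm \<dots> \<le> norm (\<rho> (h (r j)) - \<rho> (h (r i))) * norm ?v" by (rule norm_blinfun)
        also have "\<dots> \<le> 1 / 4 * norm v"
          using i[OF j] norm_\<rho>_le[of "inv (h (r i))" v] hc by (intro mult_mono) auto
        finally show "norm (\<rho> ?h v - \<rho> \<one> v) \<le> 1 / 4 * norm v" .
      qed simp
      hence b: "norm (Q (\<tau> ?h)) \<le> 2 * norm (\<tau> g)" by (intro bound hc)
      have "\<tau> ?h = \<tau> (h (r j)) - \<rho> ?h (\<tau> (h (r i)))"
        using hc by (simp add: \<tau>_mult \<tau>_inv blinfun.minus_right)
      hence "real (r j) *\<^sub>R u = \<tau> ?h - (\<tau> (h (r j)) - real (r j) *\<^sub>R u) - (- \<rho> ?h (\<tau> (h (r i))))"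
        by (simp del: \<rho>_mult_apply)
      hence "real (r j) *\<^sub>R Q u = Q (\<tau> ?h) - Q (\<tau> (h (r j)) - real (r j) *\<^sub>R u) - Q (- \<rho> ?h (\<tau> (h (r i))))"
        by (metis Q_diff Q_scale)
      hence "real (r j) * norm (Q u) = norm (Q (\<tau> ?h) - Q (\<tau> (h (r j)) - real (r j) *\<^sub>R u) - Q (- \<rho> ?h (\<tau> (h (r i)))))"
        by (metis abs_of_nat norm_scaleR)
      also have "\<dots> \<le> norm (Q (\<tau> ?h)) + norm (Q (\<tau> (h (r j)) - real (r j) *\<^sub>R u)) + norm (Q (- \<rho> ?h (\<tau> (h (r i)))))"
        by (meson add_right_mono norm_triangle_ineq4 order_trans)
      also have "\<dots> \<le> 2 * norm (\<tau> g) + R + norm (\<tau> (h (r i)))"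
      proof (intro add_mono b)
        show "norm (Q (\<tau> (h (r j)) - real (r j) *\<^sub>R u)) \<le> R" using Q_le h(2) order_trans by blast
        have "norm (Q (- \<rho> ?h (\<tau> (h (r i))))) \<le> norm (\<rho> ?h (\<tau> (h (r i))))" using Q_le norm_minus_cancel by metis
        also have "\<dots> \<le> norm (\<tau> (h (r i)))" by (rule norm_\<rho>_le[OF hc(1)])
        finally show "norm (Q (- \<rho> ?h (\<tau> (h (r i))))) \<le> norm (\<tau> (h (r i)))" .
      qed
      finally show ?thesis .
    qed
    moreover obtain n where "?C < real n * norm (Q u)"
      using reals_Archimedean3[of "norm (Q u)"] \<open>Q u \<noteq> 0\<close> by auto
    moreover have "real n * norm (Q u) \<le> real (r (max i n)) * norm (Q u)"
      using seq_suble[OF r(1), of "max i n"] by (intro mult_right_mono) auto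
    ultimately show False by (smt (verit) max.cobounded1)
  qed
  have Q0: "Q v = 0" for v
    using Qu[of "\<rho> \<one> v"] g by (simp add: Q_def)
  show ?thesis
  proof (rule blinfun_eqI)
    fix v
    have "\<rho> g v - \<rho> \<one> v = 0"
      by (rule range_inter_kernel[OF g(1) HOL.refl]) (use Q0[of v] g in \<open>simp add: Q_def blinfun.diff_right\<close>)
    thus "\<rho> g v = \<rho> \<one> v" by simp
  qed
qed

text \<open>Infinitely many linear parts would accumulate in a bounded set of operators; two
  distinct ones at distance below \<open>1 / 4\<close> have a quotient of small, hence trivial,
  rotation.\<close>

lemma Bieberbach_finite_holonomy:
  assumes discrete: "0 < \<epsilon>" "\<And>g. g \<in> carrier G \<Longrightarrow> rot g < \<epsilon> \<Longrightarrow> norm (\<tau> g) < \<epsilon> \<Longrightarrow> g = \<one>"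
    and cocompact: "\<And>v. \<rho> \<one> v = v \<Longrightarrow> \<exists>h\<in>carrier G. norm (\<tau> h - v) \<le> R"
  shows "finite (\<rho> ` carrier G)"
proof (rule ccontr)
  assume "infinite (\<rho> ` carrier G)"
  then obtain f :: "nat \<Rightarrow> _" where f: "inj f" "range f \<subseteq> \<rho> ` carrier G"
    using infinite_countable_subset by blast
  hence "\<exists>h\<in>carrier G. f k = \<rho> h" for k by blast
  then obtain h where h: "\<And>k. h k \<in> carrier G" "\<And>k. f k = \<rho> (h k)" by metis
  have "norm (\<rho> (h k)) \<le> 1" for k
    using norm_\<rho>_le[OF h(1)] by (intro norm_blinfun_bound) auto
  hence "bounded (range f)" unfolding bounded_iff using h by auto
  then obtain l r where r: "strict_mono r" "(\<lambda>k. f (r k)) \<longlonglongrightarrow> l"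
    using bounded_imp_convergent_subsequence[of f] by (auto simp: o_def)
  hence "Cauchy (\<lambda>k. f (r k))" by (intro LIMSEQ_imp_Cauchy)
  then obtain i where i: "norm (f (r (Suc i)) - f (r i)) < 1 / 4"
    unfolding Cauchy_iff by (metis order_refl zero_less_divide_1_iff zero_less_numeral le_Suc_eq)
  let ?h = "h (r (Suc i)) \<otimes> inv (h (r i))"
  have hc: "?h \<in> carrier G" "h (r (Suc i)) \<in> carrier G" "h (r i) \<in> carrier G" using h by auto
  have "rot ?h \<le> 1 / 4"
  proof (rule rot_bound)
    fix v
    let ?v = "\<rho> (inv (h (r i))) v"
    have "\<rho> ?h v - \<rho> \<one> v = (f (r (Suc i)) - f (r i)) ?v"
      using hc by (simp add: blinfun.diff_left h)
    also have "norm \<dots> \<le> norm (f (r (Suc i)) - f (r i)) * norm ?v" by (rule norm_blinfun)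
    also have "\<dots> \<le> 1 / 4 * norm v"
      using i norm_\<rho>_le[of "inv (h (r i))" v] hc by (intro mult_mono) auto
    finally show "norm (\<rho> ?h v - \<rho> \<one> v) \<le> 1 / 4 * norm v" .
  qed simp
  hence *: "\<rho> ?h = \<rho> \<one>" by (intro Bieberbach_small_rotation[OF discrete cocompact] hc)
  have "f (r (Suc i)) = f (r i)"
  proof (rule blinfun_eqI)
    fix v
    have "\<rho> ?h (\<rho> (h (r i)) v) = \<rho> \<one> (\<rho> (h (r i)) v)" using * by simp
    thus "f (r (Suc i)) v = f (r i) v" using hc by (simp add: h)
  qed
  hence "r (Suc i) = r i" using f(1) by (simp add: inj_def)
  thus False using r(1) by (metis n_not_Suc_n strict_mono_eq)
qed

end

section \<open>Half turns in the holonomy\<close>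

text \<open>What is available after restriction to the span of the translations when there is no
  common fixed vector. Finite holonomy and \<open>spanning\<close> stand in for cocompactness; the
  goal is a pair with the Hantzsche-Wendt relations.\<close>

locale crystal_action = isometric_action G \<rho> \<tau>
  for G (structure) and \<rho> :: "'g \<Rightarrow> 'a::euclidean_space \<Rightarrow>\<^sub>L 'a" and \<tau> :: "'g \<Rightarrow> 'a" +
  assumes torsion_free: "torsion_free_group G"
    and faithful: "g \<in> carrier G \<Longrightarrow> \<rho> g = \<rho> \<one> \<Longrightarrow> \<tau> g = 0 \<Longrightarrow> g = \<one>"
    and finite_holonomy: "finite (\<rho> ` carrier G)"
    and discrete: "\<exists>\<epsilon>>0. \<forall>g\<in>carrier G. \<rho> g = \<rho> \<one> \<longrightarrow> norm (\<tau> g) < \<epsilon> \<longrightarrow> \<tau> g = 0"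
    and spanning: "\<rho> \<one> v \<in> span (\<tau> ` {g \<in> carrier G. \<rho> g = \<rho> \<one>})"
    and dim_le: "dim (range (\<rho> \<one>)) \<le> 4"
    and no_fixed: "\<rho> \<one> u = u \<Longrightarrow> (\<And>g. g \<in> carrier G \<Longrightarrow> \<rho> g u = u) \<Longrightarrow> u = 0"
    and nontrivial: "carrier G \<noteq> {\<one>}"
begin

definition L where "L = \<tau> ` {g \<in> carrier G. \<rho> g = \<rho> \<one>}"

lemma LE: assumes "u \<in> L" obtains n where "n \<in> carrier G" "\<rho> n = \<rho> \<one>" "\<tau> n = u"
  using assms unfolding L_def by auto

lemma LI: "n \<in> carrier G \<Longrightarrow> \<rho> n = \<rho> \<one> \<Longrightarrow> \<tau> n \<in> L"
  unfolding L_def by auto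

lemma L_fixed: "u \<in> L \<Longrightarrow> \<rho> \<one> u = u"
  by (auto simp: L_def \<tau>_fixed)

lemma \<rho>_eqI: "g \<in> carrier G \<Longrightarrow> h \<in> carrier G \<Longrightarrow> (\<And>x. \<rho> \<one> x = x \<Longrightarrow> \<rho> g x = \<rho> h x) \<Longrightarrow> \<rho> g = \<rho> h"
proof (rule blinfun_eqI)
  fix x assume *: "g \<in> carrier G" "h \<in> carrier G" "\<And>x. \<rho> \<one> x = x \<Longrightarrow> \<rho> g x = \<rho> h x"
  have "\<rho> g (\<rho> \<one> x) = \<rho> h (\<rho> \<one> x)" by (rule *(3)) simp
  thus "\<rho> g x = \<rho> h x" using * by simp
qed

lemma conj_translation:
  assumes g: "g \<in> carrier G" and n: "n \<in> carrier G" "\<rho> n = \<rho> \<one>"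
  shows "\<rho> (g \<otimes> n \<otimes> inv g) = \<rho> \<one>" "\<tau> (g \<otimes> n \<otimes> inv g) = \<rho> g (\<tau> n)"
proof -
  show "\<rho> (g \<otimes> n \<otimes> inv g) = \<rho> \<one>" by (rule blinfun_eqI) (use g n in simp)
  show "\<tau> (g \<otimes> n \<otimes> inv g) = \<rho> g (\<tau> n)"
    using g n by (simp add: \<tau>_mult \<tau>_inv blinfun.minus_right \<tau>_fixed)
qed

lemma L_action: assumes "g \<in> carrier G" "u \<in> L" shows "\<rho> g u \<in> L"
proof -
  obtain n where n: "n \<in> carrier G" "\<rho> n = \<rho> \<one>" "\<tau> n = u" using LE assms(2) .
  thus ?thesis using conj_translation[OF assms(1) n(1,2)] LI[of "g \<otimes> n \<otimes> inv g"] assms(1) by simp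
qed

lemma L_zero: "0 \<in> L" using LI[of \<one>] by simp

lemma L_add: assumes "u \<in> L" "v \<in> L" shows "u + v \<in> L"
proof -
  obtain m where m: "m \<in> carrier G" "\<rho> m = \<rho> \<one>" "\<tau> m = u" using LE assms(1) .
  obtain n where n: "n \<in> carrier G" "\<rho> n = \<rho> \<one>" "\<tau> n = v" using LE assms(2) .
  have "\<rho> (m \<otimes> n) = \<rho> \<one>" by (rule blinfun_eqI) (use m n in simp)
  moreover have "\<tau> (m \<otimes> n) = u + v" using m n by (simp add: \<tau>_mult L_fixed assms)
  ultimately show ?thesis using LI[of "m \<otimes> n"] m n by simp
qed

lemma L_uminus: assumes "u \<in> L" shows "- u \<in> L"
proof -
  obtain m where m: "m \<in> carrier G" "\<rho> m = \<rho> \<one>" "\<tau> m = u" using LE assms(1) .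
  have "\<rho> (inv m) = \<rho> \<one>" by (rule blinfun_eqI) (metis \<rho>_inv(1) \<rho>_one(2) inv_closed m(1,2))
  moreover from this have "\<tau> (inv m) = - u" using m by (simp add: \<tau>_inv L_fixed assms)
  ultimately show ?thesis using LI[of "inv m"] m by simp
qed

lemma L_sum: "(\<And>i. i \<in> I \<Longrightarrow> f i \<in> L) \<Longrightarrow> (\<Sum>i\<in>I. f i) \<in> L"
  by (induction I rule: infinite_finite_induct) (auto simp: L_zero L_add)

lemma ext:
  assumes "g \<in> carrier G" "h \<in> carrier G" "\<rho> g = \<rho> h" "\<tau> g = \<tau> h" shows "g = h"
proof -
  have 1: "\<rho> (g \<otimes> inv h) = \<rho> \<one>" by (rule blinfun_eqI) (use assms in simp)
  have "\<tau> (g \<otimes> inv h) = \<tau> g - \<rho> (g \<otimes> inv h) (\<tau> h)"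
    using assms by (simp add: \<tau>_mult \<tau>_inv blinfun.minus_right)
  hence "\<tau> (g \<otimes> inv h) = 0" unfolding 1 using assms by (simp add: \<tau>_fixed)
  hence "g \<otimes> inv h = \<one>" using 1 assms by (intro faithful) auto
  thus ?thesis using assms by (simp add: inv_solve_right')
qed

lemma finite_order: assumes g: "g \<in> carrier G" obtains m :: nat where "m > 0" "\<rho> (g [^] m) = \<rho> \<one>"
proof -
  have "\<not> inj (\<lambda>k::nat. \<rho> (g [^] k))"
  proof
    assume "inj (\<lambda>k::nat. \<rho> (g [^] k))"
    moreover have "range (\<lambda>k::nat. \<rho> (g [^] k)) \<subseteq> \<rho> ` carrier G" using g by auto
    ultimately show False using finite_holonomy finite_subset finite_imageD infinite_UNIV_nat by blast
  qed
  then obtain i j :: nat where ij: "i < j" "\<rho> (g [^] i) = \<rho> (g [^] j)"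
    unfolding inj_def by (metis nat_neq_iff)
  have "\<rho> (g [^] (j - i)) v = \<rho> \<one> v" for v
  proof -
    have gi: "g [^] i \<in> carrier G" using g by simp
    have "\<rho> (g [^] (j - i) \<otimes> g [^] i) (\<rho> (inv (g [^] i)) v) = \<rho> (g [^] i) (\<rho> (inv (g [^] i)) v)"
      using g ij by (simp add: nat_pow_mult)
    thus ?thesis using g gi by simp
  qed
  hence "\<rho> (g [^] (j - i)) = \<rho> \<one>" by (simp add: blinfun_eqI)
  thus thesis using that[of "j - i"] ij(1) by simp
qed

text \<open>Some power of \<open>g\<close> has trivial linear part, and it is not
  \<open>\<one>\<close> by torsion-freeness. It commutes with \<open>g\<close>, so its translation
  vector is fixed by \<open>\<rho> g\<close>. For \<open>g = \<one>\<close> a nontrivial element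
  supplies a nonzero vector.\<close>

lemma has_fixed_vector:
  assumes g: "g \<in> carrier G" obtains w where "\<rho> \<one> w = w" "norm w = 1" "\<rho> g w = w"
proof -
  have nt: "\<exists>w. w \<noteq> 0 \<and> \<rho> \<one> w = w \<and> \<rho> h w = w" if h: "h \<in> carrier G" "h \<noteq> \<one>" for h
  proof -
    obtain m where m: "m > (0::nat)" "\<rho> (h [^] m) = \<rho> \<one>" using finite_order h by blast
    let ?w = "\<tau> (h [^] m)"
    have "h [^] m \<noteq> \<one>" using torsion_free m(1) h unfolding torsion_free_group_def by blast
    hence "?w \<noteq> 0" using faithful[of "h [^] m"] m(2) h(1) by blast
    moreover have "\<tau> (h [^] m \<otimes> h) = \<tau> (h \<otimes> h [^] m)" using h(1) by (simp add: nat_pow_Suc2[symmetric])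
    hence "\<rho> h ?w = ?w" using h m by (simp add: \<tau>_mult \<tau>_fixed)
    ultimately show ?thesis using \<tau>_fixed h by auto
  qed
  obtain h where h: "h \<in> carrier G" "h \<noteq> \<one>" using nontrivial one_closed by blast
  obtain w where w: "w \<noteq> 0" "\<rho> \<one> w = w" "\<rho> g w = w"
  proof (cases "g = \<one>")
    case True
    thus thesis using nt[OF h] that by auto
  next
    case False
    thus thesis using nt[OF g] that by auto
  qed
  show thesis by (rule that[of "w /\<^sub>R norm w"]) (use w in \<open>simp_all add: blinfun.scaleR_right\<close>)
qed

lemma inner_\<rho>: "g \<in> carrier G \<Longrightarrow> \<rho> \<one> v = v \<Longrightarrow> \<rho> g v \<bullet> \<rho> g w = v \<bullet> w"
  by (simp add: \<rho>_inner)

lemma \<rho>_inv_eqI: assumes "g \<in> carrier G" "\<rho> \<one> v = v" "\<rho> g v = w" shows "\<rho> (inv g) w = v"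
  using \<rho>_inv(1)[OF assms(1), of v] assms by simp

lemma orthogonal_card:
  assumes "finite B" "\<And>b. b \<in> B \<Longrightarrow> \<rho> \<one> b = b \<and> b \<noteq> 0" "pairwise orthogonal B"
  shows "card B \<le> 4"
proof -
  have "independent B" using assms by (intro pairwise_orthogonal_independent) auto
  moreover have "B \<subseteq> range (\<rho> \<one>)" using assms(2) by (metis rangeI subsetI)
  ultimately show ?thesis using independent_card_le_dim dim_le order_trans by blast
qed

text \<open>The form in which the bound on the dimension is used: four orthogonal nonzero vectors
  are already complete.\<close>

lemma five_orthogonal:
  assumes "\<rho> \<one> a = a" "\<rho> \<one> b = b" "\<rho> \<one> c = c" "\<rho> \<one> d = d" "\<rho> \<one> e = e"
    and "a \<noteq> 0" "b \<noteq> 0" "c \<noteq> 0" "d \<noteq> 0" "e \<noteq> 0"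
    and "a \<bullet> b = 0" "a \<bullet> c = 0" "a \<bullet> d = 0" "a \<bullet> e = 0" "b \<bullet> c = 0" "b \<bullet> d = 0" "b \<bullet> e = 0"
    and "c \<bullet> d = 0" "c \<bullet> e = 0" "d \<bullet> e = 0"
  shows False
proof -
  have "card {a, b, c, d, e} \<le> 4"
    using assms by (intro orthogonal_card) (auto simp: pairwise_def orthogonal_def inner_commute)
  moreover have "a \<noteq> b" "a \<noteq> c" "a \<noteq> d" "a \<noteq> e" "b \<noteq> c" "b \<noteq> d" "b \<noteq> e" "c \<noteq> d" "c \<noteq> e" "d \<noteq> e"
    using assms by (metis inner_eq_zero_iff)+
  ultimately show False by simp
qed

text \<open>The formula is minus the reflection in the hyperplane orthogonal to \<open>w\<close>; in
  dimension 3 this is the rotation by a straight angle about \<open>w\<close>.\<close>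

definition half_turn where
  "half_turn g w \<longleftrightarrow> g \<in> carrier G \<and> \<rho> \<one> w = w \<and> norm w = 1 \<and>
     (\<forall>x. \<rho> \<one> x = x \<longrightarrow> \<rho> g x = (2 * (x \<bullet> w)) *\<^sub>R w - x)"

text \<open>Everything hinges on \<open>\<rho> x\<close> being an involution. A fixed vector
  \<open>v1\<close> of \<open>x\<close> is orthogonal to \<open>w\<close>; a fixed vector
  \<open>v2\<close> of \<open>x \<otimes> y\<close> is so too, hence negated by \<open>y\<close> and
  by \<open>x\<close>. On the line that may be left \<open>x\<close> is a sign. Thus both squares
  are translations: that of \<open>x\<close> is fixed by \<open>x\<close>, hence orthogonal to
  \<open>w\<close> and negated by \<open>y\<close>; that of \<open>y\<close> lies along
  \<open>w\<close> and is negated by \<open>x\<close>.\<close>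

lemma half_turn_pair:
  assumes y: "half_turn y w" and x: "x \<in> carrier G" "\<rho> x w = - w"
  shows "HW_pair G x y" "x \<noteq> \<one>" "y \<noteq> \<one>"
proof -
  have yc: "y \<in> carrier G" and w: "\<rho> \<one> w = w" "norm w = 1" "w \<bullet> w = 1"
    and \<rho>y: "\<And>v. \<rho> \<one> v = v \<Longrightarrow> \<rho> y v = (2 * (v \<bullet> w)) *\<^sub>R w - v"
    using y by (auto simp: half_turn_def dot_square_norm)
  have perp: "\<rho> y v = - v" if "\<rho> \<one> v = v" "v \<bullet> w = 0" for v using \<rho>y that by simp
  have yw: "\<rho> y w = w" using \<rho>y[OF w(1)] w by (simp add: scaleR_2)
  obtain v1 where v1: "\<rho> \<one> v1 = v1" "norm v1 = 1" "\<rho> x v1 = v1" using has_fixed_vector x(1) .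
  have x_inner: "\<rho> x v \<bullet> w = - (v \<bullet> w)" if "\<rho> \<one> v = v" for v
    using inner_\<rho>[OF x(1) that, of w] x(2) by simp
  have v1w: "v1 \<bullet> w = 0" using x_inner[OF v1(1)] v1(3) by simp
  obtain v2 where v2: "\<rho> \<one> v2 = v2" "norm v2 = 1" "\<rho> (x \<otimes> y) v2 = v2" using has_fixed_vector[OF m_closed[OF x(1) yc]] .
  have "v2 \<bullet> w = - (\<rho> y v2 \<bullet> w)" using x_inner[of "\<rho> y v2"] v2(3) x yc by simp
  also have "\<rho> y v2 \<bullet> w = v2 \<bullet> w" using inner_\<rho>[OF yc v2(1), of w] yw by simp
  finally have v2w: "v2 \<bullet> w = 0" by simp
  have "- \<rho> x v2 = v2" using v2(3) perp[OF v2(1) v2w] x yc by (simp add: blinfun.minus_right)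
  hence v2m: "\<rho> x v2 = - v2" by (metis minus_minus)
  have "v1 \<bullet> v2 = \<rho> x v1 \<bullet> \<rho> x v2" using inner_\<rho>[OF x(1) v1(1)] by simp
  hence v12: "v1 \<bullet> v2 = 0" using v1 v2m by simp
  have v_sq: "v1 \<bullet> v1 = 1" "v2 \<bullet> v2 = 1" using v1 v2 by (simp_all add: dot_square_norm)
  have flipped: "w \<bullet> v1 = 0" "w \<bullet> v2 = 0" "v2 \<bullet> v1 = 0"
    using v1w v2w v12 by (simp_all add: inner_commute)
  have xx: "\<rho> x (\<rho> x v) = v" if v: "\<rho> \<one> v = v" for v
  proof -
    define v' where "v' = v - (v \<bullet> w) *\<^sub>R w - (v \<bullet> v1) *\<^sub>R v1 - (v \<bullet> v2) *\<^sub>R v2"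
    have v': "\<rho> \<one> v' = v'" using v w v1 v2 by (simp add: v'_def blinfun.diff_right blinfun.scaleR_right)
    have v'_perp: "v' \<bullet> w = 0" "v' \<bullet> v1 = 0" "v' \<bullet> v2 = 0"
      using w v_sq v1w v2w v12 flipped by (simp_all add: v'_def inner_diff_left)
    have fv'_perp: "\<rho> x v' \<bullet> w = 0" "\<rho> x v' \<bullet> v1 = 0" "\<rho> x v' \<bullet> v2 = 0"
      using inner_\<rho>[OF x(1) v', of w] inner_\<rho>[OF x(1) v', of v1] inner_\<rho>[OF x(1) v', of v2]
        v'_perp x v1 v2m by simp_all
    have xxv': "\<rho> x (\<rho> x v') = v'"
    proof (cases "v' = 0")
      case True
      thus ?thesis by (simp add: blinfun.zero_right)
    next
      case False
      define l where "l = (\<rho> x v' \<bullet> v') / (v' \<bullet> v')"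
      \<comment> \<open>The part of \<open>\<rho> x v'\<close> orthogonal to \<open>v'\<close>: if
        nonzero, it would be a fifth orthogonal direction.\<close>
      define z where "z = \<rho> x v' - l *\<^sub>R v'"
      have "\<rho> \<one> z = z" using x v' by (simp add: z_def blinfun.diff_right blinfun.scaleR_right)
      moreover have "z \<bullet> w = 0" "z \<bullet> v1 = 0" "z \<bullet> v2 = 0"
        using v'_perp fv'_perp by (simp_all add: z_def inner_diff_left)
      moreover have "z \<bullet> v' = 0" using False by (simp add: z_def inner_diff_left l_def)
      ultimately have "z = 0"
        using five_orthogonal[of w v1 v2 v' z] False w v1 v2 v' v'_perp flipped v12
        by (metis inner_commute norm_zero zero_neq_one)
      hence l: "\<rho> x v' = l *\<^sub>R v'" by (simp add: z_def)
      have "(l * l) * (v' \<bullet> v') = v' \<bullet> v'" using inner_\<rho>[OF x(1) v', of v'] by (simp add: l)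
      hence "l * l = 1" using False by simp
      thus ?thesis by (simp add: l blinfun.scaleR_right)
    qed
    have dec: "v' + (v \<bullet> w) *\<^sub>R w + (v \<bullet> v1) *\<^sub>R v1 + (v \<bullet> v2) *\<^sub>R v2 = v" by (simp add: v'_def)
    have "\<rho> x (\<rho> x (v' + (v \<bullet> w) *\<^sub>R w + (v \<bullet> v1) *\<^sub>R v1 + (v \<bullet> v2) *\<^sub>R v2))
        = v' + (v \<bullet> w) *\<^sub>R w + (v \<bullet> v1) *\<^sub>R v1 + (v \<bullet> v2) *\<^sub>R v2"
      by (simp add: blinfun.add_right blinfun.diff_right blinfun.scaleR_right blinfun.minus_right xxv' x v1 v2m)
    thus ?thesis unfolding dec .
  qed
  have yy: "\<rho> y (\<rho> y v) = v" if v: "\<rho> \<one> v = v" for v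
    using \<rho>y[OF v] v yw by (simp add: blinfun.diff_right blinfun.scaleR_right)
  have \<rho>xx: "\<rho> (x \<otimes> x) = \<rho> \<one>" and \<rho>yy: "\<rho> (y \<otimes> y) = \<rho> \<one>"
    using x yc by (auto intro!: \<rho>_eqI simp: xx yy)
  have xa: "\<rho> x (\<tau> (x \<otimes> x)) = \<tau> (x \<otimes> x)"
    using x xx[of "\<tau> x"] by (simp add: \<tau>_mult \<tau>_fixed blinfun.add_right add.commute)
  have yb: "\<rho> y (\<tau> (y \<otimes> y)) = \<tau> (y \<otimes> y)"
    using yc yy[of "\<tau> y"] by (simp add: \<tau>_mult \<tau>_fixed blinfun.add_right add.commute)
  let ?a = "\<tau> (x \<otimes> x)" and ?b = "\<tau> (y \<otimes> y)"
  have aU: "\<rho> \<one> ?a = ?a" and bU: "\<rho> \<one> ?b = ?b" using x yc by (simp_all add: \<tau>_fixed)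
  have "?a \<bullet> w = 0" using x_inner[OF aU] xa by simp
  hence ya: "\<rho> (inv y) ?a = - ?a"
    using \<rho>_inv_eqI[OF yc, of "- ?a" ?a] perp[of "- ?a"] aU by (simp add: blinfun.minus_right)
  have bw: "?b = (?b \<bullet> w) *\<^sub>R w"
  proof -
    have "2 *\<^sub>R ?b = (2 * (?b \<bullet> w)) *\<^sub>R w" using \<rho>y[OF bU] yb by (simp add: scaleR_2 algebra_simps)
    thus ?thesis by (metis scaleR_cancel_left scaleR_scaleR zero_neq_numeral)
  qed
  have "\<rho> x (- ?b) = ?b"
    using bw x(2) by (metis add.inverse_inverse blinfun.minus_right blinfun.scaleR_right scaleR_minus_right)
  hence xb: "\<rho> (inv x) ?b = - ?b"
    using \<rho>_inv_eqI[OF x(1), of "- ?b" ?b] bU by (simp add: blinfun.minus_right)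
  have inv_trans: "\<rho> (inv n) = \<rho> \<one>" "\<tau> (inv n) = - \<tau> n" if "n \<in> carrier G" "\<rho> n = \<rho> \<one>" for n
  proof -
    show 1: "\<rho> (inv n) = \<rho> \<one>" by (rule blinfun_eqI) (metis \<rho>_inv(1) \<rho>_one(2) inv_closed that)
    show "\<tau> (inv n) = - \<tau> n" using that by (simp add: \<tau>_inv 1 \<tau>_fixed)
  qed
  have rel: "inv u \<otimes> n \<otimes> u = inv n"
    if "u \<in> carrier G" "n \<in> carrier G" "\<rho> n = \<rho> \<one>" "\<rho> (inv u) (\<tau> n) = - \<tau> n" for u n
    using that conj_translation[of "inv u" n] inv_trans[of n] by (intro ext) auto
  show "HW_pair G x y"
  proof
    show "inv x \<otimes> (y \<otimes> y) \<otimes> x = inv (y \<otimes> y)" by (rule rel) (use x yc \<rho>yy xb in simp_all)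
    show "inv y \<otimes> (x \<otimes> x) \<otimes> y = inv (x \<otimes> x)" by (rule rel) (use x yc \<rho>xx ya in simp_all)
  qed (use x yc in simp_all)
  have neg: "v \<noteq> - v" if "v \<bullet> v = 1" for v :: 'a
    using that by (metis inner_minus_left one_neq_neg_one)
  show "x \<noteq> \<one>" using x(2) w neg[of w] by auto
  show "y \<noteq> \<one>" using perp[OF v1(1) v1w] v1 v_sq neg[of v1] by auto
qed

text \<open>Pairs the index \<open>i\<close> with \<open>2 * k + 1 - i\<close>, as a half turn pairs
  the powers of a rotation of odd order in a dihedral group.\<close>

lemma sum_odd_symmetric:
  fixes F :: "nat \<Rightarrow> 'c::ab_group_add"
  shows "(\<Sum>i<2 * k + 1. F i) = F 0 + (\<Sum>i<k. F (Suc i) + F (2 * k - i))"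
proof -
  have "{..<2 * k + 1} = insert 0 (Suc ` {..<k} \<union> (\<lambda>i. 2 * k - i) ` {..<k})" (is "?l = ?r")
  proof
    show "?l \<subseteq> ?r"
    proof
      fix i assume i: "i \<in> ?l"
      consider "i = 0" | "0 < i" "i \<le> k" | "k < i" by linarith
      thus "i \<in> ?r"
      proof cases
        case 2
        hence "i = Suc (i - 1)" "i - 1 \<in> {..<k}" by auto
        thus ?thesis by blast
      next
        case 3
        hence "i = 2 * k - (2 * k - i)" "2 * k - i \<in> {..<k}" using i by auto
        thus ?thesis by blast
      qed simp
    qed
  qed auto
  hence "sum F {..<2 * k + 1} = sum F (insert 0 (Suc ` {..<k} \<union> (\<lambda>i. 2 * k - i) ` {..<k}))" by simp
  also have "\<dots> = F 0 + sum F (Suc ` {..<k} \<union> (\<lambda>i. 2 * k - i) ` {..<k})"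
    by (rule sum.insert) auto
  also have "sum F (Suc ` {..<k} \<union> (\<lambda>i. 2 * k - i) ` {..<k}) = sum F (Suc ` {..<k}) + sum F ((\<lambda>i. 2 * k - i) ` {..<k})"
    by (rule sum.union_disjoint) auto
  also have "sum F (Suc ` {..<k}) = (\<Sum>i<k. F (Suc i))" by (subst sum.reindex) auto
  also have "sum F ((\<lambda>i. 2 * k - i) ` {..<k}) = (\<Sum>i<k. F (2 * k - i))"
    by (subst sum.reindex) (auto simp: inj_on_def)
  finally show ?thesis by (simp add: sum.distrib)
qed


text \<open>Otherwise some \<open>g\<close> moves \<open>w\<close> to another line, and the half
  turns about \<open>w\<close> and \<open>w' = \<rho> g w\<close> generate a dihedral group with a
  rotation \<open>r\<close> of order \<open>m\<close>. For even \<open>m\<close> the central power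
  of \<open>r\<close> commutes with both half turns and, flips being excluded, fixes both axes; it
  would be trivial. For odd \<open>m\<close> the orbit of the vector of \<open>y \<otimes> y\<close>
  under \<open>r\<close> sums to zero, and half of that sum corrects \<open>y\<close> by a
  translation to an element with trivial square.\<close>

lemma half_turn_flip:
  assumes y: "half_turn y w"
  shows "\<exists>x\<in>carrier G. \<rho> x w = - w"
proof (rule ccontr)
  assume "\<not> ?thesis"
  hence noflip: "\<rho> h w \<noteq> - w" if "h \<in> carrier G" for h using that by blast
  have yc: "y \<in> carrier G" and w: "\<rho> \<one> w = w" "norm w = 1" "w \<bullet> w = 1"
    and \<rho>y: "\<And>v. \<rho> \<one> v = v \<Longrightarrow> \<rho> y v = (2 * (v \<bullet> w)) *\<^sub>R w - v"
    using y by (auto simp: half_turn_def dot_square_norm)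
  have yw: "\<rho> y w = w" using \<rho>y[OF w(1)] w by (simp add: scaleR_2)
  have "w \<noteq> 0" using w by auto
  then obtain g where g: "g \<in> carrier G" "\<rho> g w \<noteq> w" using no_fixed[OF w(1)] by blast
  define w' where "w' = \<rho> g w"
  have w': "\<rho> \<one> w' = w'" "w' \<bullet> w' = 1" "w' \<noteq> w" "w' \<noteq> - w"
    using g noflip w inner_\<rho>[OF g(1) w(1), of w] by (auto simp: w'_def)
  have noflip': "\<rho> h w' \<noteq> - w'" if h: "h \<in> carrier G" for h
  proof
    assume "\<rho> h w' = - w'"
    hence "\<rho> (inv g \<otimes> h \<otimes> g) w = - w"
      using h g w by (simp add: w'_def blinfun.minus_right)
    thus False using noflip[of "inv g \<otimes> h \<otimes> g"] g h by simp
  qed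
  have indep: "a = 0 \<and> b = 0" if "a *\<^sub>R w = b *\<^sub>R w'" for a b
  proof -
    have "(a *\<^sub>R w) \<bullet> (a *\<^sub>R w) = (b *\<^sub>R w') \<bullet> (b *\<^sub>R w')" using that by simp
    hence "a\<^sup>2 = b\<^sup>2" using w w' by (simp add: power2_eq_square)
    hence "a = b \<or> a = - b" by (simp add: power2_eq_iff)
    moreover have "b = 0" if "a = b" using w'(3) \<open>a *\<^sub>R w = b *\<^sub>R w'\<close> that by (metis scaleR_cancel_left)
    moreover have "b = 0" if "a = - b"
    proof (rule ccontr)
      assume "b \<noteq> 0"
      have "b *\<^sub>R (- w) = b *\<^sub>R w'" using \<open>a *\<^sub>R w = b *\<^sub>R w'\<close> \<open>a = - b\<close> by simp
      thus False using \<open>b \<noteq> 0\<close> w'(4) by (metis scaleR_cancel_left)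
    qed
    ultimately show ?thesis by auto
  qed
  define s where "s = g \<otimes> y \<otimes> inv g"
  have sc: "s \<in> carrier G" using g yc by (simp add: s_def)
  have \<rho>s: "\<rho> s v = (2 * (v \<bullet> w')) *\<^sub>R w' - v" if v: "\<rho> \<one> v = v" for v
  proof -
    have "\<rho> (inv g) v \<bullet> w = v \<bullet> w'"
      using inner_adjoint[of "inv g" v w] g by (simp add: w'_def)
    thus ?thesis
      using g yc v \<rho>y[of "\<rho> (inv g) v"] by (simp add: s_def blinfun.diff_right blinfun.scaleR_right w'_def)
  qed
  define r where "r = s \<otimes> y"
  have rc: "r \<in> carrier G" using sc yc by (simp add: r_def)
  have yy: "\<rho> y (\<rho> y v) = v" if v: "\<rho> \<one> v = v" for v
    using \<rho>y[OF v] v yw by (simp add: blinfun.diff_right blinfun.scaleR_right)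
  have ss: "\<rho> s (\<rho> s v) = v" if v: "\<rho> \<one> v = v" for v
  proof -
    have "\<rho> s w' = w'" using \<rho>s[OF w'(1)] w' by (simp add: scaleR_2)
    thus ?thesis using \<rho>s[OF v] v by (simp add: blinfun.diff_right blinfun.scaleR_right)
  qed
  have r_perp: "\<rho> r v = v" if "\<rho> \<one> v = v" "v \<bullet> w = 0" "v \<bullet> w' = 0" for v
    using that \<rho>y[of v] \<rho>s[of "- v"] sc yc by (simp add: r_def blinfun.minus_right)
  have rk_perp: "\<rho> (r [^] k) v = v" if "\<rho> \<one> v = v" "v \<bullet> w = 0" "v \<bullet> w' = 0" for v and k :: nat
    by (induction k) (use that r_perp rc in simp_all)
  \<comment> \<open>Conjugation by the half turn \<open>y\<close> inverts \<open>r\<close>.\<close>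
  have ryr: "\<rho> (r [^] k) (\<rho> y (\<rho> (r [^] k) v)) = \<rho> y v" for k :: nat and v
  proof (induction k arbitrary: v)
    case (Suc k)
    have 1: "\<rho> r (\<rho> y (\<rho> r u)) = \<rho> y u" for u
      using sc yc yy[of "\<rho> s (\<rho> y u)"] yy[of "\<rho> \<one> u"] ss[of "\<rho> y u"] by (simp add: r_def)
    have A: "\<rho> (r [^] Suc k) x = \<rho> (r [^] k) (\<rho> r x)" for x using rc by simp
    have B: "\<rho> (r [^] Suc k) x = \<rho> r (\<rho> (r [^] k) x)" for x unfolding nat_pow_Suc2[OF rc] using rc by simp
    have "\<rho> (r [^] Suc k) (\<rho> y (\<rho> (r [^] Suc k) v)) = \<rho> (r [^] k) (\<rho> r (\<rho> y (\<rho> r (\<rho> (r [^] k) v))))"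
      by (simp only: B[of v] A[of "\<rho> y (\<rho> r (\<rho> (r [^] k) v))"])
    also have "\<dots> = \<rho> (r [^] k) (\<rho> y (\<rho> (r [^] k) v))" by (simp only: 1)
    finally show ?case using Suc by simp
  qed (use yc in simp)
  define m :: nat where "m = (LEAST m. 0 < m \<and> \<rho> (r [^] m) = \<rho> \<one>)"
  obtain m0 :: nat where "0 < m0" "\<rho> (r [^] m0) = \<rho> \<one>" using finite_order[OF rc] .
  hence m: "0 < m" "\<rho> (r [^] m) = \<rho> \<one>"
    unfolding m_def by (metis (mono_tags, lifting) LeastI)+
  have m_least: "\<rho> (r [^] k) \<noteq> \<rho> \<one>" if "0 < k" "k < m" for k
    using that not_less_Least[of k "\<lambda>m. 0 < m \<and> \<rho> (r [^] m) = \<rho> \<one>"] unfolding m_def by blast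
  have yrk: "\<rho> y (\<rho> (r [^] k) v) = \<rho> (r [^] (m - k)) (\<rho> y v)" if "k \<le> m" for k v
  proof -
    have "\<rho> (r [^] (m - k)) (\<rho> y v) = \<rho> (r [^] (m - k)) (\<rho> (r [^] k) (\<rho> y (\<rho> (r [^] k) v)))"
      by (simp only: ryr)
    also have "\<dots> = \<rho> (r [^] (m - k) \<otimes> r [^] k) (\<rho> y (\<rho> (r [^] k) v))" using rc by simp
    also have "r [^] (m - k) \<otimes> r [^] k = r [^] m" using rc that by (simp add: nat_pow_mult)
    finally show ?thesis using m yc by simp
  qed
  show False
  proof (cases "even m")
    case True
    then obtain k where k: "m = 2 * k" by (elim evenE)
    let ?z = "r [^] k"
    have kp: "0 < k" "k < m" using m k by auto
    have zc: "?z \<in> carrier G" using rc by simp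
    have zz: "\<rho> ?z (\<rho> ?z v) = \<rho> \<one> v" for v
    proof -
      have "\<rho> ?z (\<rho> ?z v) = \<rho> (r [^] k \<otimes> r [^] k) v" using rc by simp
      also have "r [^] k \<otimes> r [^] k = r [^] m" using rc by (simp add: nat_pow_mult k mult_2)
      finally show ?thesis using m by simp
    qed
    have yz: "\<rho> y (\<rho> ?z v) = \<rho> ?z (\<rho> y v)" for v using yrk[of k v] k by simp
    have sz: "\<rho> s (\<rho> ?z v) = \<rho> ?z (\<rho> s v)" if v: "\<rho> \<one> v = v" for v
    proof -
      have "r \<otimes> ?z = ?z \<otimes> r" using nat_pow_Suc2[OF rc, of k] by simp
      hence "\<rho> (r \<otimes> ?z) (\<rho> y v) = \<rho> (?z \<otimes> r) (\<rho> y v)" by (simp only:)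
      hence "\<rho> r (\<rho> ?z (\<rho> y v)) = \<rho> ?z (\<rho> r (\<rho> y v))" using rc by simp
      thus ?thesis using sc yc zc v yy[of "\<rho> ?z v"] yy[OF v] yz[of v, symmetric] by (simp add: r_def)
    qed
    have fixz: "\<rho> ?z u = u"
      if u: "\<rho> \<one> u = u" "u \<bullet> u = 1" and h: "\<And>v. \<rho> \<one> v = v \<Longrightarrow> \<rho> h v = (2 * (v \<bullet> u)) *\<^sub>R u - v"
        and hz: "\<rho> h (\<rho> ?z u) = \<rho> ?z (\<rho> h u)" and nf: "\<rho> ?z u \<noteq> - u" for u h
    proof -
      have hu: "\<rho> h u = u" using h[OF u(1)] u by (simp add: scaleR_2)
      let ?c = "\<rho> ?z u \<bullet> u"
      have "(2 * ?c) *\<^sub>R u - \<rho> ?z u = \<rho> ?z u" using h[of "\<rho> ?z u"] hz hu zc by simp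
      hence "2 *\<^sub>R (?c *\<^sub>R u) = 2 *\<^sub>R \<rho> ?z u" by (simp add: scaleR_2 algebra_simps)
      hence eq: "\<rho> ?z u = ?c *\<^sub>R u" by (metis scaleR_cancel_left zero_neq_numeral)
      have "?c * ?c = 1" using inner_\<rho>[OF zc u(1), of u] u(2) eq by (metis inner_scaleR_left inner_scaleR_right mult.right_neutral)
      hence "?c = 1 \<or> ?c = -1" by (simp add: square_eq_1_iff)
      thus ?thesis using eq nf by (metis scaleR_minus1_left scaleR_one)
    qed
    have zw: "\<rho> ?z w = w" by (rule fixz[OF w(1,3) \<rho>y yz noflip[OF zc]])
    have zw': "\<rho> ?z w' = w'" by (rule fixz[OF w'(1,2) \<rho>s sz[OF w'(1)] noflip'[OF zc]])
    have "\<rho> ?z v = \<rho> \<one> v" for v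
    proof -
      let ?d = "\<rho> ?z v - \<rho> \<one> v"
      have d: "\<rho> \<one> ?d = ?d" using zc by (simp add: blinfun.diff_right)
      have "?d \<bullet> u = 0" if "\<rho> ?z u = u" "\<rho> \<one> u = u" for u
      proof -
        have "\<rho> ?z v \<bullet> u = \<rho> ?z v \<bullet> \<rho> ?z u" using that by simp
        also have "\<dots> = \<rho> \<one> v \<bullet> u" using \<rho>_inner[OF zc] by simp
        finally show ?thesis by (simp add: inner_diff_left)
      qed
      hence "\<rho> ?z ?d = ?d" using rk_perp[OF d] zw zw' w w' by blast
      hence "?d = 0" by (rule range_inter_kernel[OF zc HOL.refl])
      thus ?thesis by simp
    qed
    thus False using m_least[OF kp] by (simp add: blinfun_eqI)
  next
    case False
    then obtain k where k: "m = 2 * k + 1" by (elim oddE)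
    define u where "u = \<tau> (y \<otimes> y)"
    have \<rho>yy: "\<rho> (y \<otimes> y) = \<rho> \<one>" using yc yy by (intro \<rho>_eqI) simp_all
    have uL: "u \<in> L" unfolding u_def by (rule LI) (use yc \<rho>yy in simp_all)
    have uU: "\<rho> \<one> u = u" using uL by (rule L_fixed)
    have yu: "\<rho> y u = u"
      using yc yy[of "\<tau> y"] by (simp add: u_def \<tau>_mult \<tau>_fixed blinfun.add_right add.commute)
    have "2 *\<^sub>R u = 2 *\<^sub>R ((u \<bullet> w) *\<^sub>R w)" using \<rho>y[OF uU] yu by (simp add: scaleR_2 algebra_simps)
    hence uw: "u = (u \<bullet> w) *\<^sub>R w" by (metis scaleR_cancel_left zero_neq_numeral)
    \<comment> \<open>\<open>N\<close> is fixed by \<open>r\<close>, so \<open>s\<close> and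
      \<open>y\<close> agree on it, and comparing their formulas makes \<open>N\<close> orthogonal
      to both axes. Since \<open>u\<close> lies on the axis \<open>w\<close> and all powers of
      \<open>r\<close> fix \<open>N\<close>, it is orthogonal to each of its own summands.\<close>
    define N where "N = (\<Sum>i<m. \<rho> (r [^] i) u)"
    have NL: "N \<in> L" unfolding N_def using rc uL by (intro L_sum L_action) auto
    have NU: "\<rho> \<one> N = N" using NL by (rule L_fixed)
    have rN: "\<rho> r N = N"
    proof -
      have "\<rho> r N = (\<Sum>i<m. \<rho> (r [^] Suc i) u)"
        unfolding N_def blinfun.sum_right nat_pow_Suc2[OF rc] using rc by simp
      also have "\<dots> + \<rho> (r [^] (0::nat)) u = (\<Sum>i<Suc m. \<rho> (r [^] i) u)"
        by (simp only: sum.lessThan_Suc_shift add.commute)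
      also have "\<dots> = N + \<rho> (r [^] m) u" by (simp add: N_def)
      finally show ?thesis using m(2) by simp
    qed
    have "\<rho> s N = \<rho> s (\<rho> s (\<rho> y N))" using rN sc yc by (simp add: r_def)
    hence "\<rho> s N = \<rho> y N" using ss[of "\<rho> y N"] yc by simp
    hence "(2 * (N \<bullet> w')) *\<^sub>R w' = (2 * (N \<bullet> w)) *\<^sub>R w" using \<rho>s[OF NU] \<rho>y[OF NU] by simp
    hence "2 * (N \<bullet> w) = 0 \<and> 2 * (N \<bullet> w') = 0" by (intro indep) simp
    hence Nw: "N \<bullet> w = 0" "N \<bullet> w' = 0" by simp_all
    have "\<rho> (r [^] i) u \<bullet> N = 0" for i :: nat
    proof -
      have "\<rho> (r [^] i) u \<bullet> N = \<rho> (r [^] i) u \<bullet> \<rho> (r [^] i) N" using rk_perp[OF NU Nw] by simp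
      also have "\<dots> = u \<bullet> N" using inner_\<rho>[OF _ uU] rc by simp
      also have "\<dots> = 0" using uw Nw by (metis inner_commute inner_scaleR_left mult_zero_right)
      finally show ?thesis .
    qed
    hence "N \<bullet> N = 0" by (subst (1) N_def) (simp add: inner_sum_left)
    hence N0: "N = 0" by simp
    \<comment> \<open>The first half of the sum without the term \<open>u\<close>;
      \<open>\<rho> y\<close> exchanges it with the second half. The equation
      \<open>u + (z + \<rho> y z) = 0\<close> says exactly that \<open>y\<close>, shifted by
      \<open>z\<close>, squares to \<open>\<one>\<close>.\<close>
    define z where "z = (\<Sum>i<k. \<rho> (r [^] Suc i) u)"
    have zL: "z \<in> L" unfolding z_def using rc uL by (intro L_sum L_action) auto
    have "\<rho> y z = (\<Sum>i<k. \<rho> (r [^] (2 * k - i)) u)"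
      unfolding z_def blinfun.sum_right
    proof (rule sum.cong[OF HOL.refl])
      fix i assume "i \<in> {..<k}"
      thus "\<rho> y (\<rho> (r [^] Suc i) u) = \<rho> (r [^] (2 * k - i)) u"
        using yrk[of "Suc i" u] yu k by simp
    qed
    hence sum0: "u + (z + \<rho> y z) = 0"
      using N0 uU unfolding N_def k sum_odd_symmetric by (simp add: z_def sum.distrib)
    obtain n where n: "n \<in> carrier G" "\<rho> n = \<rho> \<one>" "\<tau> n = z" using LE[OF zL] .
    let ?h = "n \<otimes> y"
    have hc: "?h \<in> carrier G" using n yc by simp
    have \<rho>h: "\<rho> ?h v = \<rho> y v" for v using n yc by simp
    have "?h \<otimes> ?h = \<one>"
    proof (rule faithful)
      show "\<rho> (?h \<otimes> ?h) = \<rho> \<one>" using hc \<rho>yy yc by (intro \<rho>_eqI) (simp_all add: \<rho>h yy)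
      have "\<tau> ?h = z + \<tau> y" using n yc by (simp add: \<tau>_mult \<tau>_fixed)
      hence "\<tau> (?h \<otimes> ?h) = z + \<tau> y + \<rho> y (z + \<tau> y)" using hc by (simp add: \<tau>_mult \<rho>h)
      also have "\<dots> = u + (z + \<rho> y z)" using yc by (simp add: u_def \<tau>_mult blinfun.add_right)
      finally show "\<tau> (?h \<otimes> ?h) = 0" using sum0 by simp
    qed (use hc in simp)
    hence "?h [^] (2::nat) = \<one>" using hc by (simp add: numeral_2_eq_2)
    hence "?h = \<one>" using torsion_free hc unfolding torsion_free_group_def by (metis zero_less_numeral)
    hence "\<rho> y w' = w'" using \<rho>h[of w'] w' by simp
    hence "2 *\<^sub>R ((w' \<bullet> w) *\<^sub>R w) = 2 *\<^sub>R w'" using \<rho>y[OF w'(1)] by (simp add: scaleR_2 algebra_simps)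
    hence "(w' \<bullet> w) *\<^sub>R w = 1 *\<^sub>R w'" by (metis scaleR_cancel_left scaleR_one zero_neq_numeral)
    thus False using indep by (metis zero_neq_one)
  qed
qed

end

text \<open>The first-order condition at a minimum, tested at \<open>t = - B / (2 * D)\<close> with
  \<open>D\<close> a positive upper bound of \<open>C\<close>.\<close>

lemma linear_coefficient_zero:
  fixes B C :: real
  assumes "\<And>t. t * B + t\<^sup>2 * C \<ge> 0"
  shows "B = 0"
proof (rule ccontr)
  assume B: "B \<noteq> 0"
  define D where "D = \<bar>C\<bar> + 1"
  have D: "D > 0" "C \<le> D" by (auto simp: D_def)
  have "0 \<le> (- B / (2 * D)) * B + (- B / (2 * D))\<^sup>2 * C" by (rule assms)
  also have "\<dots> \<le> (- B / (2 * D)) * B + (- B / (2 * D))\<^sup>2 * D" using D by (intro add_left_mono mult_left_mono) auto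
  also have "\<dots> = - (B\<^sup>2 / (4 * D))" using D by (simp add: field_simps power2_eq_square)
  also have "\<dots> < 0" using D B by simp
  finally show False by simp
qed

section \<open>Elements of negative trace\<close>

context crystal_action
begin

text \<open>For the operators \<open>\<rho> g\<close> this trace on the ambient space is the trace
  on the range of \<open>\<rho> \<one>\<close> (\<open>tr_onb\<close>), because the orthogonal
  complement of that range is sent to zero.\<close>

definition tr where "tr f = (\<Sum>b\<in>Basis. blinfun_apply f b \<bullet> b)" for f :: "'a \<Rightarrow>\<^sub>L 'a"

text \<open>The sum runs over the finite set of linear parts, not over \<open>G\<close>. Composition
  with \<open>\<rho> h\<close> permutes this set, so the sum is a common fixed vector.\<close>

lemma sum_holonomy: "(\<Sum>f\<in>\<rho> ` carrier G. blinfun_apply f v) = 0" (is "?S = 0")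
proof -
  have "\<rho> h ?S = ?S" if h: "h \<in> carrier G" for h
  proof -
    let ?t = "\<lambda>f. \<rho> h o\<^sub>L f"
    have inj: "inj_on ?t (\<rho> ` carrier G)"
    proof (rule inj_onI)
      fix f f' assume ff: "f \<in> \<rho> ` carrier G" "f' \<in> \<rho> ` carrier G" "\<rho> h o\<^sub>L f = \<rho> h o\<^sub>L f'"
      have "\<rho> (inv h) ((\<rho> h o\<^sub>L f) x) = \<rho> (inv h) ((\<rho> h o\<^sub>L f') x)" for x using ff(3) by simp
      thus "f = f'" using ff(1,2) h by (auto intro!: blinfun_eqI)
    qed
    moreover have "?t ` (\<rho> ` carrier G) \<subseteq> \<rho> ` carrier G"
    proof
      fix f assume "f \<in> ?t ` (\<rho> ` carrier G)"
      then obtain g where "g \<in> carrier G" "f = \<rho> h o\<^sub>L \<rho> g" by blast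
      thus "f \<in> \<rho> ` carrier G" using \<rho>_mult[OF h] h by (metis imageI m_closed)
    qed
    ultimately have surj: "?t ` (\<rho> ` carrier G) = \<rho> ` carrier G"
      using finite_holonomy by (intro endo_inj_surj)
    have "\<rho> h ?S = (\<Sum>f\<in>\<rho> ` carrier G. blinfun_apply (?t f) v)" by (simp add: blinfun.sum_right)
    also have "\<dots> = (\<Sum>f\<in>?t ` (\<rho> ` carrier G). blinfun_apply f v)"
      unfolding sum.reindex[OF inj] by simp
    finally show ?thesis unfolding surj .
  qed
  thus ?thesis using no_fixed by blast
qed

lemma sum_tr: "(\<Sum>f\<in>\<rho> ` carrier G. tr f) = 0"
proof -
  have "(\<Sum>f\<in>\<rho> ` carrier G. tr f) = (\<Sum>b\<in>Basis. (\<Sum>f\<in>\<rho> ` carrier G. blinfun_apply f b) \<bullet> b)"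
    unfolding tr_def inner_sum_left by (rule sum.swap)
  thus ?thesis by (simp add: sum_holonomy)
qed

lemma tr_one: "tr (\<rho> \<one>) > 0"
proof -
  have eq: "tr (\<rho> \<one>) = (\<Sum>b\<in>Basis. (norm (\<rho> \<one> b))\<^sup>2)"
    unfolding tr_def using \<rho>_inner[of \<one>] by (simp add: power2_norm_eq_inner)
  have "tr (\<rho> \<one>) \<noteq> 0"
  proof
    assume "tr (\<rho> \<one>) = 0"
    hence "\<rho> \<one> b = 0" if "b \<in> Basis" for b
      using that unfolding eq by (subst (asm) sum_nonneg_eq_0_iff) auto
    hence "\<rho> \<one> = 0" by (intro blinfun_euclidean_eqI) simp
    moreover obtain w where "\<rho> \<one> w = w" "norm w = 1" using has_fixed_vector[OF one_closed] .
    ultimately show False by simp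
  qed
  moreover have "tr (\<rho> \<one>) \<ge> 0" unfolding eq by (rule sum_nonneg) simp
  ultimately show ?thesis by simp
qed

text \<open>Orthonormal basis of the range of \<open>\<rho> \<one>\<close>; completeness is phrased
  through orthogonality because this is what \<open>five_orthogonal\<close> delivers.\<close>

definition onb where
  "onb B \<longleftrightarrow> finite B \<and> (\<forall>b\<in>B. \<rho> \<one> b = b \<and> b \<bullet> b = 1) \<and> (\<forall>a\<in>B. \<forall>b\<in>B. a \<noteq> b \<longrightarrow> a \<bullet> b = 0) \<and>
     (\<forall>x. \<rho> \<one> x = x \<longrightarrow> (\<forall>b\<in>B. x \<bullet> b = 0) \<longrightarrow> x = 0)"

lemma onb_expansion:
  assumes B: "onb B" shows "\<rho> \<one> v = (\<Sum>e\<in>B. (v \<bullet> e) *\<^sub>R e)"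
proof -
  let ?d = "\<rho> \<one> v - (\<Sum>e\<in>B. (v \<bullet> e) *\<^sub>R e)"
  have "\<rho> \<one> ?d = ?d"
    using B by (simp add: onb_def blinfun.diff_right blinfun.sum_right blinfun.scaleR_right)
  moreover have "?d \<bullet> b = 0" if b: "b \<in> B" for b
  proof -
    have "(\<Sum>e\<in>B. (v \<bullet> e) *\<^sub>R e) \<bullet> b = (\<Sum>e\<in>B. if e = b then v \<bullet> b else 0)"
      unfolding inner_sum_left by (rule sum.cong) (use B b in \<open>auto simp: onb_def\<close>)
    also have "\<dots> = v \<bullet> b" using B b by (simp add: onb_def)
    finally show ?thesis using B b by (simp add: inner_diff_left inner_projection onb_def)
  qed
  ultimately have "?d = 0" using B unfolding onb_def by blast
  thus ?thesis by simp
qed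

lemma tr_onb:
  assumes B: "onb B" and g: "g \<in> carrier G" shows "tr (\<rho> g) = (\<Sum>e\<in>B. \<rho> g e \<bullet> e)"
proof -
  have "\<rho> g b \<bullet> b = (\<Sum>e\<in>B. (b \<bullet> e) * (\<rho> g e \<bullet> b))" for b
  proof -
    have "\<rho> g b = \<rho> g (\<Sum>e\<in>B. (b \<bullet> e) *\<^sub>R e)"
      unfolding onb_expansion[OF B, symmetric] using g by simp
    thus ?thesis by (simp add: blinfun.sum_right blinfun.scaleR_right inner_sum_left)
  qed
  hence "tr (\<rho> g) = (\<Sum>b\<in>Basis. \<Sum>e\<in>B. (b \<bullet> e) * (\<rho> g e \<bullet> b))" by (simp add: tr_def)
  also have "\<dots> = (\<Sum>e\<in>B. \<Sum>b\<in>Basis. (b \<bullet> e) * (\<rho> g e \<bullet> b))" by (rule sum.swap)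
  also have "\<dots> = (\<Sum>e\<in>B. \<rho> g e \<bullet> (\<Sum>b\<in>Basis. (e \<bullet> b) *\<^sub>R b))"
    by (simp add: inner_sum_right inner_commute)
  finally show ?thesis by (simp add: euclidean_representation)
qed

text \<open>A real substitute for diagonalising over the complex numbers: a minimum \<open>p\<close>
  of the quadratic form of \<open>\<rho> g\<close> on the unit sphere of \<open>S\<close> is an
  eigenvector of the symmetric map \<open>\<rho> g + \<rho> (inv g)\<close>, so \<open>p\<close> and
  \<open>\<rho> g p\<close> span an invariant subspace.\<close>

lemma min_vector:
  assumes g: "g \<in> carrier G" and S: "subspace S" "S \<noteq> {0}" "\<And>x. x \<in> S \<Longrightarrow> \<rho> \<one> x = x"
    and inv: "\<And>x. x \<in> S \<Longrightarrow> \<rho> g x \<in> S" "\<And>x. x \<in> S \<Longrightarrow> \<rho> (inv g) x \<in> S"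
  shows "\<exists>p\<in>S. p \<bullet> p = 1 \<and> (\<forall>x\<in>S. \<rho> g x \<bullet> x \<ge> (\<rho> g p \<bullet> p) * (x \<bullet> x)) \<and>
    \<rho> g p + \<rho> (inv g) p = (2 * (\<rho> g p \<bullet> p)) *\<^sub>R p"
proof -
  let ?K = "S \<inter> sphere 0 1"
  have "compact ?K" using S(1) by (simp add: closed_subspace closed_Int_compact)
  moreover obtain x0 where x0: "x0 \<in> S" "x0 \<noteq> 0" using S subspace_0 by blast
  hence "x0 /\<^sub>R norm x0 \<in> ?K" using S(1) by (auto simp: subspace_scale)
  hence "?K \<noteq> {}" by blast
  moreover have "continuous_on ?K (\<lambda>x. \<rho> g x \<bullet> x)" by (intro continuous_intros)
  ultimately obtain p where p: "p \<in> ?K" "\<And>x. x \<in> ?K \<Longrightarrow> \<rho> g p \<bullet> p \<le> \<rho> g x \<bullet> x"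
    using continuous_attains_inf[of ?K "\<lambda>x. \<rho> g x \<bullet> x"] by blast
  have pS: "p \<in> S" and p1: "p \<bullet> p = 1" using p(1) by (auto simp: dot_square_norm)
  let ?c = "\<rho> g p \<bullet> p"
  have min: "\<rho> g x \<bullet> x \<ge> ?c * (x \<bullet> x)" if x: "x \<in> S" for x
  proof (cases "x = 0")
    case False
    have "x /\<^sub>R norm x \<in> ?K" using x False S(1) by (auto simp: subspace_scale)
    hence "?c \<le> \<rho> g (x /\<^sub>R norm x) \<bullet> (x /\<^sub>R norm x)" by (rule p(2))
    also have "\<dots> = (\<rho> g x \<bullet> x) / (norm x)\<^sup>2"
      by (simp add: blinfun.scaleR_right power2_eq_square divide_inverse)
    finally show ?thesis using False by (simp add: pos_le_divide_eq power2_norm_eq_inner)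
  qed (simp add: blinfun.zero_right)
  \<comment> \<open>The residue that has to vanish. Taken as the direction of variation, it makes
    the linear coefficient \<open>?B\<close> equal to \<open>?h \<bullet> ?h\<close>.\<close>
  let ?h = "\<rho> g p + \<rho> (inv g) p - (2 * ?c) *\<^sub>R p"
  have hS: "?h \<in> S" using pS inv S(1) by (auto intro!: subspace_diff subspace_add subspace_scale)
  let ?B = "\<rho> g p \<bullet> ?h + \<rho> g ?h \<bullet> p - 2 * ?c * (p \<bullet> ?h)"
  let ?C = "\<rho> g ?h \<bullet> ?h - ?c * (?h \<bullet> ?h)"
  have "t * ?B + t\<^sup>2 * ?C \<ge> 0" for t
  proof -
    have "p + t *\<^sub>R ?h \<in> S" using pS hS S(1) by (intro subspace_add subspace_scale)
    from min[OF this] have "?c * ((p + t *\<^sub>R ?h) \<bullet> (p + t *\<^sub>R ?h)) \<le> \<rho> g (p + t *\<^sub>R ?h) \<bullet> (p + t *\<^sub>R ?h)" .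
    moreover have "(p + t *\<^sub>R h) \<bullet> (p + t *\<^sub>R h) = 1 + 2 * t * (p \<bullet> h) + t\<^sup>2 * (h \<bullet> h)" for h
      using p1 by (simp add: inner_add_left inner_add_right inner_commute power2_eq_square)
    moreover have "\<rho> g (p + t *\<^sub>R h) \<bullet> (p + t *\<^sub>R h)
        = ?c + t * (\<rho> g p \<bullet> h + \<rho> g h \<bullet> p) + t\<^sup>2 * (\<rho> g h \<bullet> h)" for h
      by (simp add: blinfun.add_right blinfun.scaleR_right inner_add_left inner_add_right power2_eq_square algebra_simps)
    ultimately have "?c * (1 + 2 * t * (p \<bullet> ?h) + t\<^sup>2 * (?h \<bullet> ?h))
        \<le> ?c + t * (\<rho> g p \<bullet> ?h + \<rho> g ?h \<bullet> p) + t\<^sup>2 * (\<rho> g ?h \<bullet> ?h)" by (simp only:)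
    thus ?thesis by (simp only: algebra_simps)
  qed
  hence "?B = 0" by (rule linear_coefficient_zero)
  moreover have "\<rho> g ?h \<bullet> p = ?h \<bullet> \<rho> (inv g) p" by (rule inner_adjoint[OF g])
  ultimately have "?h \<bullet> ?h = 0" by (simp add: inner_diff_left inner_add_left inner_commute)
  hence "\<rho> g p + \<rho> (inv g) p = (2 * ?c) *\<^sub>R p" by simp
  thus ?thesis using pS p1 min by blast
qed

definition rotates where
  "rotates g p q c s \<longleftrightarrow> g \<in> carrier G \<and> \<rho> \<one> p = p \<and> \<rho> \<one> q = q \<and> p \<bullet> p = 1 \<and> q \<bullet> q = 1 \<and> p \<bullet> q = 0 \<and>
     \<rho> g p = c *\<^sub>R p + s *\<^sub>R q \<and> \<rho> g q = (- s) *\<^sub>R p + c *\<^sub>R q \<and> c\<^sup>2 + s\<^sup>2 = 1"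

text \<open>If the minimum \<open>p\<close> is an eigenvector, its eigenvalue is 1 or -1, and 1 can
  only be the minimum when \<open>\<rho> g\<close> is the identity on \<open>S\<close>. Otherwise
  \<open>\<rho> g (\<rho> g p)\<close> is \<open>2 * c\<close> times \<open>\<rho> g p\<close> minus
  \<open>p\<close>, and orthonormalising \<open>p\<close> and \<open>\<rho> g p\<close> gives a
  rotation matrix.\<close>

lemma min_vector_cases:
  assumes g: "g \<in> carrier G" and S: "subspace S" "S \<noteq> {0}" "\<And>x. x \<in> S \<Longrightarrow> \<rho> \<one> x = x"
    and inv: "\<And>x. x \<in> S \<Longrightarrow> \<rho> g x \<in> S" "\<And>x. x \<in> S \<Longrightarrow> \<rho> (inv g) x \<in> S"
  obtains (identity) "\<And>x. x \<in> S \<Longrightarrow> \<rho> g x = x"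
  | (negative) p where "p \<in> S" "p \<bullet> p = 1" "\<rho> g p = - p"
  | (plane) p q c s where "p \<in> S" "q \<in> S" "rotates g p q c s"
proof -
  from min_vector[OF assms] obtain p where pS: "p \<in> S" and p0: "p \<bullet> p = 1 \<and>
      (\<forall>x\<in>S. \<rho> g x \<bullet> x \<ge> (\<rho> g p \<bullet> p) * (x \<bullet> x)) \<and> \<rho> g p + \<rho> (inv g) p = (2 * (\<rho> g p \<bullet> p)) *\<^sub>R p" ..
  have min: "\<rho> g x \<bullet> x \<ge> (\<rho> g p \<bullet> p) * (x \<bullet> x)" if "x \<in> S" for x
    by (rule bspec[OF conjunct1[OF conjunct2[OF p0]] that])
  note p = pS conjunct1[OF p0] conjunct2[OF conjunct2[OF p0]]
  define c where "c = \<rho> g p \<bullet> p"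
  define q' where "q' = \<rho> g p - c *\<^sub>R p"
  have pU: "\<rho> \<one> p = p" using S(3) p(1) .
  have fp1: "\<rho> g p \<bullet> \<rho> g p = 1" using inner_\<rho>[OF g pU, of p] p(2) by simp
  have q'q': "q' \<bullet> q' = 1 - c\<^sup>2"
  proof -
    have "p \<bullet> \<rho> g p = c" by (simp add: c_def inner_commute)
    thus ?thesis using fp1 p(2) by (simp add: q'_def inner_diff_left inner_diff_right c_def[symmetric] power2_eq_square)
  qed
  show thesis
  proof (cases "q' = 0")
    case True
    hence fp: "\<rho> g p = c *\<^sub>R p" by (simp add: q'_def)
    have "c\<^sup>2 = 1" using q'q' True by simp
    hence "c = 1 \<or> c = -1" by (simp add: power2_eq_1_iff)
    thus thesis
    proof
      assume c: "c = 1"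
      have "\<rho> g x = x" if x: "x \<in> S" for x
      proof -
        have "(\<rho> g x - x) \<bullet> (\<rho> g x - x) = 2 * (x \<bullet> x) - 2 * (\<rho> g x \<bullet> x)"
          using inner_\<rho>[OF g S(3)[OF x], of x] by (simp add: inner_diff_left inner_diff_right inner_commute)
        also have "\<dots> \<le> 0" using min[OF x] c by (simp add: c_def)
        finally have "(\<rho> g x - x) \<bullet> (\<rho> g x - x) = 0"
          using inner_ge_zero[of "\<rho> g x - x"] by (rule antisym)
        hence "\<rho> g x - x = 0" by (simp only: inner_eq_zero_iff)
        thus ?thesis by (simp only: right_minus_eq)
      qed
      thus thesis by (rule identity)
    next
      assume "c = -1"
      thus thesis using negative p(1,2) fp by simp
    qed
  next
    case False
    define s where "s = norm q'"
    define q where "q = q' /\<^sub>R s"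
    have s: "s > 0" using False by (simp add: s_def)
    have s2: "s\<^sup>2 = 1 - c\<^sup>2" using q'q' by (simp add: s_def power2_norm_eq_inner)
    have q': "q' = s *\<^sub>R q" using s by (simp add: q_def)
    have fp: "\<rho> g p = c *\<^sub>R p + s *\<^sub>R q" using q' by (simp add: q'_def algebra_simps)
    have qS: "q \<in> S" using S(1) p(1) inv(1) by (auto simp: q_def q'_def intro!: subspace_scale subspace_diff)
    have pq': "p \<bullet> q' = 0" using p(2) by (simp add: q'_def inner_diff_right c_def inner_commute)
    have "\<rho> g (\<rho> g p + \<rho> (inv g) p) = \<rho> g ((2 * c) *\<^sub>R p)" using p(3) by (simp add: c_def)
    hence ffp: "\<rho> g (\<rho> g p) = (2 * c) *\<^sub>R \<rho> g p - p"
      using g pU by (simp add: blinfun.add_right blinfun.scaleR_right eq_diff_eq)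
    have "s *\<^sub>R \<rho> g q = \<rho> g q'" by (simp add: q' blinfun.scaleR_right)
    also have "\<dots> = c *\<^sub>R \<rho> g p - p" by (simp add: q'_def blinfun.diff_right blinfun.scaleR_right ffp algebra_simps flip: scaleR_add_left)
    also have "\<dots> = (c\<^sup>2 - 1) *\<^sub>R p + (c * s) *\<^sub>R q" by (simp add: fp algebra_simps power2_eq_square)
    also have "\<dots> = s *\<^sub>R ((- s) *\<^sub>R p + c *\<^sub>R q)"
    proof -
      have "c\<^sup>2 - 1 = - (s * s)" using s2 by (simp add: power2_eq_square)
      thus ?thesis by (simp add: scaleR_diff_right mult.commute)
    qed
    finally have fq: "\<rho> g q = (- s) *\<^sub>R p + c *\<^sub>R q" using s by (metis less_irrefl scaleR_cancel_left)
    have "rotates g p q c s"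
      unfolding rotates_def
    proof (intro conjI)
      show "q \<bullet> q = 1" using s by (simp add: q_def s_def dot_square_norm power2_eq_square)
      show "p \<bullet> q = 0" using pq' by (simp add: q_def)
    qed (use g S(3) qS p(1,2) fp fq s2 in simp_all)
    thus thesis using plane p(1) qS by blast
  qed
qed

end

context crystal_action
begin

section \<open>Normal form of elements with negative trace\<close>

definition unit where "unit v \<longleftrightarrow> \<rho> \<one> v = v \<and> v \<bullet> v = 1"

lemma unit_nonzero: "unit v \<Longrightarrow> v \<noteq> 0" by (auto simp: unit_def)

lemma unit_neq: "unit v \<Longrightarrow> v \<bullet> w = 0 \<Longrightarrow> v \<noteq> w" by (auto simp: unit_def)

lemma unit_scale: assumes "\<rho> \<one> x = x" "x \<noteq> 0" shows "unit (x /\<^sub>R norm x)"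
  using assms by (simp add: unit_def blinfun.scaleR_right power2_eq_square field_simps flip: power2_norm_eq_inner)

lemma onb_1:
  assumes "unit w" "\<And>x. \<rho> \<one> x = x \<Longrightarrow> x \<bullet> w = 0 \<Longrightarrow> x = 0" "g \<in> carrier G"
  shows "tr (\<rho> g) = \<rho> g w \<bullet> w"
proof -
  have "onb {w}" using assms by (simp add: onb_def unit_def)
  thus ?thesis using tr_onb assms(3) by fastforce
qed

lemma onb_2:
  assumes "unit w" "unit p" "w \<bullet> p = 0" and g: "g \<in> carrier G"
    and "\<And>x. \<rho> \<one> x = x \<Longrightarrow> x \<bullet> w = 0 \<Longrightarrow> x \<bullet> p = 0 \<Longrightarrow> x = 0"
  shows "tr (\<rho> g) = \<rho> g w \<bullet> w + \<rho> g p \<bullet> p"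
proof -
  have "onb {w, p}" using assms by (auto simp: onb_def unit_def inner_commute)
  thus ?thesis using tr_onb[OF _ g, of "{w, p}"] unit_neq[OF assms(1,3)] by simp
qed

lemma onb_3:
  assumes "unit w" "unit p" "unit q" "w \<bullet> p = 0" "w \<bullet> q = 0" "p \<bullet> q = 0" and g: "g \<in> carrier G"
    and "\<And>x. \<rho> \<one> x = x \<Longrightarrow> x \<bullet> w = 0 \<Longrightarrow> x \<bullet> p = 0 \<Longrightarrow> x \<bullet> q = 0 \<Longrightarrow> x = 0"
  shows "tr (\<rho> g) = \<rho> g w \<bullet> w + \<rho> g p \<bullet> p + \<rho> g q \<bullet> q"
proof -
  have "onb {w, p, q}" using assms by (auto simp: onb_def unit_def inner_commute)
  thus ?thesis
    using tr_onb[OF _ g, of "{w, p, q}"] unit_neq[OF assms(1,4)] unit_neq[OF assms(1,5)] unit_neq[OF assms(2,6)] by simp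
qed

lemma onb_4:
  assumes "unit w" "unit p" "unit q" "unit e"
    and orth: "w \<bullet> p = 0" "w \<bullet> q = 0" "p \<bullet> q = 0" "w \<bullet> e = 0" "p \<bullet> e = 0" "q \<bullet> e = 0"
  shows "\<rho> \<one> x = x \<Longrightarrow> x \<bullet> w = 0 \<Longrightarrow> x \<bullet> p = 0 \<Longrightarrow> x \<bullet> q = 0 \<Longrightarrow> x \<bullet> e = 0 \<Longrightarrow> x = 0"
    and "g \<in> carrier G \<Longrightarrow> tr (\<rho> g) = \<rho> g w \<bullet> w + \<rho> g p \<bullet> p + \<rho> g q \<bullet> q + \<rho> g e \<bullet> e"
    and "\<rho> \<one> x = x \<Longrightarrow> x = (x \<bullet> w) *\<^sub>R w + (x \<bullet> p) *\<^sub>R p + (x \<bullet> q) *\<^sub>R q + (x \<bullet> e) *\<^sub>R e"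
proof -
  have U: "\<rho> \<one> w = w" "\<rho> \<one> p = p" "\<rho> \<one> q = q" "\<rho> \<one> e = e" and nz: "w \<noteq> 0" "p \<noteq> 0" "q \<noteq> 0" "e \<noteq> 0"
    using assms(1-4) unit_nonzero by (auto simp: unit_def)
  have complete: "x = 0" if "\<rho> \<one> x = x" "x \<bullet> w = 0" "x \<bullet> p = 0" "x \<bullet> q = 0" "x \<bullet> e = 0" for x
    using five_orthogonal[of x w p q e] that U nz orth by blast
  thus "\<rho> \<one> x = x \<Longrightarrow> x \<bullet> w = 0 \<Longrightarrow> x \<bullet> p = 0 \<Longrightarrow> x \<bullet> q = 0 \<Longrightarrow> x \<bullet> e = 0 \<Longrightarrow> x = 0" .
  have onb: "onb {w, p, q, e}" using assms complete by (auto simp: onb_def unit_def inner_commute)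
  note ne = unit_neq[OF assms(1) orth(1)] unit_neq[OF assms(1) orth(2)] unit_neq[OF assms(2) orth(3)]
    unit_neq[OF assms(1) orth(4)] unit_neq[OF assms(2) orth(5)] unit_neq[OF assms(3) orth(6)]
  show "tr (\<rho> g) = \<rho> g w \<bullet> w + \<rho> g p \<bullet> p + \<rho> g q \<bullet> q + \<rho> g e \<bullet> e" if "g \<in> carrier G"
    using tr_onb[OF onb that] ne by simp
  show "x = (x \<bullet> w) *\<^sub>R w + (x \<bullet> p) *\<^sub>R p + (x \<bullet> q) *\<^sub>R q + (x \<bullet> e) *\<^sub>R e" if "\<rho> \<one> x = x"
    using onb_expansion[OF onb, of x] that ne by (simp add: add.assoc)
qed

text \<open>The last clause separates the dimensions: with no further direction the trace is
  \<open>1 + 2 * c\<close>, and its sign gives \<open>c < - 1 / 2\<close>; in dimension 4 a unit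
  vector \<open>e\<close> is left, it is negated, and the trace is \<open>2 * c\<close>.\<close>

definition neg_form where
  "neg_form g w p q c s \<longleftrightarrow> rotates g p q c s \<and> unit w \<and> \<rho> g w = w \<and> w \<bullet> p = 0 \<and> w \<bullet> q = 0 \<and> c < 0 \<and>
     (\<forall>x. \<rho> \<one> x = x \<longrightarrow> x \<bullet> w = 0 \<longrightarrow> x \<bullet> p = 0 \<longrightarrow> x \<bullet> q = 0 \<longrightarrow> \<rho> g x = - x) \<and>
     (c < - 1 / 2 \<or> (\<exists>e. unit e \<and> w \<bullet> e = 0 \<and> p \<bullet> e = 0 \<and> q \<bullet> e = 0 \<and> tr (\<rho> g) = 2 * c))"

lemma rotates_unit: "rotates g p q c s \<Longrightarrow> unit p" "rotates g p q c s \<Longrightarrow> unit q"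
  by (simp_all add: rotates_def unit_def)

lemma rotates_perp:
  assumes r: "rotates g p q c s" and x: "\<rho> \<one> x = x" "x \<bullet> p = 0" "x \<bullet> q = 0"
  shows "\<rho> g x \<bullet> p = 0" "\<rho> g x \<bullet> q = 0"
proof -
  have g: "g \<in> carrier G" and cs: "c * c + s * s = 1"
    and fp: "\<rho> g p = c *\<^sub>R p + s *\<^sub>R q" and fq: "\<rho> g q = (- s) *\<^sub>R p + c *\<^sub>R q"
    using r by (simp_all add: rotates_def power2_eq_square)
  let ?a = "\<rho> g x \<bullet> p" and ?b = "\<rho> g x \<bullet> q"
  have 1: "c * ?a + s * ?b = 0" using inner_\<rho>[OF g x(1), of p] x by (simp add: fp inner_add_right)
  have 2: "- s * ?a + c * ?b = 0" using inner_\<rho>[OF g x(1), of q] x by (simp add: fq inner_add_right inner_diff_right)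
  have "?a = (c * c + s * s) * ?a" using cs by simp
  also have "\<dots> = c * (c * ?a + s * ?b) - s * (- s * ?a + c * ?b)" by (simp add: algebra_simps)
  finally show "?a = 0" using 1 2 by simp
  have "?b = (c * c + s * s) * ?b" using cs by simp
  also have "\<dots> = s * (c * ?a + s * ?b) + c * (- s * ?a + c * ?b)" by (simp add: algebra_simps)
  finally show "?b = 0" using 1 2 by simp
qed

text \<open>A fourth direction \<open>e\<close> is an eigenvector because its image stays orthogonal
  to the other three. The eigenvalue 1 would give the trace \<open>2 + 2 * c\<close>, which is not
  negative.\<close>

lemma neg_formI:
  assumes r: "rotates g p q c s" and w: "unit w" "\<rho> g w = w" "w \<bullet> p = 0" "w \<bullet> q = 0" and neg: "tr (\<rho> g) < 0"
  shows "neg_form g w p q c s"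
proof -
  note u = w(1) rotates_unit[OF r]
  have g: "g \<in> carrier G" and cs: "c\<^sup>2 + s\<^sup>2 = 1" and pq: "p \<bullet> q = 0" and uu: "p \<bullet> p = 1" "q \<bullet> q = 1" "w \<bullet> w = 1"
    and U: "\<rho> \<one> w = w" "\<rho> \<one> p = p" "\<rho> \<one> q = q"
    and fp: "\<rho> g p = c *\<^sub>R p + s *\<^sub>R q" and fq: "\<rho> g q = (- s) *\<^sub>R p + c *\<^sub>R q"
    using r u by (simp_all add: rotates_def unit_def)
  have tr3: "\<rho> g w \<bullet> w + \<rho> g p \<bullet> p + \<rho> g q \<bullet> q = 1 + 2 * c"
  proof -
    have "q \<bullet> p = 0" using pq by (simp add: inner_commute)
    thus ?thesis using uu pq w by (simp add: fp fq inner_add_left inner_diff_left)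
  qed
  have "c\<^sup>2 \<le> 1" using cs zero_le_power2[of s] by linarith
  hence "\<bar>c\<bar> \<le> 1" by (simp only: abs_square_le_1)
  hence c1: "c \<ge> -1" by linarith
  show ?thesis
  proof (cases "\<exists>x. \<rho> \<one> x = x \<and> x \<bullet> w = 0 \<and> x \<bullet> p = 0 \<and> x \<bullet> q = 0 \<and> x \<noteq> 0")
    case False
    hence "tr (\<rho> g) = 1 + 2 * c"
      using onb_3[OF u w(3,4) pq g] tr3 by auto
    hence lt: "c < - 1 / 2" using neg by simp
    hence c0: "c < 0" by simp
    have perp: "\<forall>x. \<rho> \<one> x = x \<longrightarrow> x \<bullet> w = 0 \<longrightarrow> x \<bullet> p = 0 \<longrightarrow> x \<bullet> q = 0 \<longrightarrow> \<rho> g x = - x"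
    proof (intro allI impI)
      fix x assume "\<rho> \<one> x = x" "x \<bullet> w = 0" "x \<bullet> p = 0" "x \<bullet> q = 0"
      hence "x = 0" using False by blast
      thus "\<rho> g x = - x" by (simp add: blinfun.zero_right)
    qed
    show ?thesis unfolding neg_form_def by (intro conjI disjI1 r w c0 perp lt)
  next
    case True
    then obtain x where x: "\<rho> \<one> x = x" "x \<bullet> w = 0" "x \<bullet> p = 0" "x \<bullet> q = 0" "x \<noteq> 0" by blast
    define e where "e = x /\<^sub>R norm x"
    have e: "unit e" unfolding e_def by (rule unit_scale) fact+
    have e': "e \<bullet> w = 0" "e \<bullet> p = 0" "e \<bullet> q = 0" using x by (simp_all add: e_def)
    hence e'': "w \<bullet> e = 0" "p \<bullet> e = 0" "q \<bullet> e = 0" by (simp_all add: inner_commute)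
    have eU: "\<rho> \<one> e = e" "e \<bullet> e = 1" using e by (simp_all add: unit_def)
    note onb = onb_4[OF u e w(3,4) pq e'']
    have fe: "\<rho> g e \<bullet> w = 0" "\<rho> g e \<bullet> p = 0" "\<rho> g e \<bullet> q = 0"
      using inner_\<rho>[OF g eU(1), of w] w e' rotates_perp[OF r eU(1)] by simp_all
    define l where "l = \<rho> g e \<bullet> e"
    have le: "\<rho> g e = l *\<^sub>R e"
      using onb(3)[of "\<rho> g e"] g fe by (simp add: l_def)
    have "l * l = 1" using inner_\<rho>[OF g eU(1), of e] eU(2) by (simp add: le)
    hence l: "l = 1 \<or> l = -1" by (simp add: square_eq_1_iff)
    have "tr (\<rho> g) = 1 + 2 * c + l" using onb(2)[OF g] tr3 by (simp add: l_def)
    hence l1: "l = -1" and tr: "tr (\<rho> g) = 2 * c" using l neg c1 by auto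
    have perp: "\<forall>y. \<rho> \<one> y = y \<longrightarrow> y \<bullet> w = 0 \<longrightarrow> y \<bullet> p = 0 \<longrightarrow> y \<bullet> q = 0 \<longrightarrow> \<rho> g y = - y"
    proof (intro allI impI)
      fix y assume y: "\<rho> \<one> y = y" "y \<bullet> w = 0" "y \<bullet> p = 0" "y \<bullet> q = 0"
      have ye: "y = (y \<bullet> e) *\<^sub>R e" using onb(3)[OF y(1)] y by simp
      have "\<rho> g ((y \<bullet> e) *\<^sub>R e) = - ((y \<bullet> e) *\<^sub>R e)" using le l1 by (simp add: blinfun.scaleR_right)
      thus "\<rho> g y = - y" unfolding ye[symmetric] .
    qed
    have c0: "c < 0" using tr neg by simp
    have ex: "\<exists>e. unit e \<and> w \<bullet> e = 0 \<and> p \<bullet> e = 0 \<and> q \<bullet> e = 0 \<and> tr (\<rho> g) = 2 * c"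
      by (intro exI[of _ e] conjI e e'' tr)
    show ?thesis unfolding neg_form_def by (intro conjI disjI2 r w c0 perp ex)
  qed
qed

text \<open>After a fixed vector \<open>w\<close>, \<open>min_vector_cases\<close> is applied to its
  complement. A negated vector is split off and the step repeated; two negated vectors form a
  rotation with cosine -1. Where \<open>\<rho> g\<close> is the identity on the remaining space, the
  trace could not be negative.\<close>

lemma negative_trace_form:
  assumes g: "g \<in> carrier G" and neg: "tr (\<rho> g) < 0"
  shows "\<exists>w p q c s. neg_form g w p q c s"
proof -
  obtain w where "\<rho> \<one> w = w" "norm w = 1" and fw: "\<rho> g w = w" using has_fixed_vector[OF g] .
  hence w: "unit w" by (simp add: unit_def dot_square_norm)
  have wU: "\<rho> \<one> w = w" "w \<bullet> w = 1" using w by (simp_all add: unit_def)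
  have fiw: "\<rho> (inv g) w = w" using \<rho>_inv_eqI[OF g wU(1) fw] .
  have ig: "inv g \<in> carrier G" using g by simp
  have subsp: "subspace {x. \<rho> \<one> x = x \<and> x \<bullet> a = 0 \<and> x \<bullet> b = 0}" for a b
    by (auto simp: subspace_def blinfun.zero_right blinfun.add_right blinfun.scaleR_right inner_add_left)
  \<comment> \<open>The condition is doubled so that \<open>subsp\<close> applies with
    \<open>a = b = w\<close>.\<close>
  define S1 where "S1 = {x. \<rho> \<one> x = x \<and> x \<bullet> w = 0 \<and> x \<bullet> w = 0}"
  have S1: "subspace S1" unfolding S1_def by (rule subsp)
  have S1U: "\<rho> \<one> x = x" "w \<bullet> x = 0" "x \<bullet> w = 0" if "x \<in> S1" for x
    using that by (auto simp: S1_def inner_commute)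
  have S1g: "\<rho> h x \<in> S1" if "h \<in> {g, inv g}" "x \<in> S1" for h x
    using that g ig inner_\<rho>[of h x w] fw fiw by (auto simp: S1_def)
  show ?thesis
  proof (cases "S1 = {0}")
    case True
    hence "tr (\<rho> g) = \<rho> g w \<bullet> w" by (intro onb_1 w g) (auto simp: S1_def)
    thus ?thesis using neg fw wU by simp
  next
    case False
    show ?thesis
    proof (rule min_vector_cases[OF g S1 False])
      show "\<rho> \<one> x = x" if "x \<in> S1" for x using S1U that by blast
      show "\<rho> g x \<in> S1" "\<rho> (inv g) x \<in> S1" if "x \<in> S1" for x using S1g that by blast+
    next
      assume id: "\<And>x. x \<in> S1 \<Longrightarrow> \<rho> g x = x"
      have "\<rho> g = \<rho> \<one>"
      proof (rule \<rho>_eqI[OF g one_closed])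
        fix x assume x: "\<rho> \<one> x = x"
        let ?y = "x - (x \<bullet> w) *\<^sub>R w"
        have "?y \<in> S1" using x wU by (simp add: S1_def blinfun.diff_right blinfun.scaleR_right inner_diff_left)
        from id[OF this] show "\<rho> g x = \<rho> \<one> x" using fw x by (simp add: blinfun.diff_right blinfun.scaleR_right)
      qed
      thus ?thesis using neg tr_one by simp
    next
      fix p q c s assume "p \<in> S1" "q \<in> S1" "rotates g p q c s"
      thus ?thesis using neg_formI[OF _ w fw _ _ neg] S1U by blast
    next
      fix p assume p: "p \<in> S1" "p \<bullet> p = 1" "\<rho> g p = - p"
      have up: "unit p" using p S1U by (simp add: unit_def)
      have pU: "\<rho> \<one> p = p" using p S1U by blast
      have fip: "\<rho> (inv g) p = - p" using \<rho>_inv_eqI[OF g, of "- p" p] pU p(3) by (simp add: blinfun.minus_right)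
      define S2 where "S2 = {x. \<rho> \<one> x = x \<and> x \<bullet> w = 0 \<and> x \<bullet> p = 0}"
      have S2: "subspace S2" unfolding S2_def by (rule subsp)
      have S2U: "\<rho> \<one> x = x" "w \<bullet> x = 0" "x \<bullet> w = 0" "p \<bullet> x = 0" "x \<bullet> p = 0" if "x \<in> S2" for x
        using that by (auto simp: S2_def inner_commute)
      have S2g: "\<rho> h x \<in> S2" if "h \<in> {g, inv g}" "x \<in> S2" for h x
        using that g ig inner_\<rho>[of h x w] inner_\<rho>[of h x p] fw fiw fip p(3) by (auto simp: S2_def)
      show ?thesis
      proof (cases "S2 = {0}")
        case True
        hence "tr (\<rho> g) = \<rho> g w \<bullet> w + \<rho> g p \<bullet> p"
          using S1U[OF p(1)] by (intro onb_2 w up g) (auto simp: S2_def)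
        thus ?thesis using neg fw wU p by simp
      next
        case S2_ne: False
        show ?thesis
        proof (rule min_vector_cases[OF g S2 S2_ne])
          show "\<rho> \<one> x = x" if "x \<in> S2" for x using S2U that by blast
          show "\<rho> g x \<in> S2" "\<rho> (inv g) x \<in> S2" if "x \<in> S2" for x using S2g that by blast+
        next
          fix p2 q c s assume "p2 \<in> S2" "q \<in> S2" "rotates g p2 q c s"
          thus ?thesis using neg_formI[OF _ w fw _ _ neg] S2U by blast
        next
          fix q assume q: "q \<in> S2" "q \<bullet> q = 1" "\<rho> g q = - q"
          have "rotates g p q (-1) 0" using g p q S2U pU by (simp add: rotates_def)
          thus ?thesis using neg_formI[OF _ w fw _ _ neg] S1U(2)[OF p(1)] S2U(2)[OF q(1)] by blast
        next
          assume id: "\<And>x. x \<in> S2 \<Longrightarrow> \<rho> g x = x"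
          obtain x where x: "x \<in> S2" "x \<noteq> 0" using S2_ne subspace_0[OF S2] by blast
          define q where "q = x /\<^sub>R norm x"
          have q: "q \<in> S2" "unit q" using x S2 S2U by (auto simp: q_def subspace_scale intro!: unit_scale)
          have qU: "q \<bullet> q = 1" using q by (simp add: unit_def)
          show ?thesis
          proof (cases "\<exists>y\<in>S2. y \<bullet> q = 0 \<and> y \<noteq> 0")
            case True
            then obtain y where y: "y \<in> S2" "y \<bullet> q = 0" "y \<noteq> 0" by blast
            define e where "e = y /\<^sub>R norm y"
            have e: "e \<in> S2" "unit e" using y S2 S2U by (auto simp: e_def subspace_scale intro!: unit_scale)
            \<comment> \<open>The identity on a plane, read as a rotation with cosine 1;
              \<open>neg_formI\<close> then claims this cosine to be negative.\<close>
            have "rotates g q e 1 0"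
              using g q e id S2U y(2) by (auto simp: rotates_def unit_def e_def inner_commute)
            hence "neg_form g w q e 1 0" using neg_formI[OF _ w fw _ _ neg] S2U q e by blast
            thus ?thesis by (simp add: neg_form_def)
          next
            case False
            have "tr (\<rho> g) = \<rho> g w \<bullet> w + \<rho> g p \<bullet> p + \<rho> g q \<bullet> q"
              using S1U[OF p(1)] S2U[OF q(1)] False by (intro onb_3 w up q g) (auto simp: S2_def)
            thus ?thesis using neg fw wU p q qU id by simp
          qed
        qed
      qed
    qed
  qed
qed

end

context crystal_action
begin

section \<open>The crystallographic restriction on the cosine\<close>

lemma rotates_apply:
  assumes "rotates h p q c s"
  shows "\<rho> h (a *\<^sub>R p + b *\<^sub>R q) = (a * c - b * s) *\<^sub>R p + (a * s + b * c) *\<^sub>R q"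
proof -
  have pq: "\<rho> h p = c *\<^sub>R p + s *\<^sub>R q" "\<rho> h q = (- s) *\<^sub>R p + c *\<^sub>R q"
    using assms unfolding rotates_def by blast+
  have "\<rho> h (a *\<^sub>R p + b *\<^sub>R q) = a *\<^sub>R (c *\<^sub>R p + s *\<^sub>R q) + b *\<^sub>R ((- s) *\<^sub>R p + c *\<^sub>R q)"
    by (simp only: blinfun.add_right blinfun.scaleR_right pq)
  also have "\<dots> = (a * c - b * s) *\<^sub>R p + (a * s + b * c) *\<^sub>R q" by (simp add: algebra_simps)
  finally show ?thesis .
qed

lemma rotates_norm:
  assumes "rotates h p q c s"
  shows "(norm (a *\<^sub>R p + b *\<^sub>R q))\<^sup>2 = a\<^sup>2 + b\<^sup>2"
  using assms unfolding power2_norm_eq_inner rotates_def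
  by (simp add: inner_add_left inner_add_right inner_commute[of q p] power2_eq_square)

lemma rotates_square:
  assumes "rotates g p q c s" shows "rotates (g \<otimes> g) p q (c\<^sup>2 - s\<^sup>2) (2 * c * s)"
proof -
  have g: "g \<in> carrier G" and cs: "c\<^sup>2 + s\<^sup>2 = 1" using assms by (simp_all add: rotates_def)
  have pq: "\<rho> g p = c *\<^sub>R p + s *\<^sub>R q" "\<rho> g q = (- s) *\<^sub>R p + c *\<^sub>R q"
    using assms unfolding rotates_def by blast+
  have "\<rho> (g \<otimes> g) p = \<rho> g (c *\<^sub>R p + s *\<^sub>R q)" using g pq by simp
  also have "\<dots> = (c * c - s * s) *\<^sub>R p + (c * s + s * c) *\<^sub>R q" by (rule rotates_apply[OF assms])
  also have "c * c - s * s = c\<^sup>2 - s\<^sup>2" by (simp add: power2_eq_square)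
  also have "c * s + s * c = 2 * c * s" by simp
  finally have "\<rho> (g \<otimes> g) p = (c\<^sup>2 - s\<^sup>2) *\<^sub>R p + (2 * c * s) *\<^sub>R q" .
  moreover have "\<rho> (g \<otimes> g) q = (- (2 * c * s)) *\<^sub>R p + (c\<^sup>2 - s\<^sup>2) *\<^sub>R q"
  proof -
    have "\<rho> (g \<otimes> g) q = \<rho> g ((- s) *\<^sub>R p + c *\<^sub>R q)" using g pq(2) by (metis \<rho>_mult_apply)
    also have "\<dots> = (- s * c - c * s) *\<^sub>R p + (- s * s + c * c) *\<^sub>R q" by (rule rotates_apply[OF assms])
    also have "- s * c - c * s = - (2 * c * s)" by simp
    also have "- s * s + c * c = c\<^sup>2 - s\<^sup>2" by (simp add: power2_eq_square)
    finally show ?thesis .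
  qed
  moreover have "(c\<^sup>2 - s\<^sup>2)\<^sup>2 + (2 * c * s)\<^sup>2 = (c\<^sup>2 + s\<^sup>2)\<^sup>2" by (simp add: power2_eq_square algebra_simps)
  ultimately show ?thesis using assms g cs unfolding rotates_def by simp
qed

text \<open>The map \<open>x \<mapsto> x + \<rho> h x\<close> preserves the discrete set \<open>L\<close> and scales the plane by \<open>2 + 2 c\<close>.\<close>

lemma no_lattice_vector_in_plane:
  assumes r: "rotates h p q c s" and c: "- 1 < c" "c < - 1 / 2" and z: "z \<in> L" "z = a *\<^sub>R p + b *\<^sub>R q"
  shows "z = 0"
proof (rule ccontr)
  assume nz: "z \<noteq> 0"
  have h: "h \<in> carrier G" and cs: "c\<^sup>2 + s\<^sup>2 = 1" using r by (simp_all add: rotates_def)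
  let ?M = "\<lambda>x. x + \<rho> h x" and ?k = "2 + 2 * c"
  have step: "\<exists>a' b'. ?M (a *\<^sub>R p + b *\<^sub>R q) = a' *\<^sub>R p + b' *\<^sub>R q \<and> a'\<^sup>2 + b'\<^sup>2 = ?k * (a\<^sup>2 + b\<^sup>2)" for a b
  proof (intro exI conjI)
    show "?M (a *\<^sub>R p + b *\<^sub>R q) = (a + (a * c - b * s)) *\<^sub>R p + (b + (a * s + b * c)) *\<^sub>R q"
      unfolding rotates_apply[OF r] by (simp add: algebra_simps)
    have "(a + (a * c - b * s))\<^sup>2 + (b + (a * s + b * c))\<^sup>2 = (a\<^sup>2 + b\<^sup>2) * (1 + 2 * c + (c\<^sup>2 + s\<^sup>2))"
      by (simp add: power2_eq_square algebra_simps)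
    thus "(a + (a * c - b * s))\<^sup>2 + (b + (a * s + b * c))\<^sup>2 = ?k * (a\<^sup>2 + b\<^sup>2)" using cs by simp
  qed
  have iter: "(?M ^^ n) z \<in> L \<and> (\<exists>a b. (?M ^^ n) z = a *\<^sub>R p + b *\<^sub>R q \<and> a\<^sup>2 + b\<^sup>2 = ?k ^ n * (norm z)\<^sup>2)" for n
  proof (induction n)
    case 0
    have "a\<^sup>2 + b\<^sup>2 = ?k ^ 0 * (norm z)\<^sup>2" unfolding z(2) rotates_norm[OF r] by simp
    moreover have "(?M ^^ 0) z = a *\<^sub>R p + b *\<^sub>R q" using z(2) by simp
    moreover have "(?M ^^ 0) z \<in> L" using z(1) by simp
    ultimately show ?case by blast
  next
    case (Suc n)
    then obtain a b where ab: "(?M ^^ n) z = a *\<^sub>R p + b *\<^sub>R q" "a\<^sup>2 + b\<^sup>2 = ?k ^ n * (norm z)\<^sup>2" by blast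
    obtain a' b' where ab': "?M ((?M ^^ n) z) = a' *\<^sub>R p + b' *\<^sub>R q" "a'\<^sup>2 + b'\<^sup>2 = ?k * (a\<^sup>2 + b\<^sup>2)"
      using step[of a b] unfolding ab(1) by blast
    have eq: "(?M ^^ Suc n) z = ?M ((?M ^^ n) z)" by simp
    have "?M ((?M ^^ n) z) \<in> L" using Suc L_add L_action[OF h] by blast
    moreover have "a'\<^sup>2 + b'\<^sup>2 = ?k ^ Suc n * (norm z)\<^sup>2" unfolding ab'(2) ab(2) by simp
    ultimately show ?case unfolding eq using ab'(1) by blast
  qed
  obtain \<epsilon> where e: "\<epsilon> > 0" "\<And>u. u \<in> L \<Longrightarrow> norm u < \<epsilon> \<Longrightarrow> u = 0"
    using discrete unfolding L_def by auto
  have k: "0 < ?k" "?k < 1" using c by auto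
  obtain n where "?k ^ n < \<epsilon>\<^sup>2 / (norm z)\<^sup>2"
    using real_arch_pow_inv[of "\<epsilon>\<^sup>2 / (norm z)\<^sup>2" ?k] k e(1) nz by auto
  hence n: "?k ^ n * (norm z)\<^sup>2 < \<epsilon>\<^sup>2" using nz by (simp add: field_simps)
  obtain a b where ab: "(?M ^^ n) z = a *\<^sub>R p + b *\<^sub>R q" "a\<^sup>2 + b\<^sup>2 = ?k ^ n * (norm z)\<^sup>2" using iter by blast
  have norm: "(norm ((?M ^^ n) z))\<^sup>2 = ?k ^ n * (norm z)\<^sup>2" unfolding ab(1) rotates_norm[OF r] ab(2) ..
  hence "norm ((?M ^^ n) z) < \<epsilon>" using n e(1) by (intro power2_less_imp_less[of _ \<epsilon>]) auto
  hence "(?M ^^ n) z = 0" using e(2) iter by blast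
  thus False using norm k nz by simp
qed

text \<open>The difference of \<open>\<rho> (g \<otimes> g)\<close> and the identity kills the fixed
  axis and the negated complement, so it sends \<open>L\<close> into the plane. It does not kill all
  of \<open>L\<close>, because \<open>L\<close> spans and the sine \<open>2 * c * s\<close> of the
  double angle is not zero.\<close>

lemma lattice_vector_in_plane:
  assumes nf: "neg_form g w p q c s" and c: "- 1 < c"
  shows "\<exists>z a b. z \<in> L \<and> z \<noteq> 0 \<and> z = a *\<^sub>R p + b *\<^sub>R q"
proof -
  have r: "rotates g p q c s" and w: "unit w" "\<rho> g w = w" "w \<bullet> p = 0" "w \<bullet> q = 0" and c0: "c < 0"
    and perp: "\<And>x. \<rho> \<one> x = x \<Longrightarrow> x \<bullet> w = 0 \<Longrightarrow> x \<bullet> p = 0 \<Longrightarrow> x \<bullet> q = 0 \<Longrightarrow> \<rho> g x = - x"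
    using nf by (simp_all add: neg_form_def)
  have g: "g \<in> carrier G" and cs: "c\<^sup>2 + s\<^sup>2 = 1" and pq: "p \<bullet> q = 0" "q \<bullet> p = 0" "p \<bullet> p = 1" "q \<bullet> q = 1"
    and U: "\<rho> \<one> p = p" "\<rho> \<one> q = q"
    using r by (simp_all add: rotates_def inner_commute)
  have wU: "\<rho> \<one> w = w" "w \<bullet> w = 1" using w(1) by (simp_all add: unit_def)
  define C where "C = c\<^sup>2 - s\<^sup>2"
  define S where "S = 2 * c * s"
  have r2: "rotates (g \<otimes> g) p q C S" unfolding C_def S_def by (rule rotates_square[OF r])
  have "\<bar>c\<bar> < 1" using c c0 by simp
  hence "c\<^sup>2 < 1" by (simp add: abs_square_less_1)
  hence "s \<noteq> 0" using cs by auto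
  hence S: "S \<noteq> 0" using c0 by (simp add: S_def)
  have "\<exists>a\<in>L. \<rho> (g \<otimes> g) a \<noteq> \<rho> \<one> a"
  proof (rule ccontr)
    assume *: "\<not> ?thesis"
    have "subspace {x. \<rho> (g \<otimes> g) x = \<rho> \<one> x}"
      by (auto simp: subspace_def blinfun.zero_right blinfun.add_right blinfun.scaleR_right)
    moreover have "L \<subseteq> {x. \<rho> (g \<otimes> g) x = \<rho> \<one> x}" using * by blast
    ultimately have "span L \<subseteq> {x. \<rho> (g \<otimes> g) x = \<rho> \<one> x}" by (intro span_minimal)
    hence "\<rho> (g \<otimes> g) p = \<rho> \<one> p" using spanning[of p] U unfolding L_def by auto
    hence "(C *\<^sub>R p + S *\<^sub>R q) \<bullet> q = p \<bullet> q" using r2 U by (simp add: rotates_def)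
    thus False using S pq by (simp add: inner_add_left)
  qed
  then obtain a where a: "a \<in> L" "\<rho> (g \<otimes> g) a \<noteq> \<rho> \<one> a" by blast
  have aU: "\<rho> \<one> a = a" using a(1) by (rule L_fixed)
  define z where "z = \<rho> (g \<otimes> g) a - a"
  have "z = \<rho> (g \<otimes> g) a + - a" by (simp add: z_def)
  also have "\<dots> \<in> L" using L_add[OF L_action[OF _ a(1)] L_uminus[OF a(1)], of "g \<otimes> g"] g by simp
  finally have zL: "z \<in> L" .
  have nz: "z \<noteq> 0" using a(2) aU by (simp add: z_def)
  define A where "A = a \<bullet> p"
  define B where "B = a \<bullet> q"
  define x where "x = a - (a \<bullet> w) *\<^sub>R w - A *\<^sub>R p - B *\<^sub>R q"
  have pw: "p \<bullet> w = 0" "q \<bullet> w = 0" using w by (simp_all add: inner_commute)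
  have "\<rho> g x = - x"
  proof (rule perp)
    show "\<rho> \<one> x = x" using aU U wU by (simp add: x_def blinfun.diff_right blinfun.scaleR_right)
  qed (use wU w(3,4) pw pq in \<open>simp_all add: x_def A_def B_def inner_diff_left\<close>)
  hence x2: "\<rho> (g \<otimes> g) x = x" using g by (simp add: blinfun.minus_right)
  have w2: "\<rho> (g \<otimes> g) w = w" using g w by simp
  have dec: "a = x + (a \<bullet> w) *\<^sub>R w + (A *\<^sub>R p + B *\<^sub>R q)" by (simp add: x_def)
  have "\<rho> (g \<otimes> g) (x + (a \<bullet> w) *\<^sub>R w + (A *\<^sub>R p + B *\<^sub>R q))
      = x + (a \<bullet> w) *\<^sub>R w + ((A * C - B * S) *\<^sub>R p + (A * S + B * C) *\<^sub>R q)"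
    unfolding blinfun.add_right[of _ "x + (a \<bullet> w) *\<^sub>R w"] blinfun.add_right[of _ x] rotates_apply[OF r2]
      blinfun.scaleR_right x2 w2 ..
  hence "\<rho> (g \<otimes> g) a = x + (a \<bullet> w) *\<^sub>R w + ((A * C - B * S) *\<^sub>R p + (A * S + B * C) *\<^sub>R q)"
    unfolding dec[symmetric] .
  hence "z = (A * C - B * S - A) *\<^sub>R p + (A * S + B * C - B) *\<^sub>R q"
    by (simp add: z_def x_def algebra_simps)
  thus ?thesis using zL nz by blast
qed

text \<open>For \<open>- 1 < c < - 1 / 2\<close> the contraction of
  \<open>no_lattice_vector_in_plane\<close> applies to \<open>g\<close>. For
  \<open>- 1 / 2 < c < 0\<close> the cosine \<open>c\<^sup>2 - s\<^sup>2\<close> of the double angle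
  falls into that same interval, and it applies to \<open>g \<otimes> g\<close>.\<close>

lemma neg_form_cosine:
  assumes nf: "neg_form g w p q c s" shows "c = -1 \<or> c = - 1 / 2"
proof -
  have r: "rotates g p q c s" and c0: "c < 0" using nf by (simp_all add: neg_form_def)
  have cs: "c\<^sup>2 + s\<^sup>2 = 1" using r by (simp add: rotates_def)
  have "c\<^sup>2 \<le> 1" using cs zero_le_power2[of s] by linarith
  hence "\<bar>c\<bar> \<le> 1" by (simp only: abs_square_le_1)
  hence c1: "c \<ge> -1" by linarith
  have False if c: "-1 < c" "c \<noteq> - 1 / 2"
  proof -
    obtain z a b where z: "z \<in> L" "z \<noteq> 0" "z = a *\<^sub>R p + b *\<^sub>R q" using lattice_vector_in_plane[OF nf c(1)] by blast
    show False
    proof (cases "c < - 1 / 2")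
      case True
      thus False using no_lattice_vector_in_plane[OF r c(1) True z(1,3)] z(2) by simp
    next
      case False
      hence "\<bar>c\<bar> < 1 / 2" using c c0 by simp
      hence "\<bar>c\<bar>\<^sup>2 < (1 / 2)\<^sup>2" by (intro power_strict_mono) auto
      hence "c\<^sup>2 < (1 / 2)\<^sup>2" by simp
      hence "c\<^sup>2 - s\<^sup>2 < - 1 / 2" using cs by (simp add: power2_eq_square)
      moreover have "c\<^sup>2 > 0" using c0 by simp
      hence "- 1 < c\<^sup>2 - s\<^sup>2" using cs by linarith
      ultimately show False using no_lattice_vector_in_plane[OF rotates_square[OF r] _ _ z(1,3)] z(2) by simp
    qed
  qed
  moreover have "- 1 < c \<or> c = - 1" using c1 by auto
  ultimately show ?thesis by blast
qed

lemma neg_form_half_turn: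
  assumes nf: "neg_form g w p q (-1) s" shows "half_turn g w"
proof -
  have r: "rotates g p q (-1) s" and w: "unit w" "\<rho> g w = w" "w \<bullet> p = 0" "w \<bullet> q = 0"
    and perp: "\<And>x. \<rho> \<one> x = x \<Longrightarrow> x \<bullet> w = 0 \<Longrightarrow> x \<bullet> p = 0 \<Longrightarrow> x \<bullet> q = 0 \<Longrightarrow> \<rho> g x = - x"
    using nf by (simp_all add: neg_form_def)
  have g: "g \<in> carrier G" and s: "s = 0" and pq: "p \<bullet> q = 0" "q \<bullet> p = 0" "p \<bullet> p = 1" "q \<bullet> q = 1"
    and U: "\<rho> \<one> p = p" "\<rho> \<one> q = q"
    using r by (simp_all add: rotates_def inner_commute)
  have fp: "\<rho> g p = - p" "\<rho> g q = - q" using r s by (simp_all add: rotates_def)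
  have wU: "\<rho> \<one> w = w" "w \<bullet> w = 1" using w(1) by (simp_all add: unit_def)
  have pw: "p \<bullet> w = 0" "q \<bullet> w = 0" using w by (simp_all add: inner_commute)
  show ?thesis
    unfolding half_turn_def
  proof (intro conjI allI impI g wU)
    show "norm w = 1" using wU by (simp add: norm_eq_sqrt_inner)
    fix x assume x: "\<rho> \<one> x = x"
    define y where "y = x - (x \<bullet> w) *\<^sub>R w - (x \<bullet> p) *\<^sub>R p - (x \<bullet> q) *\<^sub>R q"
    have "\<rho> g y = - y"
    proof (rule perp)
      show "\<rho> \<one> y = y" using x U wU by (simp add: y_def blinfun.diff_right blinfun.scaleR_right)
    qed (use wU w(3,4) pw pq in \<open>simp_all add: y_def inner_diff_left\<close>)
    hence "\<rho> g x - (x \<bullet> w) *\<^sub>R w + (x \<bullet> p) *\<^sub>R p + (x \<bullet> q) *\<^sub>R q = - y"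
      using w fp by (simp add: y_def blinfun.diff_right blinfun.scaleR_right)
    hence "\<rho> g x + x = (x \<bullet> w) *\<^sub>R w + (x \<bullet> w) *\<^sub>R w" by (simp add: y_def algebra_simps)
    thus "\<rho> g x = (2 * (x \<bullet> w)) *\<^sub>R w - x" by (simp only: eq_diff_eq mult_2 scaleR_add_left)
  qed
qed

text \<open>The linear part has order six: a third of a turn on the plane of \<open>p\<close> and
  \<open>q\<close>, and a reflection on the plane of \<open>w\<close> and \<open>e\<close>.\<close>

definition sextic where
  "sextic g w e p q s \<longleftrightarrow> rotates g p q (- 1 / 2) s \<and> unit w \<and> unit e \<and> \<rho> g w = w \<and> \<rho> g e = - e \<and>
     w \<bullet> p = 0 \<and> w \<bullet> q = 0 \<and> w \<bullet> e = 0 \<and> p \<bullet> e = 0 \<and> q \<bullet> e = 0"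

lemma sextic_facts:
  assumes "sextic g w e p q s"
  shows "g \<in> carrier G" "unit w" "unit e" "w \<bullet> e = 0" "\<rho> g w = w" "\<rho> g e = - e"
    and "\<rho> \<one> x = x \<Longrightarrow> x = ((x \<bullet> w) *\<^sub>R w + (x \<bullet> e) *\<^sub>R e) + ((x \<bullet> p) *\<^sub>R p + (x \<bullet> q) *\<^sub>R q)"
    and "tr (\<rho> g) = - 1" "tr (\<rho> (g \<otimes> g)) = 1" "\<rho> (g \<otimes> g) p \<noteq> p" "p \<bullet> w = 0" "p \<bullet> e = 0" "q \<bullet> w = 0" "q \<bullet> e = 0"
    and "\<rho> \<one> p = p" "\<rho> \<one> q = q"
    and "\<rho> g (\<rho> g (\<rho> g (a *\<^sub>R p + b *\<^sub>R q))) = a *\<^sub>R p + b *\<^sub>R q"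
    and "\<rho> \<one> x = x \<Longrightarrow> \<rho> g (\<rho> g x) = x \<Longrightarrow> x = (x \<bullet> w) *\<^sub>R w + (x \<bullet> e) *\<^sub>R e"
proof -
  have r: "rotates g p q (- 1 / 2) s" and w: "unit w" "unit e" "\<rho> g w = w" "\<rho> g e = - e"
    and orth: "w \<bullet> p = 0" "w \<bullet> q = 0" "w \<bullet> e = 0" "p \<bullet> e = 0" "q \<bullet> e = 0"
    using assms by (simp_all add: sextic_def)
  have g: "g \<in> carrier G" and s: "s * s = 3 / 4" and pq: "p \<bullet> q = 0" "q \<bullet> p = 0" "p \<bullet> p = 1" "q \<bullet> q = 1"
    and U: "\<rho> \<one> p = p" "\<rho> \<one> q = q"
    using r by (simp_all add: rotates_def inner_commute power2_eq_square)
  have we: "w \<bullet> w = 1" "e \<bullet> e = 1" using w by (simp_all add: unit_def)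
  have r2: "rotates (g \<otimes> g) p q (- 1 / 2) (- s)"
    using rotates_square[OF r] s by (simp add: power2_eq_square)
  note onb = onb_4[OF w(1) rotates_unit[OF r] w(2) orth(1,2) pq(1) orth(3,4,5)]
  show "g \<in> carrier G" "unit w" "unit e" "w \<bullet> e = 0" "\<rho> g w = w" "\<rho> g e = - e" by fact+
  show flip: "p \<bullet> w = 0" "p \<bullet> e = 0" "q \<bullet> w = 0" "q \<bullet> e = 0" using orth by (simp_all add: inner_commute)
  show "\<rho> \<one> p = p" "\<rho> \<one> q = q" by fact+
  show dec: "x = ((x \<bullet> w) *\<^sub>R w + (x \<bullet> e) *\<^sub>R e) + ((x \<bullet> p) *\<^sub>R p + (x \<bullet> q) *\<^sub>R q)" if "\<rho> \<one> x = x" for x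
    using onb(3)[OF that] by (simp add: algebra_simps)
  have p2: "\<rho> (g \<otimes> g) p = (- 1 / 2) *\<^sub>R p + (- s) *\<^sub>R q" and q2: "\<rho> (g \<otimes> g) q = (- (- s)) *\<^sub>R p + (- 1 / 2) *\<^sub>R q"
    using r2 unfolding rotates_def by blast+
  have p1: "\<rho> g p = (- 1 / 2) *\<^sub>R p + s *\<^sub>R q" and q1: "\<rho> g q = (- s) *\<^sub>R p + (- 1 / 2) *\<^sub>R q"
    using r unfolding rotates_def by blast+
  have e2: "\<rho> (g \<otimes> g) e = e" "\<rho> (g \<otimes> g) w = w" using g w by (simp_all add: blinfun.minus_right)
  show "tr (\<rho> g) = - 1"
    unfolding onb(2)[OF g] using w we pq by (simp add: p1 q1 inner_add_left inner_diff_left)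
  have "tr (\<rho> (g \<otimes> g)) = \<rho> (g \<otimes> g) w \<bullet> w + \<rho> (g \<otimes> g) p \<bullet> p + \<rho> (g \<otimes> g) q \<bullet> q + \<rho> (g \<otimes> g) e \<bullet> e"
    using g by (intro onb(2)) simp
  thus "tr (\<rho> (g \<otimes> g)) = 1"
    unfolding p2 q2 e2 using we pq by (simp add: inner_add_left inner_diff_left)
  show "\<rho> (g \<otimes> g) p \<noteq> p"
  proof
    assume "\<rho> (g \<otimes> g) p = p"
    hence "((- 1 / 2) *\<^sub>R p + (- s) *\<^sub>R q) \<bullet> p = p \<bullet> p" unfolding p2 by (simp only:)
    thus False using pq by (simp add: inner_add_left inner_diff_left)
  qed
  show "\<rho> g (\<rho> g (\<rho> g (a *\<^sub>R p + b *\<^sub>R q))) = a *\<^sub>R p + b *\<^sub>R q" for a b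
  proof -
    have "\<rho> g (\<rho> (g \<otimes> g) (a *\<^sub>R p + b *\<^sub>R q)) = a *\<^sub>R p + b *\<^sub>R q"
      unfolding rotates_apply[OF r2] rotates_apply[OF r]
    proof (rule arg_cong2[where f = "\<lambda>u v. u *\<^sub>R p + v *\<^sub>R q"])
      have "(a * (- 1 / 2) - b * - s) * (- 1 / 2) - (a * - s + b * (- 1 / 2)) * s = a / 4 + a * (s * s)"
        by (simp add: field_simps)
      thus "(a * (- 1 / 2) - b * - s) * (- 1 / 2) - (a * - s + b * (- 1 / 2)) * s = a"
        unfolding s by simp
      have "(a * (- 1 / 2) - b * - s) * s + (a * - s + b * (- 1 / 2)) * (- 1 / 2) = b / 4 + b * (s * s)"
        by (simp add: field_simps)
      thus "(a * (- 1 / 2) - b * - s) * s + (a * - s + b * (- 1 / 2)) * (- 1 / 2) = b"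
        unfolding s by simp
    qed
    thus ?thesis using g by simp
  qed
  show "x = (x \<bullet> w) *\<^sub>R w + (x \<bullet> e) *\<^sub>R e" if x: "\<rho> \<one> x = x" "\<rho> g (\<rho> g x) = x"
  proof -
    have gg: "g \<otimes> g \<in> carrier G" using g by simp
    have fx: "\<rho> (g \<otimes> g) x = x" using x g by simp
    have 1: "x \<bullet> p = x \<bullet> ((- 1 / 2) *\<^sub>R p + (- s) *\<^sub>R q)"
      using inner_\<rho>[OF gg x(1), of p] unfolding fx p2 by simp
    have 2: "x \<bullet> q = x \<bullet> ((- (- s)) *\<^sub>R p + (- 1 / 2) *\<^sub>R q)"
      using inner_\<rho>[OF gg x(1), of q] unfolding fx q2 by simp
    have 3: "3 / 2 * (x \<bullet> p) = - s * (x \<bullet> q)" using 1 by (simp add: inner_add_right inner_diff_right)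
    have 4: "3 / 2 * (x \<bullet> q) = s * (x \<bullet> p)" using 2 by (simp add: inner_add_right inner_diff_right)
    have "9 / 4 * (x \<bullet> q) = s * (3 / 2 * (x \<bullet> p))" using 4 by simp
    also have "\<dots> = - (s * s) * (x \<bullet> q)" unfolding 3 by simp
    finally have q0: "x \<bullet> q = 0" unfolding s by simp
    hence "x \<bullet> p = 0" using 3 by simp
    thus ?thesis using dec[OF x(1)] q0 by simp
  qed
qed


text \<open>On the rotated plane the linear part has order three and is the square of its square. On
  the plane of \<open>w\<close> and \<open>e\<close> both maps are reflections. Torsion-freeness
  gives \<open>g \<otimes> g'\<close> a fixed vector \<open>v\<close>; it turns out to lie in this
  second plane, where \<open>\<rho> g v = \<rho> g' v\<close>. Two reflections of a plane that agree
  at a nonzero vector coincide.\<close>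

lemma sextic_inj:
  assumes G1: "sextic g w e p q s" and G2: "sextic g' w' e' p' q' s'" and sq: "\<rho> (g \<otimes> g) = \<rho> (g' \<otimes> g')"
  shows "\<rho> g = \<rho> g'"
proof -
  note f1 = sextic_facts[OF G1] and f2 = sextic_facts[OF G2]
  note g = f1(1) and g' = f2(1)
  have U: "\<rho> \<one> w = w" "\<rho> \<one> e = e" "\<rho> \<one> w' = w'" "\<rho> \<one> e' = e'"
    and unit: "w \<bullet> w = 1" "e \<bullet> e = 1" "w' \<bullet> w' = 1" "e' \<bullet> e' = 1"
    using f1(2,3) f2(2,3) by (simp_all add: unit_def)
  have sq': "\<rho> g (\<rho> g x) = \<rho> g' (\<rho> g' x)" for x using arg_cong[OF sq, of "\<lambda>f. blinfun_apply f x"] g g' by simp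
  have fixed: "\<rho> g (\<rho> g w') = w'" "\<rho> g (\<rho> g e') = e'"
    unfolding sq' by (simp_all add: f2(5,6) blinfun.minus_right)
  have fixed_w: "\<rho> g (\<rho> g w) = w" "\<rho> g (\<rho> g e) = e"
    by (simp_all add: f1(5,6) blinfun.minus_right)
  have plane: "\<rho> g b = \<rho> g' b" "b \<bullet> w = 0" "b \<bullet> e = 0" if b: "b = \<alpha> *\<^sub>R p + \<beta> *\<^sub>R q" for b \<alpha> \<beta>
  proof -
    have bU: "\<rho> \<one> b = b" by (simp add: b blinfun.add_right blinfun.scaleR_right f1(15,16))
    show bw: "b \<bullet> w = 0" and be: "b \<bullet> e = 0" using f1(11-14) by (simp_all add: b inner_add_left)
    have "b \<bullet> w' = b \<bullet> ((w' \<bullet> w) *\<^sub>R w + (w' \<bullet> e) *\<^sub>R e)"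
      "b \<bullet> e' = b \<bullet> ((e' \<bullet> w) *\<^sub>R w + (e' \<bullet> e) *\<^sub>R e)"
      by (rule arg_cong[OF f1(18)[OF U(3) fixed(1)]], rule arg_cong[OF f1(18)[OF U(4) fixed(2)]])
    hence "b \<bullet> w' = 0" "b \<bullet> e' = 0" using bw be by (simp_all add: inner_add_right)
    hence b': "b = (b \<bullet> p') *\<^sub>R p' + (b \<bullet> q') *\<^sub>R q'" using f2(7)[OF bU] by simp
    have 1: "\<rho> g (\<rho> g (\<rho> g b)) = b" unfolding b by (rule f1(17))
    have 2: "\<rho> g' (\<rho> g' (\<rho> g' b)) = b" using f2(17)[of "b \<bullet> p'" "b \<bullet> q'"] unfolding b'[symmetric] .
    have "\<rho> g b = \<rho> g (\<rho> g (\<rho> g (\<rho> g b)))" using 1 by simp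
    also have "\<dots> = \<rho> g' (\<rho> g' (\<rho> g' (\<rho> g' b)))" by (simp only: sq')
    also have "\<dots> = \<rho> g' b" using 2 by simp
    finally show "\<rho> g b = \<rho> g' b" .
  qed
  have formula: "\<rho> g a = (a \<bullet> w) *\<^sub>R w - (a \<bullet> e) *\<^sub>R e" "\<rho> g' a = (a \<bullet> w') *\<^sub>R w' - (a \<bullet> e') *\<^sub>R e'"
    "a = (a \<bullet> w) *\<^sub>R w + (a \<bullet> e) *\<^sub>R e" "a = (a \<bullet> w') *\<^sub>R w' + (a \<bullet> e') *\<^sub>R e'"
    if a: "\<rho> \<one> a = a" "\<rho> g (\<rho> g a) = a" for a
  proof -
    show 1: "a = (a \<bullet> w) *\<^sub>R w + (a \<bullet> e) *\<^sub>R e" by (rule f1(18)[OF a])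
    have "\<rho> g' (\<rho> g' a) = a" using a(2) by (simp add: sq')
    thus 2: "a = (a \<bullet> w') *\<^sub>R w' + (a \<bullet> e') *\<^sub>R e'" by (rule f2(18)[OF a(1)])
    have "\<rho> g ((a \<bullet> w) *\<^sub>R w + (a \<bullet> e) *\<^sub>R e) = (a \<bullet> w) *\<^sub>R w - (a \<bullet> e) *\<^sub>R e"
      by (simp add: blinfun.add_right blinfun.scaleR_right f1(5,6))
    thus "\<rho> g a = (a \<bullet> w) *\<^sub>R w - (a \<bullet> e) *\<^sub>R e" unfolding 1[symmetric] .
    have "\<rho> g' ((a \<bullet> w') *\<^sub>R w' + (a \<bullet> e') *\<^sub>R e') = (a \<bullet> w') *\<^sub>R w' - (a \<bullet> e') *\<^sub>R e'"
      by (simp add: blinfun.add_right blinfun.scaleR_right f2(5,6))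
    thus "\<rho> g' a = (a \<bullet> w') *\<^sub>R w' - (a \<bullet> e') *\<^sub>R e'" unfolding 2[symmetric] .
  qed
  obtain v where v: "\<rho> \<one> v = v" "norm v = 1" "\<rho> (g \<otimes> g') v = v" using has_fixed_vector[OF m_closed[OF g g']] .
  have fv: "\<rho> g (\<rho> g' v) = v" using v(3) g g' by simp
  define a where "a = (v \<bullet> w) *\<^sub>R w + (v \<bullet> e) *\<^sub>R e"
  define b where "b = (v \<bullet> p) *\<^sub>R p + (v \<bullet> q) *\<^sub>R q"
  have vab: "v = a + b" unfolding a_def b_def by (rule f1(7)[OF v(1)])
  note pb = plane[OF b_def]
  have bU: "\<rho> \<one> b = b" by (simp add: b_def blinfun.add_right blinfun.scaleR_right f1(15,16))
  have aU: "\<rho> \<one> a = a" by (simp add: a_def blinfun.add_right blinfun.scaleR_right U)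
  have ra: "\<rho> g (\<rho> g a) = a" by (simp add: a_def blinfun.add_right blinfun.scaleR_right fixed_w)
  let ?a' = "\<rho> g (\<rho> g' a)"
  have "\<rho> g (\<rho> g ?a') = \<rho> g (\<rho> g' (\<rho> g' (\<rho> g' a)))" by (simp only: sq')
  also have "\<dots> = ?a'" using ra by (simp add: sq')
  finally have ra': "\<rho> g (\<rho> g ?a') = ?a'" .
  have a'b: "?a' + \<rho> g (\<rho> g b) = a + b"
    using fv pb(1) by (simp add: vab blinfun.add_right)
  have rbw: "\<rho> g (\<rho> g b) \<bullet> x = 0" if "\<rho> \<one> x = x" "\<rho> g (\<rho> g x) = x" for x
  proof -
    have "\<rho> g (\<rho> g b) \<bullet> x = \<rho> g (\<rho> g b) \<bullet> \<rho> g (\<rho> g x)" using that by simp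
    also have "\<dots> = \<rho> g b \<bullet> \<rho> g x" by (rule inner_\<rho>[OF g]) (use g in simp)
    also have "\<dots> = b \<bullet> x" by (rule inner_\<rho>[OF g bU])
    also have "\<dots> = b \<bullet> ((x \<bullet> w) *\<^sub>R w + (x \<bullet> e) *\<^sub>R e)" using formula(3)[OF that] by simp
    finally show ?thesis using pb(2,3) by (simp add: inner_add_right)
  qed
  \<comment> \<open>\<open>?d\<close> is fixed by the common square, hence lies in the span of
    \<open>w\<close> and \<open>e\<close>, while both of its terms are orthogonal to that
    span.\<close>
  let ?d = "b - \<rho> g (\<rho> g b)"
  have d: "?d = ?a' - a" using a'b by (simp add: algebra_simps)
  have dU: "\<rho> \<one> ?d = ?d" using bU g by (simp add: blinfun.diff_right)
  have rd: "\<rho> g (\<rho> g ?d) = ?d" unfolding d using ra ra' by (simp add: blinfun.diff_right)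
  have "b \<bullet> ?d = b \<bullet> ((?d \<bullet> w) *\<^sub>R w + (?d \<bullet> e) *\<^sub>R e)" using formula(3)[OF dU rd] by (rule arg_cong)
  also have "\<dots> = 0" using pb(2,3) by (simp add: inner_add_right)
  finally have "?d \<bullet> ?d = 0" using rbw[OF dU rd] by (simp only: inner_diff_left[of b])
  hence "\<rho> g (\<rho> g b) = b" by simp
  from formula(3)[OF bU this] have "b = 0" using pb(2,3) by simp
  hence rv: "\<rho> g (\<rho> g v) = v" using vab ra by simp
  note fo = formula[OF v(1) rv]
  have "\<rho> g v = \<rho> g (\<rho> g (\<rho> g' v))" using fv by simp
  also have "\<dots> = \<rho> g' (\<rho> g' (\<rho> g' v))" by (simp only: sq')
  also have "\<dots> = \<rho> g' v" using rv by (simp add: sq')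
  finally have gv: "\<rho> g v = \<rho> g' v" .
  have half: "2 *\<^sub>R E = x - u \<and> 2 *\<^sub>R A = x + u" if "x = A + E" "u = A - E" for x u A E :: 'a
    unfolding that by (simp add: scaleR_2)
  note ev = half[OF fo(3,1), THEN conjunct1] half[OF fo(4,2), THEN conjunct1]
  note wv = half[OF fo(3,1), THEN conjunct2] half[OF fo(4,2), THEN conjunct2]
  \<comment> \<open>Proportional unit vectors differ by a factor of square 1 and so define the same
    projection onto a line.\<close>
  have par: "(x \<bullet> u) *\<^sub>R u = (x \<bullet> u') *\<^sub>R u'"
    if "l *\<^sub>R u = m *\<^sub>R u'" "l \<noteq> 0" "u \<bullet> u = 1" "u' \<bullet> u' = 1" for x u u' :: 'a and l m
  proof -
    have "inverse l *\<^sub>R (l *\<^sub>R u) = inverse l *\<^sub>R (m *\<^sub>R u')" using that(1) by (simp only:)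
    hence u: "u = (inverse l * m) *\<^sub>R u'" using that(2) by simp
    have "u \<bullet> u = (inverse l * m) * ((inverse l * m) * (u' \<bullet> u'))" unfolding u by simp
    hence 1: "(inverse l * m) * (inverse l * m) = 1" using that(3,4) by simp
    have "(x \<bullet> u) *\<^sub>R u = ((inverse l * m) * (inverse l * m) * (x \<bullet> u')) *\<^sub>R u'" unfolding u by (simp add: mult.commute mult.left_commute)
    thus ?thesis unfolding 1 by simp
  qed
  have "2 *\<^sub>R ((v \<bullet> e) *\<^sub>R e) = 2 *\<^sub>R ((v \<bullet> e') *\<^sub>R e')" unfolding ev gv ..
  hence ee': "(v \<bullet> e) *\<^sub>R e = (v \<bullet> e') *\<^sub>R e'" by (simp only: scaleR_cancel_left numeral_neq_zero simp_thms)
  have "2 *\<^sub>R ((v \<bullet> w) *\<^sub>R w) = 2 *\<^sub>R ((v \<bullet> w') *\<^sub>R w')" unfolding wv gv ..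
  hence ww': "(v \<bullet> w) *\<^sub>R w = (v \<bullet> w') *\<^sub>R w'" by (simp only: scaleR_cancel_left numeral_neq_zero simp_thms)
  have same: "\<rho> g a = \<rho> g' a" if a: "\<rho> \<one> a = a" "\<rho> g (\<rho> g a) = a" for a
  proof -
    have sum: "(a \<bullet> w) *\<^sub>R w + (a \<bullet> e) *\<^sub>R e = (a \<bullet> w') *\<^sub>R w' + (a \<bullet> e') *\<^sub>R e'"
      by (rule HOL.trans[OF formula(3)[OF a, symmetric] formula(4)[OF a]])
    have "(a \<bullet> w) *\<^sub>R w = (a \<bullet> w') *\<^sub>R w' \<and> (a \<bullet> e) *\<^sub>R e = (a \<bullet> e') *\<^sub>R e'"
    proof (cases "v \<bullet> e = 0")
      case False
      have "(a \<bullet> e) *\<^sub>R e = (a \<bullet> e') *\<^sub>R e'" by (rule par[OF ee' False unit(2,4)])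
      thus ?thesis using sum by simp
    next
      case True
      have "v \<bullet> w \<noteq> 0"
      proof
        assume "v \<bullet> w = 0"
        hence "(v \<bullet> w) *\<^sub>R w + (v \<bullet> e) *\<^sub>R e = 0" using True by simp
        hence "v = 0" by (rule HOL.trans[OF fo(3)])
        thus False using v(2) by simp
      qed
      hence "(a \<bullet> w) *\<^sub>R w = (a \<bullet> w') *\<^sub>R w'" by (rule par[OF ww' _ unit(1,3)])
      thus ?thesis using sum by simp
    qed
    thus ?thesis unfolding formula(1,2)[OF a] by simp
  qed
  show ?thesis
  proof (rule \<rho>_eqI[OF g g'])
    fix x assume x: "\<rho> \<one> x = x"
    let ?a = "(x \<bullet> w) *\<^sub>R w + (x \<bullet> e) *\<^sub>R e" and ?b = "(x \<bullet> p) *\<^sub>R p + (x \<bullet> q) *\<^sub>R q"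
    have "\<rho> g ?a = \<rho> g' ?a" by (rule same) (simp_all add: blinfun.add_right blinfun.scaleR_right U fixed_w)
    moreover have "\<rho> g ?b = \<rho> g' ?b" by (rule plane(1)[OF HOL.refl])
    ultimately have "\<rho> g (?a + ?b) = \<rho> g' (?a + ?b)" by (simp only: blinfun.add_right[of _ ?a ?b])
    thus "\<rho> g x = \<rho> g' x" unfolding f1(7)[OF x, symmetric] .
  qed
qed

text \<open>Without half turns each negative trace is -1 and its square has trace 1. Squaring is
  injective on these linear parts (\<open>sextic_inj\<close>) and never yields the identity, so the
  contributions cancel in pairs and the positive trace of the identity contradicts
  \<open>sum_tr\<close>.\<close>

lemma exists_half_turn: "\<exists>g w. half_turn g w"
proof (rule ccontr)
  assume no: "\<not> ?thesis"
  define H where "H = \<rho> ` carrier G"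
  define N where "N = {f \<in> H. tr f < 0}"
  have sextic: "\<exists>g w e p q s. f = \<rho> g \<and> sextic g w e p q s" if f: "f \<in> N" for f
  proof -
    obtain g where g: "g \<in> carrier G" "f = \<rho> g" "tr (\<rho> g) < 0" using f by (auto simp: N_def H_def)
    obtain w p q c s where nf: "neg_form g w p q c s" using negative_trace_form[OF g(1,3)] by blast
    have "c \<noteq> -1" using neg_form_half_turn[of g w p q s] nf no by blast
    hence c: "c = - 1 / 2" using neg_form_cosine[OF nf] by blast
    then obtain e where e: "unit e" "w \<bullet> e = 0" "p \<bullet> e = 0" "q \<bullet> e = 0"
      using nf unfolding neg_form_def by auto
    have eU: "\<rho> \<one> e = e" "e \<bullet> w = 0" "e \<bullet> p = 0" "e \<bullet> q = 0" using e by (simp_all add: unit_def inner_commute)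
    hence "\<rho> g e = - e" using nf unfolding neg_form_def by blast
    hence "sextic g w e p q s" using nf e unfolding sextic_def neg_form_def c by blast
    thus ?thesis using g(2) by blast
  qed
  define sq where "sq f = f o\<^sub>L f" for f :: "'a \<Rightarrow>\<^sub>L 'a"
  have sq\<rho>: "sq (\<rho> g) = \<rho> (g \<otimes> g)" if "g \<in> carrier G" for g using that by (simp add: sq_def \<rho>_mult)
  have finH: "finite H" using finite_holonomy by (simp add: H_def)
  have finN: "finite N" using finH by (simp add: N_def)
  have inj: "inj_on sq N"
  proof (rule inj_onI)
    fix f f' assume f: "f \<in> N" "f' \<in> N" "sq f = sq f'"
    obtain g w e p q s where 1: "f = \<rho> g" "sextic g w e p q s" using sextic[OF f(1)] by blast
    obtain g' w' e' p' q' s' where 2: "f' = \<rho> g'" "sextic g' w' e' p' q' s'" using sextic[OF f(2)] by blast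
    have "\<rho> (g \<otimes> g) = \<rho> (g' \<otimes> g')" using f(3) sq\<rho> 1 2 sextic_facts(1) by simp
    thus "f = f'" using sextic_inj[OF 1(2) 2(2)] 1(1) 2(1) by simp
  qed
  have trN: "tr f = -1" "tr (sq f) = 1" "sq f \<in> H" "sq f \<noteq> \<rho> \<one>" if f: "f \<in> N" for f
  proof -
    obtain g w e p q s where g: "f = \<rho> g" "sextic g w e p q s" using sextic[OF f] by blast
    note facts = sextic_facts[OF g(2)]
    show "tr f = -1" "tr (sq f) = 1" using facts g(1) sq\<rho> by simp_all
    show "sq f \<in> H" using facts(1) g(1) sq\<rho> by (simp add: H_def)
    show "sq f \<noteq> \<rho> \<one>"
    proof
      assume "sq f = \<rho> \<one>"
      hence "\<rho> (g \<otimes> g) = \<rho> \<one>" using g(1) sq\<rho>[OF facts(1)] by (simp only:)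
      thus False using facts(10,15) by (simp only: simp_thms)
    qed
  qed
  define M where "M = sq ` N"
  have finM: "finite M" using finN by (simp add: M_def)
  have "\<rho> \<one> \<in> H" by (simp add: H_def)
  moreover have "\<rho> \<one> \<notin> N" using tr_one by (simp add: N_def)
  moreover have "\<rho> \<one> \<notin> M"
  proof
    assume "\<rho> \<one> \<in> M"
    then obtain f where f: "f \<in> N" "\<rho> \<one> = sq f" unfolding M_def by blast
    show False using trN(4)[OF f(1)] f(2)[symmetric] by (rule notE)
  qed
  ultimately have P: "\<rho> \<one> \<in> H" "\<rho> \<one> \<notin> N" "\<rho> \<one> \<notin> M" .
  have disj: "N \<inter> M = {}"
  proof (rule equals0I)
    fix f assume "f \<in> N \<inter> M"
    then obtain f' where f: "f \<in> N" "f' \<in> N" "f = sq f'" unfolding M_def by blast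
    show False using trN(1)[OF f(1)] trN(2)[OF f(2)] f(3) by simp
  qed
  have MH: "M \<subseteq> H" unfolding M_def using trN(3) by (rule image_subsetI)
  have NH: "N \<subseteq> H" by (auto simp: N_def)
  have "0 = sum tr H" using sum_tr by (simp add: H_def)
  also have "\<dots> = sum tr (insert (\<rho> \<one>) (N \<union> M)) + sum tr (H - insert (\<rho> \<one>) (N \<union> M))"
  proof -
    have "insert (\<rho> \<one>) (N \<union> M) \<subseteq> H" using P(1) MH NH by blast
    thus ?thesis using sum.subset_diff[OF _ finH, of _ tr] by (simp only: add.commute)
  qed
  also have "sum tr (insert (\<rho> \<one>) (N \<union> M)) = tr (\<rho> \<one>) + (sum tr N + sum tr M)"
    using finN finM P disj by (simp add: sum.union_disjoint)
  also have "sum tr N = - real (card N)" using trN(1) by simp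
  also have "sum tr M = real (card N)" unfolding M_def using trN(2) by (simp add: sum.reindex[OF inj])
  finally have "0 = tr (\<rho> \<one>) + (- real (card N) + real (card N)) + sum tr (H - insert (\<rho> \<one>) (N \<union> M))" .
  moreover have "sum tr (H - insert (\<rho> \<one>) (N \<union> M)) \<ge> 0"
    by (rule sum_nonneg) (auto simp: N_def)
  ultimately show False using tr_one by simp
qed

theorem exists_HW_pair: "\<exists>x y. HW_pair G x y \<and> x \<noteq> \<one> \<and> y \<noteq> \<one>"
proof -
  obtain y w where y: "half_turn y w" using exists_half_turn by blast
  obtain x where "x \<in> carrier G" "\<rho> x w = - w" using half_turn_flip[OF y] by blast
  thus ?thesis using half_turn_pair[OF y] by blast
qed

end

lemma HW_pair_of_subgroup:
  assumes "group G" "subgroup H G" "HW_pair (G\<lparr>carrier := H\<rparr>) x y"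
  shows "HW_pair G x y"
proof -
  interpret group G by fact
  interpret H: HW_pair "G\<lparr>carrier := H\<rparr>" x y by fact
  have xy: "x \<in> H" "y \<in> H" using H.x H.y by simp_all
  have inv: "inv\<^bsub>G\<lparr>carrier := H\<rparr>\<^esub> z = inv\<^bsub>G\<^esub> z" if "z \<in> H" for z
    using m_inv_consistent[OF assms(2) that] .
  have sq: "x \<otimes>\<^bsub>G\<^esub> x \<in> H" "y \<otimes>\<^bsub>G\<^esub> y \<in> H" using xy assms(2) by (simp_all add: subgroup.m_closed)
  show ?thesis
  proof
    show "x \<in> carrier G" "y \<in> carrier G" using xy assms(2) subgroup.subset by blast+
    show "inv\<^bsub>G\<^esub> x \<otimes>\<^bsub>G\<^esub> (y \<otimes>\<^bsub>G\<^esub> y) \<otimes>\<^bsub>G\<^esub> x = inv\<^bsub>G\<^esub> (y \<otimes>\<^bsub>G\<^esub> y)"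
      using H.rel1 by (simp add: inv xy sq)
    show "inv\<^bsub>G\<^esub> y \<otimes>\<^bsub>G\<^esub> (x \<otimes>\<^bsub>G\<^esub> x) \<otimes>\<^bsub>G\<^esub> y = inv\<^bsub>G\<^esub> (x \<otimes>\<^bsub>G\<^esub> x)"
      using H.rel2 by (simp add: inv xy sq)
  qed
qed

lemma (in group) torsion_free_subgroup:
  assumes "torsion_free_group G" "H \<subseteq> carrier G"
  shows "torsion_free_group (G\<lparr>carrier := H\<rparr>)"
  unfolding torsion_free_group_def nat_pow_consistent[symmetric]
  using assms by (simp add: torsion_free_group_def subset_iff)

lemma diffuse_trivial_group: "diffuse_group (G\<lparr>carrier := {\<one>\<^bsub>G\<^esub>}\<rparr>)"
  unfolding diffuse_group_def extremal_point_def by auto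

section \<open>Diffuseness in low dimensions\<close>

text \<open>Hypotheses that every subgroup inherits; neither cocompactness nor spanning translations
  are among them.\<close>

locale discrete_isometries = isometric_action G \<rho> \<tau>
  for G (structure) and \<rho> :: "'g \<Rightarrow> 'a::euclidean_space \<Rightarrow>\<^sub>L 'a" and \<tau> :: "'g \<Rightarrow> 'a" +
  assumes torsion_free: "torsion_free_group G"
    and faithful: "g \<in> carrier G \<Longrightarrow> \<rho> g = \<rho> \<one> \<Longrightarrow> \<tau> g = 0 \<Longrightarrow> g = \<one>"
    and finite_holonomy: "finite (\<rho> ` carrier G)"
    and discrete: "\<exists>\<epsilon>>0. \<forall>g\<in>carrier G. \<rho> g = \<rho> \<one> \<longrightarrow> norm (\<tau> g) < \<epsilon> \<longrightarrow> \<tau> g = 0"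
    and dim_le: "dim (range (\<rho> \<one>)) \<le> 4"
begin

text \<open>The bound is independent of \<open>g\<close>: it is the factor by which the radius of
  discreteness shrinks when translations are projected to a subspace.\<close>

lemma bounded_order:
  assumes g: "g \<in> carrier G"
  shows "\<exists>m>0. m \<le> card (\<rho> ` carrier G) \<and> \<rho> (g [^] (m::nat)) = \<rho> \<one>"
proof -
  let ?n = "card (\<rho> ` carrier G)"
  have "\<not> inj_on (\<lambda>k::nat. \<rho> (g [^] k)) {..?n}"
  proof
    assume inj: "inj_on (\<lambda>k::nat. \<rho> (g [^] k)) {..?n}"
    have "(\<lambda>k::nat. \<rho> (g [^] k)) ` {..?n} \<subseteq> \<rho> ` carrier G" using g by auto
    from card_inj_on_le[OF inj this finite_holonomy] show False by simp
  qed
  then obtain i j where ij0: "i \<le> ?n" "j \<le> ?n" "i \<noteq> j" "\<rho> (g [^] i) = \<rho> (g [^] j)"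
    unfolding inj_on_def by auto
  obtain i j where ij: "i < j" "j \<le> ?n" "\<rho> (g [^] i) = \<rho> (g [^] j)"
  proof (cases "i < j")
    case True thus thesis using that ij0 by blast
  next
    case False
    hence "j < i" using ij0(3) by simp
    thus thesis using that[of j i] ij0 by simp
  qed
  have "\<rho> (g [^] (j - i)) = \<rho> \<one>"
  proof (rule blinfun_eqI)
    fix v
    have gi: "g [^] i \<in> carrier G" using g by simp
    have "\<rho> (g [^] (j - i) \<otimes> g [^] i) (\<rho> (inv (g [^] i)) v) = \<rho> (g [^] i) (\<rho> (inv (g [^] i)) v)"
      using g ij by (simp add: nat_pow_mult)
    thus "\<rho> (g [^] (j - i)) v = \<rho> \<one> v" using g gi by simp
  qed
  thus ?thesis using ij by (intro exI[of _ "j - i"]) auto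
qed

text \<open>Projecting the action to the span \<open>U\<close> of the translations of
  \<open>H\<close> makes them spanning, but an element acting trivially on \<open>U\<close> may
  become a new translation there. A power of it is a true translation, and this keeps the projected
  action faithful and discrete.\<close>

lemma subgroup_diffuse:
  assumes no_pair: "\<nexists>x y. HW_pair G x y \<and> x \<noteq> \<one> \<and> y \<noteq> \<one>" and "subgroup H G"
  shows "diffuse_group (G\<lparr>carrier := H\<rparr>)"
  using assms(2)
proof (induction "dim (\<tau> ` {g \<in> H. \<rho> g = \<rho> \<one>})" arbitrary: H rule: less_induct)
  case less
  note H = less.prems
  let ?H = "G\<lparr>carrier := H\<rparr>"
  interpret H: group ?H by (rule subgroup_imp_group[OF H])
  have HG: "g \<in> carrier G" if "g \<in> H" for g using H that subgroup.subset by blast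
  have Hinv: "inv g \<in> H" if "g \<in> H" for g using H that by (rule subgroup.m_inv_closed)
  have Hmult: "g \<otimes> h \<in> H" if "g \<in> H" "h \<in> H" for g h using H that by (rule subgroup.m_closed)
  have H1: "\<one> \<in> H" using H by (rule subgroup.one_closed)
  have Hpow: "g [^] (k::nat) \<in> H" if "g \<in> H" for g k
    by (induction k) (simp_all add: H1 Hmult that)
  show ?case
  proof (cases "H = {\<one>}")
    case True
    thus ?thesis using diffuse_trivial_group by simp
  next
    case nontriv: False
    define L where "L = \<tau> ` {g \<in> H. \<rho> g = \<rho> \<one>}"
    define U where "U = span L"
    have LU: "L \<subseteq> U" by (simp add: U_def span_superset)
    have subU: "subspace U" by (simp add: U_def)
    obtain B where B: "B \<subseteq> U" "pairwise orthogonal B" "\<And>x. x \<in> B \<Longrightarrow> norm x = 1" "independent B" "span B = U"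
      using orthonormal_basis_subspace[OF subU] by metis
    have finB: "finite B" using B(4) by (rule independent_imp_finite)
    define Qf where "Qf v = (\<Sum>b\<in>B. (v \<bullet> b) *\<^sub>R b)" for v
    have "bounded_linear Qf"
      unfolding Qf_def by (intro bounded_linear_sum bounded_linear_scaleR_const bounded_linear_inner_left)
    define Q where "Q = Blinfun Qf"
    have Q: "blinfun_apply Q v = (\<Sum>b\<in>B. (v \<bullet> b) *\<^sub>R b)" for v
      unfolding Q_def by (simp add: bounded_linear_Blinfun_apply \<open>bounded_linear Qf\<close> Qf_def)
    have QU: "Q v \<in> U" for v
      unfolding Q using B(1) subU by (intro subspace_sum subspace_scale) auto
    have Q_inner: "Q v \<bullet> b = v \<bullet> b" if "b \<in> B" for v b
    proof -
      have "(\<Sum>e\<in>B. (v \<bullet> e) *\<^sub>R e) \<bullet> b = (\<Sum>e\<in>B. if e = b then v \<bullet> b else 0)"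
        unfolding inner_sum_left
      proof (rule sum.cong[OF HOL.refl])
        fix e assume "e \<in> B"
        thus "(v \<bullet> e) *\<^sub>R e \<bullet> b = (if e = b then v \<bullet> b else 0)"
          using B(2) B(3)[of b] that by (auto simp: pairwise_def orthogonal_def dot_square_norm)
      qed
      also have "\<dots> = v \<bullet> b" using finB that by simp
      finally show ?thesis unfolding Q .
    qed
    have perp0: "x = 0" if x: "x \<in> U" "\<And>b. b \<in> B \<Longrightarrow> x \<bullet> b = 0" for x
    proof -
      have "orthogonal x x" using x B(5) orthogonal_to_span[of x B x] by (simp add: orthogonal_def)
      thus ?thesis by (simp add: orthogonal_self)
    qed
    have Qid: "Q u = u" if "u \<in> U" for u
    proof -
      have "Q u - u = 0"
        using QU[of u] that subU Q_inner by (intro perp0) (auto simp: inner_diff_left intro: subspace_diff)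
      thus ?thesis by simp
    qed
    have QQ: "Q (Q v) = Q v" for v by (rule Qid[OF QU])
    have Q_adj: "Q v \<bullet> w = v \<bullet> Q w" for v w
      unfolding Q by (simp add: inner_sum_left inner_sum_right inner_commute mult.commute)
    have \<rho>L: "\<rho> h x \<in> L" if h: "h \<in> H" and x: "x \<in> L" for h x
    proof -
      obtain n where n: "n \<in> H" "\<rho> n = \<rho> \<one>" "x = \<tau> n" using x by (auto simp: L_def)
      note c = HG[OF h] HG[OF n(1)]
      have "\<rho> (h \<otimes> n \<otimes> inv h) = \<rho> \<one>" by (rule blinfun_eqI) (use c n in simp)
      moreover have "\<tau> (h \<otimes> n \<otimes> inv h) = \<rho> h x"
        using c n by (simp add: \<tau>_mult \<tau>_inv blinfun.minus_right \<tau>_fixed)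
      moreover have "h \<otimes> n \<otimes> inv h \<in> H" using h n Hmult Hinv by blast
      ultimately show ?thesis unfolding L_def by force
    qed
    have \<rho>U: "\<rho> h u \<in> U" if h: "h \<in> H" and u: "u \<in> U" for h u
    proof -
      have "\<rho> h ` span L = span (\<rho> h ` L)"
        by (rule linear_span_image[symmetric]) (rule bounded_linear.linear[OF blinfun.bounded_linear_right])
      also have "\<dots> \<subseteq> span L" using \<rho>L[OF h] by (intro span_mono) blast
      finally show ?thesis using u by (auto simp: U_def)
    qed
    have PU: "\<rho> \<one> u = u" if "u \<in> U" for u
    proof -
      have "subspace {u. \<rho> \<one> u = u}"
        by (auto simp: subspace_def blinfun.zero_right blinfun.add_right blinfun.scaleR_right)
      moreover have "L \<subseteq> {u. \<rho> \<one> u = u}" using HG by (auto simp: L_def \<tau>_fixed)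
      ultimately have "span L \<subseteq> {u. \<rho> \<one> u = u}" by (rule span_minimal[rotated])
      thus ?thesis using that unfolding U_def by blast
    qed
    have Q\<rho>: "Q (\<rho> h v) = \<rho> h (Q v)" if h: "h \<in> H" for h v
    proof -
      let ?d = "Q (\<rho> h v) - \<rho> h (Q v)"
      have dU: "?d \<in> U" using QU \<rho>U[OF h QU] subU by (intro subspace_diff)
      have "?d \<bullet> u = 0" if u: "u \<in> U" for u
      proof -
        have iu: "\<rho> (inv h) u \<in> U" using \<rho>U Hinv h u by blast
        have "Q (\<rho> h v) \<bullet> u = v \<bullet> \<rho> (inv h) u"
          using Q_adj[of "\<rho> h v" u] Qid[OF u] inner_adjoint[OF HG[OF h]] by simp
        moreover have "\<rho> h (Q v) \<bullet> u = v \<bullet> \<rho> (inv h) u"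
          using Q_adj[of v "\<rho> (inv h) u"] Qid[OF iu] inner_adjoint[OF HG[OF h]] by simp
        ultimately show ?thesis by (simp add: inner_diff_left)
      qed
      from this[OF dU] show ?thesis by simp
    qed
    define \<rho>' where "\<rho>' h = \<rho> h o\<^sub>L Q" for h
    define \<tau>' where "\<tau>' h = Q (\<tau> h)" for h
    have \<rho>'_apply: "\<rho>' h v = \<rho> h (Q v)" for h v by (simp add: \<rho>'_def)
    interpret A: isometric_action ?H \<rho>' \<tau>'
    proof
      fix g h assume gh: "g \<in> carrier ?H" "h \<in> carrier ?H"
      hence c: "g \<in> H" "h \<in> H" "g \<in> carrier G" "h \<in> carrier G" using HG by auto
      show "\<rho>' (g \<otimes>\<^bsub>?H\<^esub> h) = \<rho>' g o\<^sub>L \<rho>' h"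
        by (rule blinfun_eqI) (simp add: \<rho>'_apply c Q\<rho> QQ)
      show "\<tau>' (g \<otimes>\<^bsub>?H\<^esub> h) = \<tau>' g + \<rho>' g (\<tau>' h)"
        by (simp add: \<tau>'_def \<rho>'_apply c QQ \<tau>_mult blinfun.add_right Q\<rho>)
    next
      fix g v w assume "g \<in> carrier ?H"
      hence g: "g \<in> carrier G" using HG by simp
      show "\<rho>' g v \<bullet> \<rho>' g w = \<rho>' \<one>\<^bsub>?H\<^esub> v \<bullet> w"
        using g by (simp add: \<rho>'_apply \<rho>_inner PU QU Q_adj QQ)
    next
      fix g assume "g \<in> carrier ?H"
      show "\<rho>' \<one>\<^bsub>?H\<^esub> (\<tau>' g) = \<tau>' g" by (simp add: \<rho>'_apply \<tau>'_def QQ PU QU)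
    qed
    have \<rho>'_trans: "\<rho>' n = \<rho>' \<one>" "\<tau>' n = \<tau> n" if "n \<in> H" "\<rho> n = \<rho> \<one>" for n
    proof -
      show "\<rho>' n = \<rho>' \<one>" using that by (simp add: \<rho>'_def)
      have "\<tau> n \<in> U" using that LU by (auto simp: L_def)
      thus "\<tau>' n = \<tau> n" by (simp add: \<tau>'_def Qid)
    qed
    \<comment> \<open>The element need not be a translation of the whole space; on \<open>U\<close>
      it acts as one, so its projected vectors add up.\<close>
    have \<tau>'_pow: "\<tau>' (g [^] k) = real k *\<^sub>R \<tau>' g" if g: "g \<in> H" "\<rho>' g = \<rho>' \<one>" for g and k :: nat
    proof (induction k)
      case 0
      show ?case using A.\<tau>_one by simp
    next
      case (Suc k)
      have "\<tau>' (g \<otimes> g [^] k) = \<tau>' g + \<rho>' \<one> (\<tau>' (g [^] k))"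
        using A.\<tau>_mult[of g "g [^] k"] g Hpow by simp
      also have "\<rho>' \<one> (\<tau>' (g [^] k)) = \<tau>' (g [^] k)" using A.\<tau>_fixed[of "g [^] k"] g Hpow by simp
      also have "g \<otimes> g [^] k = g [^] Suc k" using nat_pow_Suc2[OF HG[OF g(1)]] by simp
      finally show ?case using Suc by (simp add: scaleR_add_left)
    qed
    show ?thesis
    proof (cases "\<exists>u. u \<noteq> 0 \<and> \<rho>' \<one> u = u \<and> (\<forall>g\<in>H. \<rho>' g u = u)")
      case True
      then obtain u where u: "u \<noteq> 0" "\<rho>' \<one> u = u" "\<And>g. g \<in> H \<Longrightarrow> \<rho>' g u = u" by blast
      have uU: "u \<in> U" using u(2) \<rho>U[OF H1 QU[of u]] by (simp add: \<rho>'_apply)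
      have \<rho>u: "\<rho> g u = u" if "g \<in> H" for g using u(3)[OF that] Qid[OF uU] by (simp add: \<rho>'_apply)
      \<comment> \<open>The component of the translation along a common fixed vector is
        additive.\<close>
      define \<phi> where "\<phi> g = \<tau> g \<bullet> u" for g
      have \<phi>: "\<phi> (g \<otimes> h) = \<phi> g + \<phi> h" if "g \<in> H" "h \<in> H" for g h
        using that HG inner_adjoint[of g "\<tau> h" u] \<rho>u[OF Hinv[of g]] by (simp add: \<phi>_def \<tau>_mult inner_add_left)
      let ?K = "{g \<in> H. \<phi> g = 0}"
      have \<phi>1: "\<phi> \<one> = 0" by (simp add: \<phi>_def)
      have K: "subgroup ?K G"
      proof (rule subgroupI)
        show "?K \<subseteq> carrier G" using HG by blast
        show "?K \<noteq> {}" using H1 \<phi>1 by blast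
        fix g assume g: "g \<in> ?K"
        have "\<phi> (g \<otimes> inv g) = \<phi> g + \<phi> (inv g)" using g Hinv by (intro \<phi>) auto
        thus "inv g \<in> ?K" using g Hinv HG \<phi>1 by simp
        fix h assume "h \<in> ?K"
        thus "g \<otimes> h \<in> ?K" using g Hmult \<phi> by simp
      qed
      let ?LK = "\<tau> ` {g \<in> ?K. \<rho> g = \<rho> \<one>}"
      \<comment> \<open>The vector \<open>u\<close> lies in the span of the translations of
        \<open>H\<close> but is orthogonal to those of the kernel, so the dimension drops.\<close>
      have "span ?LK \<subset> span L"
      proof
        show "span ?LK \<subseteq> span L" by (rule span_mono) (auto simp: L_def)
        have "subspace {x. x \<bullet> u = 0}" by (auto simp: subspace_def inner_add_left)
        moreover have "?LK \<subseteq> {x. x \<bullet> u = 0}" by (auto simp: \<phi>_def)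
        ultimately have "span ?LK \<subseteq> {x. x \<bullet> u = 0}" by (intro span_minimal)
        hence "u \<notin> span ?LK" using u(1) by auto
        thus "span ?LK \<noteq> span L" using uU unfolding U_def by blast
      qed
      hence "dim ?LK < dim L" by (rule dim_psubset)
      hence "diffuse_group (G\<lparr>carrier := ?K\<rparr>)" by (intro less.hyps K) (simp add: L_def)
      moreover have "?H\<lparr>carrier := {g \<in> carrier ?H. \<phi> g = 0}\<rparr> = G\<lparr>carrier := ?K\<rparr>" by simp
      ultimately have "diffuse_group (?H\<lparr>carrier := {g \<in> carrier ?H. \<phi> g = 0}\<rparr>)" by (simp only:)
      thus ?thesis by (rule diffuse_by_ordered_quotient[OF H.group_axioms, rotated]) (simp add: \<phi>)
    next
      case False
      obtain \<epsilon> where e: "\<epsilon> > 0" "\<And>g. g \<in> carrier G \<Longrightarrow> \<rho> g = \<rho> \<one> \<Longrightarrow> norm (\<tau> g) < \<epsilon> \<Longrightarrow> \<tau> g = 0"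
        using discrete by blast
      let ?n = "card (\<rho> ` carrier G)"
      have n0: "?n > 0" using finite_holonomy by (auto simp: card_gt_0_iff)
      interpret C: crystal_action ?H \<rho>' \<tau>'
      proof
        show "torsion_free_group ?H" using torsion_free_subgroup[OF torsion_free] HG by blast
        show "finite (\<rho>' ` carrier ?H)"
        proof (rule finite_subset)
          show "\<rho>' ` carrier ?H \<subseteq> (\<lambda>f. f o\<^sub>L Q) ` (\<rho> ` carrier G)" using HG by (auto simp: \<rho>'_def)
        qed (simp add: finite_holonomy)
        show "carrier ?H \<noteq> {\<one>\<^bsub>?H\<^esub>}" using nontriv by simp
        show "dim (range (\<rho>' \<one>\<^bsub>?H\<^esub>)) \<le> 4"
        proof -
          have "range (\<rho>' \<one>) \<subseteq> range (\<rho> \<one>)" by (auto simp: \<rho>'_apply)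
          hence "dim (range (\<rho>' \<one>)) \<le> dim (range (\<rho> \<one>))" by (rule dim_subset)
          thus ?thesis using dim_le by simp
        qed
        show "\<rho>' \<one>\<^bsub>?H\<^esub> v \<in> span (\<tau>' ` {g \<in> carrier ?H. \<rho>' g = \<rho>' \<one>\<^bsub>?H\<^esub>})" for v
        proof -
          have "L \<subseteq> \<tau>' ` {g \<in> H. \<rho>' g = \<rho>' \<one>}"
          proof
            fix x assume "x \<in> L"
            then obtain n where n: "n \<in> H" "\<rho> n = \<rho> \<one>" "x = \<tau> n" by (auto simp: L_def)
            thus "x \<in> \<tau>' ` {g \<in> H. \<rho>' g = \<rho>' \<one>}" using \<rho>'_trans[OF n(1,2)] by force
          qed
          hence "U \<subseteq> span (\<tau>' ` {g \<in> H. \<rho>' g = \<rho>' \<one>})" unfolding U_def by (rule span_mono)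
          moreover have "\<rho>' \<one> v \<in> U" using \<rho>U[OF H1 QU] by (simp add: \<rho>'_apply)
          ultimately show ?thesis by auto
        qed
        show "u = 0" if "\<rho>' \<one>\<^bsub>?H\<^esub> u = u" "\<And>g. g \<in> carrier ?H \<Longrightarrow> \<rho>' g u = u" for u
          using False that by auto
        show "g = \<one>\<^bsub>?H\<^esub>" if g: "g \<in> carrier ?H" "\<rho>' g = \<rho>' \<one>\<^bsub>?H\<^esub>" "\<tau>' g = 0" for g
        proof -
          have gH: "g \<in> H" and \<rho>g: "\<rho>' g = \<rho>' \<one>" using g by simp_all
          \<comment> \<open>The true translation \<open>g [^] m\<close> has \<open>m\<close> times
            the projected vector of \<open>g\<close>, which is zero here; torsion-freeness then
            returns to \<open>g\<close>.\<close>
          obtain m :: nat where m: "m > 0" "\<rho> (g [^] m) = \<rho> \<one>" using bounded_order HG[OF gH] by blast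
          have "\<tau> (g [^] m) = 0"
            using \<tau>'_pow[OF gH \<rho>g, of m] \<rho>'_trans(2)[OF Hpow[OF gH] m(2)] g(3) by simp
          hence "g [^] m = \<one>" using faithful m(2) HG[OF Hpow[OF gH]] by blast
          thus ?thesis using torsion_free m(1) HG[OF gH] unfolding torsion_free_group_def by simp
        qed
        \<comment> \<open>The vector of a true translation \<open>g [^] m\<close> is
          \<open>m\<close> times the projected vector of \<open>g\<close>, with \<open>m\<close> at
          most \<open>?n\<close>; hence the radius \<open>\<epsilon> / ?n\<close>.\<close>
        show "\<exists>\<epsilon>>0. \<forall>g\<in>carrier ?H. \<rho>' g = \<rho>' \<one>\<^bsub>?H\<^esub> \<longrightarrow> norm (\<tau>' g) < \<epsilon> \<longrightarrow> \<tau>' g = 0"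
        proof (intro exI[of _ "\<epsilon> / ?n"] conjI ballI impI)
          show "\<epsilon> / ?n > 0" using e(1) n0 by simp
          fix g assume g: "g \<in> carrier ?H" "\<rho>' g = \<rho>' \<one>\<^bsub>?H\<^esub>" "norm (\<tau>' g) < \<epsilon> / ?n"
          have gH: "g \<in> H" and \<rho>g: "\<rho>' g = \<rho>' \<one>" using g by simp_all
          obtain m :: nat where m: "m > 0" "m \<le> ?n" "\<rho> (g [^] m) = \<rho> \<one>" using bounded_order HG[OF gH] by blast
          have eq: "\<tau> (g [^] m) = real m *\<^sub>R \<tau>' g"
            using \<tau>'_pow[OF gH \<rho>g, of m] \<rho>'_trans(2)[OF Hpow[OF gH] m(3)] by simp
          have "norm (\<tau> (g [^] m)) \<le> ?n * norm (\<tau>' g)" unfolding eq using m(2) by (simp add: mult_right_mono)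
          also have "\<dots> < \<epsilon>" using g(3) n0 by (simp add: field_simps)
          finally have "\<tau> (g [^] m) = 0" by (intro e(2) m(3) HG Hpow gH)
          thus "\<tau>' g = 0" using eq m(1) by simp
        qed
      qed
      obtain x y where xy: "HW_pair ?H x y" "x \<noteq> \<one>" "y \<noteq> \<one>" using C.exists_HW_pair by auto
      hence "HW_pair G x y" using HW_pair_of_subgroup[OF group_axioms H] by blast
      thus ?thesis using no_pair xy by blast
    qed
  qed
qed

end

section \<open>Bieberbach groups of dimension at most 4\<close>

definition box_nbhd :: "nat \<Rightarrow> real mat \<times> real Matrix.vec \<Rightarrow> real \<Rightarrow> (real mat \<times> real Matrix.vec) set" where
  "box_nbhd n g \<epsilon> = {h \<in> carrier (isometry_group n).
     (\<forall>i<n. \<forall>j<n. \<bar>fst h $$ (i, j) - fst g $$ (i, j)\<bar> < \<epsilon>) \<and> (\<forall>i<n. \<bar>vec_index (snd h) i - vec_index (snd g) i\<bar> < \<epsilon>)}"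

lemma openin_box_nbhd: "openin (isometry_topology n) (box_nbhd n g \<epsilon>)"
proof -
  let ?I = "{..<n} \<times> {..<n}"
  define W where "W = PiE ?I (\<lambda>ij. ball (fst g $$ ij) \<epsilon>) \<times> PiE {..<n} (\<lambda>i. ball (vec_index (snd g) i) \<epsilon>)"
  have "openin (prod_topology (product_topology (\<lambda>_. euclideanreal) ?I) (product_topology (\<lambda>_. euclideanreal) {..<n})) W"
  proof -
    have "openin (product_topology (\<lambda>_. euclideanreal) ?I) (PiE ?I (\<lambda>ij. ball (fst g $$ ij) \<epsilon>))"
      "openin (product_topology (\<lambda>_. euclideanreal) {..<n}) (PiE {..<n} (\<lambda>i. ball (vec_index (snd g) i) \<epsilon>))"
      by (simp_all only: openin_PiE finite_cartesian_product finite_lessThan) simp_all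
    thus ?thesis unfolding W_def openin_prod_Times_iff by (simp only: simp_thms)
  qed
  moreover have "box_nbhd n g \<epsilon> =
      (\<lambda>(A, v). (\<lambda>ij\<in>?I. A $$ ij, \<lambda>i\<in>{..<n}. vec_index v i)) -` W \<inter> carrier (isometry_group n)"
  proof (rule Set.set_eqI)
    fix h :: "real mat \<times> real Matrix.vec"
    obtain A v where h: "h = (A, v)" by (cases h)
    have ball: "y \<in> ball x \<epsilon> \<longleftrightarrow> \<bar>y - x\<bar> < \<epsilon>" for x y :: real
      by (simp add: dist_real_def abs_minus_commute)
    have "restrict (\<lambda>ij. A $$ ij) ?I \<in> PiE ?I (\<lambda>ij. ball (fst g $$ ij) \<epsilon>) \<longleftrightarrow>
        (\<forall>i<n. \<forall>j<n. \<bar>A $$ (i, j) - fst g $$ (i, j)\<bar> < \<epsilon>)"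
      unfolding restrict_PiE_iff ball by blast
    moreover have "restrict (vec_index v) {..<n} \<in> PiE {..<n} (\<lambda>i. ball (vec_index (snd g) i) \<epsilon>) \<longleftrightarrow>
        (\<forall>i<n. \<bar>vec_index v i - vec_index (snd g) i\<bar> < \<epsilon>)"
      unfolding restrict_PiE_iff ball by blast
    ultimately show "h \<in> box_nbhd n g \<epsilon> \<longleftrightarrow>
        h \<in> (\<lambda>(A, v). (\<lambda>ij\<in>?I. A $$ ij, \<lambda>i\<in>{..<n}. vec_index v i)) -` W \<inter> carrier (isometry_group n)"
      by (simp add: h box_nbhd_def W_def conj_commute)
  qed
  ultimately show ?thesis
    unfolding isometry_topology_def openin_pullback_topology by blast
qed

lemma uniform_epsilon:
  assumes "finite I" "\<And>i. i \<in> I \<Longrightarrow> \<exists>\<epsilon>>0. P i \<epsilon>" "\<And>i \<epsilon> \<delta>. P i \<epsilon> \<Longrightarrow> \<delta> \<le> \<epsilon> \<Longrightarrow> P i \<delta>"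
  shows "\<exists>\<epsilon>>0::real. \<forall>i\<in>I. P i \<epsilon>"
  using assms(1,2)
proof (induction I)
  case empty
  show ?case by (auto intro: exI[of _ 1])
next
  case (insert i I)
  obtain \<epsilon> where e: "\<epsilon> > 0" "\<forall>i\<in>I. P i \<epsilon>" using insert by auto
  obtain \<delta> where d: "\<delta> > 0" "P i \<delta>" using insert.prems by blast
  have "P i (min \<epsilon> \<delta>)" "\<forall>i\<in>I. P i (min \<epsilon> \<delta>)" using d e assms(3) by (meson min.cobounded1 min.cobounded2)+
  thus ?case using e d by (intro exI[of _ "min \<epsilon> \<delta>"]) auto
qed

lemma openin_product_ball:
  fixes x :: "'i \<Rightarrow> real"
  assumes "finite I" "openin (product_topology (\<lambda>_. euclideanreal) I) U" "restrict x I \<in> U"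
  shows "\<exists>\<epsilon>>0. \<forall>y. (\<forall>i\<in>I. \<bar>y i - x i\<bar> < \<epsilon>) \<longrightarrow> restrict y I \<in> U"
proof -
  obtain V where V: "\<And>i. i \<in> I \<Longrightarrow> open (V i)" "restrict x I \<in> PiE I V" "PiE I V \<subseteq> U"
    using assms(2,3) unfolding openin_product_topology_alt by (metis open_openin)
  have "\<exists>\<epsilon>>0. \<forall>i\<in>I. ball (x i) \<epsilon> \<subseteq> V i"
  proof (rule uniform_epsilon[OF assms(1)])
    fix i assume i: "i \<in> I"
    hence "x i \<in> V i" using V(2) by (auto simp: restrict_PiE_iff)
    thus "\<exists>\<epsilon>>0. ball (x i) \<epsilon> \<subseteq> V i" using V(1)[OF i] open_contains_ball by blast
  qed (use subset_ball in blast)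
  then obtain \<epsilon> where e: "\<epsilon> > 0" "\<And>i. i \<in> I \<Longrightarrow> ball (x i) \<epsilon> \<subseteq> V i" by blast
  have "restrict y I \<in> U" if y: "\<forall>i\<in>I. \<bar>y i - x i\<bar> < \<epsilon>" for y
  proof -
    have "y i \<in> V i" if "i \<in> I" for i
      using e(2)[OF that] y that by (auto simp: subset_iff dist_real_def abs_minus_commute)
    hence "restrict y I \<in> PiE I V" by (simp add: restrict_PiE_iff)
    thus ?thesis using V(3) by blast
  qed
  thus ?thesis using e(1) by blast
qed

lemma openin_isometry_topology_box:
  assumes "openin (isometry_topology n) T" "g \<in> T"
  shows "\<exists>\<epsilon>>0. box_nbhd n g \<epsilon> \<subseteq> T"
proof -
  let ?I = "{..<n} \<times> {..<n}"
  let ?f = "\<lambda>(A, v). (\<lambda>ij\<in>?I. A $$ ij, \<lambda>i\<in>{..<n}. vec_index v i) :: (nat \<times> nat \<Rightarrow> real) \<times> (nat \<Rightarrow> real)"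
  obtain W where W: "openin (prod_topology (product_topology (\<lambda>_. euclideanreal) ?I) (product_topology (\<lambda>_. euclideanreal) {..<n})) W"
    "T = ?f -` W \<inter> carrier (isometry_group n)"
    using assms(1) unfolding isometry_topology_def openin_pullback_topology by blast
  obtain B w where g: "g = (B, w)" by (cases g)
  have "?f g \<in> W" using assms(2) unfolding W(2) by blast
  hence "(restrict (\<lambda>ij. B $$ ij) ?I, restrict (vec_index w) {..<n}) \<in> W" by (simp only: g prod.case)
  from W(1)[unfolded openin_prod_topology_alt, rule_format, OF this] obtain U V where UV: "openin (product_topology (\<lambda>_. euclideanreal) ?I) U" "openin (product_topology (\<lambda>_. euclideanreal) {..<n}) V"
    "restrict (\<lambda>ij. B $$ ij) ?I \<in> U" "restrict (vec_index w) {..<n} \<in> V" "U \<times> V \<subseteq> W"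
    by (elim exE conjE)
  obtain \<epsilon> where e: "\<epsilon> > 0" "\<And>y. (\<forall>ij\<in>?I. \<bar>y ij - B $$ ij\<bar> < \<epsilon>) \<Longrightarrow> restrict y ?I \<in> U"
    using openin_product_ball[OF _ UV(1,3)] by auto
  obtain \<delta> where d: "\<delta> > 0" "\<And>y. (\<forall>i\<in>{..<n}. \<bar>y i - vec_index w i\<bar> < \<delta>) \<Longrightarrow> restrict y {..<n} \<in> V"
    using openin_product_ball[OF _ UV(2,4)] by auto
  have "box_nbhd n g (min \<epsilon> \<delta>) \<subseteq> T"
  proof
    fix h assume h: "h \<in> box_nbhd n g (min \<epsilon> \<delta>)"
    obtain A v where hA: "h = (A, v)" by (cases h)
    have "restrict (\<lambda>ij. A $$ ij) ?I \<in> U" by (rule e(2)) (use h in \<open>auto simp: box_nbhd_def hA g\<close>)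
    moreover have "restrict (vec_index v) {..<n} \<in> V" by (rule d(2)) (use h in \<open>auto simp: box_nbhd_def hA g\<close>)
    ultimately have "(restrict (\<lambda>ij. A $$ ij) ?I, restrict (vec_index v) {..<n}) \<in> W" using UV(5) by blast
    hence "?f h \<in> W" by (simp only: hA prod.case)
    moreover have "h \<in> carrier (isometry_group n)" using h by (simp add: box_nbhd_def)
    ultimately show "h \<in> T" unfolding W(2) by blast
  qed
  thus ?thesis using e(1) d(1) by (intro exI[of _ "min \<epsilon> \<delta>"]) auto
qed

lemma discrete_in_isometries_iff:
  assumes "\<Gamma> \<subseteq> carrier (isometry_group n)"
  shows "discrete_in_isometries n \<Gamma> \<longleftrightarrow> (\<forall>g\<in>\<Gamma>. \<exists>\<epsilon>>0. box_nbhd n g \<epsilon> \<inter> \<Gamma> \<subseteq> {g})"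
proof
  assume d: "discrete_in_isometries n \<Gamma>"
  show "\<forall>g\<in>\<Gamma>. \<exists>\<epsilon>>0. box_nbhd n g \<epsilon> \<inter> \<Gamma> \<subseteq> {g}"
  proof
    fix g assume g: "g \<in> \<Gamma>"
    hence "openin (subtopology (isometry_topology n) \<Gamma>) {g}"
      using d by (simp add: discrete_in_isometries_def)
    then obtain T where T: "openin (isometry_topology n) T" "{g} = T \<inter> \<Gamma>" unfolding openin_subtopology by blast
    obtain \<epsilon> where "\<epsilon> > 0" "box_nbhd n g \<epsilon> \<subseteq> T" using openin_isometry_topology_box[OF T(1), of g] T(2) by blast
    thus "\<exists>\<epsilon>>0. box_nbhd n g \<epsilon> \<inter> \<Gamma> \<subseteq> {g}" using T(2) by blast
  qed
next
  assume box: "\<forall>g\<in>\<Gamma>. \<exists>\<epsilon>>0. box_nbhd n g \<epsilon> \<inter> \<Gamma> \<subseteq> {g}"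
  have "openin (subtopology (isometry_topology n) \<Gamma>) {g}" if g: "g \<in> \<Gamma>" for g
  proof -
    obtain \<epsilon> where e: "\<epsilon> > 0" "box_nbhd n g \<epsilon> \<inter> \<Gamma> \<subseteq> {g}" using box g by blast
    have "g \<in> box_nbhd n g \<epsilon>" using e(1) g assms by (auto simp: box_nbhd_def)
    hence "{g} = box_nbhd n g \<epsilon> \<inter> \<Gamma>" using e(2) g by blast
    thus ?thesis unfolding openin_subtopology using openin_box_nbhd by blast
  qed
  moreover have "topspace (subtopology (isometry_topology n) \<Gamma>) = \<Gamma>"
    using assms by (auto simp: topspace_isometry_topology)
  ultimately have "discrete_topology \<Gamma> = subtopology (isometry_topology n) \<Gamma>"
    unfolding discrete_topology_unique by blast
  thus "discrete_in_isometries n \<Gamma>" by (simp add: discrete_in_isometries_def)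
qed

text \<open>The dimension \<open>n\<close> is a number, whereas a Euclidean space is a type. Sending
  coordinates to \<open>n\<close> vectors of the standard basis of one fixed space treats all small
  dimensions at once, and the identity matrix becomes the projection onto their span.\<close>

locale coordinates =
  fixes n :: nat and e :: "nat \<Rightarrow> 'a::euclidean_space"
  assumes inj: "inj_on e {..<n}" and basis: "e ` {..<n} \<subseteq> Basis"
begin

definition \<iota> :: "real Matrix.vec \<Rightarrow> 'a" where "\<iota> v = (\<Sum>i<n. vec_index v i *\<^sub>R e i)"
definition \<pi> :: "'a \<Rightarrow> real Matrix.vec" where "\<pi> x = Matrix.vec n (\<lambda>i. x \<bullet> e i)"

lemma e_inner: "i < n \<Longrightarrow> j < n \<Longrightarrow> e i \<bullet> e j = (if i = j then 1 else 0)"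
  using inj basis by (auto simp: inner_Basis inj_on_def image_subset_iff)

lemma \<iota>_inner_e: "i < n \<Longrightarrow> \<iota> v \<bullet> e i = vec_index v i"
proof -
  assume i: "i < n"
  have "\<iota> v \<bullet> e i = (\<Sum>j<n. if j = i then vec_index v i else 0)"
    unfolding \<iota>_def inner_sum_left by (rule sum.cong) (use i in \<open>auto simp: e_inner\<close>)
  thus ?thesis using i by simp
qed

lemma \<pi>_carrier [simp]: "\<pi> x \<in> carrier_vec n" "dim_vec (\<pi> x) = n" by (simp_all add: \<pi>_def)

lemma \<pi>_\<iota> [simp]: "v \<in> carrier_vec n \<Longrightarrow> \<pi> (\<iota> v) = v"
  by (rule eq_vecI) (auto simp: \<pi>_def \<iota>_inner_e)

lemma \<iota>_add: "v \<in> carrier_vec n \<Longrightarrow> w \<in> carrier_vec n \<Longrightarrow> \<iota> (v + w) = \<iota> v + \<iota> w"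
  by (auto simp: \<iota>_def sum.distrib[symmetric] scaleR_add_left intro!: sum.cong)

lemma \<iota>_diff: "v \<in> carrier_vec n \<Longrightarrow> w \<in> carrier_vec n \<Longrightarrow> \<iota> (v - w) = \<iota> v - \<iota> w"
  by (auto simp: \<iota>_def sum_subtractf[symmetric] scaleR_diff_left intro!: sum.cong)

lemma \<iota>_smult: "v \<in> carrier_vec n \<Longrightarrow> \<iota> (c \<cdot>\<^sub>v v) = c *\<^sub>R \<iota> v"
  by (auto simp: \<iota>_def scaleR_sum_right intro!: sum.cong)

lemma \<pi>_add: "\<pi> (x + y) = \<pi> x + \<pi> y" and \<pi>_smult: "\<pi> (c *\<^sub>R x) = c \<cdot>\<^sub>v \<pi> x"
  by (auto simp: \<pi>_def inner_add_left)

lemma \<iota>_inner: "v \<in> carrier_vec n \<Longrightarrow> \<iota> v \<bullet> x = scalar_prod v (\<pi> x)"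
  unfolding \<iota>_def inner_sum_left by (simp add: \<pi>_def scalar_prod_def inner_commute atLeast0LessThan)

lemma \<iota>_norm_le: "norm (\<iota> v - \<iota> w) \<le> (\<Sum>i<n. \<bar>vec_index v i - vec_index w i\<bar>)"
proof -
  have "\<iota> v - \<iota> w = (\<Sum>i<n. (vec_index v i - vec_index w i) *\<^sub>R e i)"
    by (simp add: \<iota>_def sum_subtractf scaleR_diff_left)
  also have "norm \<dots> \<le> (\<Sum>i<n. norm ((vec_index v i - vec_index w i) *\<^sub>R e i))" by (rule norm_sum)
  also have "\<dots> \<le> (\<Sum>i<n. \<bar>vec_index v i - vec_index w i\<bar>)"
    using basis by (intro sum_mono) (auto simp: image_subset_iff)
  finally show ?thesis .
qed

definition lin :: "real mat \<Rightarrow> 'a \<Rightarrow>\<^sub>L 'a" where "lin A = Blinfun (\<lambda>x. \<iota> (A *\<^sub>v \<pi> x))"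

lemma lin_apply: "A \<in> carrier_mat n n \<Longrightarrow> lin A x = \<iota> (A *\<^sub>v \<pi> x)"
proof -
  assume A: "A \<in> carrier_mat n n"
  have "linear (\<lambda>x. \<iota> (A *\<^sub>v \<pi> x))"
    using A by (intro linearI)
      (simp_all add: \<pi>_add \<pi>_smult mult_add_distrib_mat_vec[of _ n n] mult_mat_vec[of _ n n] \<iota>_add \<iota>_smult)
  thus ?thesis unfolding lin_def by (simp add: bounded_linear_Blinfun_apply linear_conv_bounded_linear)
qed

lemma lin_inner:
  assumes "A \<in> orthogonal_group_carrier n"
  shows "lin A v \<bullet> lin A w = scalar_prod (\<pi> v) (\<pi> w)"
proof -
  have A: "A \<in> carrier_mat n n" "transpose_mat A * A = 1\<^sub>m n"
    using assms by (auto simp: orthogonal_group_carrier_def)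
  have "lin A v \<bullet> lin A w = scalar_prod (A *\<^sub>v \<pi> v) (A *\<^sub>v \<pi> w)"
    using A by (simp add: lin_apply \<iota>_inner)
  also have "\<dots> = scalar_prod (transpose_mat A *\<^sub>v (A *\<^sub>v \<pi> v)) (\<pi> w)"
    by (rule transpose_vec_mult_scalar[symmetric]) (use A in auto)
  also have "transpose_mat A *\<^sub>v (A *\<^sub>v \<pi> v) = (transpose_mat A * A) *\<^sub>v \<pi> v"
    by (rule assoc_mult_mat_vec[symmetric, of _ n n _ n]) (use A in auto)
  finally show ?thesis unfolding A(2) by simp
qed

end

text \<open>The isometries whose translation comes within \<open>k\<close> of one from
  \<open>\<Gamma>\<close> form an open set \<open>D k\<close> invariant under
  \<open>\<Gamma>\<close>. The images of these sets are an increasing open cover of the compact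
  quotient, so a single \<open>k\<close> serves all isometries, in particular all
  translations.\<close>

lemma cocompact_covering:
  assumes co: "coordinates n (e :: nat \<Rightarrow> 'a::euclidean_space)"
    and \<Gamma>: "subgroup \<Gamma> (isometry_group n)" and cocompact: "cocompact_in_isometries n \<Gamma>"
  shows "\<exists>R. \<forall>v\<in>carrier_vec n. \<exists>h\<in>\<Gamma>. norm (coordinates.\<iota> n e (snd h) - coordinates.\<iota> n e v) \<le> R"
proof -
  interpret coordinates n e by fact
  interpret I: group "isometry_group n" by (rule group_isometry_group)
  let ?X = "isometry_topology n" and ?I = "isometry_group n"
  let ?q = "\<lambda>g. \<Gamma> #>\<^bsub>?I\<^esub> g"
  obtain Q where Q: "quotient_map ?X Q ?q" "compact_space Q"
    using cocompact by (auto simp: cocompact_in_isometries_def)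
  have \<Gamma>c: "g \<in> carrier ?I" if "g \<in> \<Gamma>" for g using \<Gamma> that subgroup.subset by blast
  define D where "D k = {g \<in> carrier ?I. \<exists>h\<in>\<Gamma>. norm (\<iota> (snd g) - \<iota> (snd h)) < real k}" for k :: nat
  have D_open: "openin ?X (D k)" for k
  proof (subst openin_subopen, intro ballI)
    fix g assume "g \<in> D k"
    then obtain h where gh: "g \<in> carrier ?I" "h \<in> \<Gamma>" "norm (\<iota> (snd g) - \<iota> (snd h)) < real k" by (auto simp: D_def)
    \<comment> \<open>A box of radius \<open>\<epsilon>\<close> moves the translation by at most
      \<open>n * \<epsilon>\<close>; the denominator \<open>n + 1\<close> keeps this strictly below
      the margin and covers \<open>n = 0\<close>.\<close>
    define \<epsilon> where "\<epsilon> = (real k - norm (\<iota> (snd g) - \<iota> (snd h))) / (real n + 1)"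
    have e: "\<epsilon> > 0" using gh by (simp add: \<epsilon>_def)
    have "box_nbhd n g \<epsilon> \<subseteq> D k"
    proof
      fix g' assume g': "g' \<in> box_nbhd n g \<epsilon>"
      have "norm (\<iota> (snd g') - \<iota> (snd g)) \<le> (\<Sum>i<n. \<bar>vec_index (snd g') i - vec_index (snd g) i\<bar>)" by (rule \<iota>_norm_le)
      also have "\<dots> \<le> (\<Sum>i<n. \<epsilon>)" using g' by (intro sum_mono) (auto simp: box_nbhd_def less_imp_le)
      also have "\<dots> = real n * \<epsilon>" by simp
      also have "\<dots> < (real n + 1) * \<epsilon>" using e by simp
      also have "\<dots> = real k - norm (\<iota> (snd g) - \<iota> (snd h))" by (simp add: \<epsilon>_def)
      finally have "norm (\<iota> (snd g') - \<iota> (snd h)) < real k"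
        using norm_triangle_ineq[of "\<iota> (snd g') - \<iota> (snd g)" "\<iota> (snd g) - \<iota> (snd h)"] by simp
      thus "g' \<in> D k" using g' gh(2) by (auto simp: D_def box_nbhd_def)
    qed
    moreover have "g \<in> box_nbhd n g \<epsilon>" using gh e by (simp add: box_nbhd_def)
    ultimately show "\<exists>T. openin ?X T \<and> g \<in> T \<and> T \<subseteq> D k" using openin_box_nbhd by blast
  qed
  have D_inv: "c \<otimes>\<^bsub>?I\<^esub> g \<in> D k" if c: "c \<in> \<Gamma>" and g: "g \<in> D k" for c g k
  proof -
    obtain h where h: "g \<in> carrier ?I" "h \<in> \<Gamma>" "norm (\<iota> (snd g) - \<iota> (snd h)) < real k" using g by (auto simp: D_def)
    obtain A v B w C u where eq: "g = (A, v)" "h = (B, w)" "c = (C, u)" by (cases g, cases h, cases c)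
    have car: "v \<in> carrier_vec n" "w \<in> carrier_vec n" "u \<in> carrier_vec n" "C \<in> orthogonal_group_carrier n" "C \<in> carrier_mat n n"
      using h \<Gamma>c[OF c] \<Gamma>c[OF h(2)] by (auto simp: eq isometry_group_simps orthogonal_group_carrier_def)
    have "\<iota> (u + C *\<^sub>v v) - \<iota> (u + C *\<^sub>v w) = lin C (\<iota> v - \<iota> w)"
      using car by (simp add: \<iota>_add lin_apply blinfun.diff_right)
    moreover have "norm (lin C (\<iota> v - \<iota> w)) = norm (\<iota> v - \<iota> w)"
    proof -
      have d: "\<iota> v - \<iota> w = \<iota> (v - w)" "v - w \<in> carrier_vec n" using car by (simp_all add: \<iota>_diff)
      show ?thesis unfolding norm_eq_sqrt_inner lin_inner[OF car(4)] d(1) using d(2) by (simp add: \<iota>_inner)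
    qed
    ultimately have "norm (\<iota> (snd (c \<otimes>\<^bsub>?I\<^esub> g)) - \<iota> (snd (c \<otimes>\<^bsub>?I\<^esub> h))) < real k"
      using h(3) by (simp add: eq isometry_group_simps)
    moreover have "c \<otimes>\<^bsub>?I\<^esub> h \<in> \<Gamma>" using \<Gamma> c h(2) by (rule subgroup.m_closed)
    moreover have "c \<otimes>\<^bsub>?I\<^esub> g \<in> carrier ?I" using \<Gamma>c[OF c] h(1) by (rule I.m_closed)
    ultimately show ?thesis unfolding D_def by blast
  qed
  \<comment> \<open>\<open>D k\<close> is a union of cosets, hence the full preimage of its image;
    this is what makes the image open in the quotient.\<close>
  have D_sat: "g \<in> D k" if g: "g \<in> carrier ?I" "?q g \<in> ?q ` D k" for g k
  proof -
    obtain h where h: "h \<in> D k" "?q g = ?q h" using g(2) by blast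
    have "g \<in> ?q h" using I.rcos_self[OF g(1) \<Gamma>] h(2) by simp
    then obtain c where "c \<in> \<Gamma>" "g = c \<otimes>\<^bsub>?I\<^esub> h" by (auto simp: r_coset_def)
    thus ?thesis using D_inv h(1) by blast
  qed
  have Dc: "D k \<subseteq> carrier ?I" for k by (auto simp: D_def)
  have top: "topspace ?X = carrier ?I" by (rule topspace_isometry_topology)
  have qtop: "?q ` carrier ?I = topspace Q" 
    by (rule conjunct1[OF Q(1)[unfolded quotient_map_def top]])
  have "openin Q (?q ` D k)" for k
  proof -
    have "?q ` D k \<subseteq> topspace Q" unfolding qtop[symmetric] by (rule image_mono[OF Dc])
    from conjunct2[OF Q(1)[unfolded quotient_map_def], rule_format, OF this]
    have "openin ?X {x \<in> topspace ?X. ?q x \<in> ?q ` D k} \<longleftrightarrow> openin Q (?q ` D k)" .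
    moreover have "{x \<in> topspace ?X. ?q x \<in> ?q ` D k} = D k"
    proof (rule Set.set_eqI)
      fix g
      show "g \<in> {x \<in> topspace ?X. ?q x \<in> ?q ` D k} \<longleftrightarrow> g \<in> D k"
        unfolding top mem_Collect_eq
      proof
        assume "g \<in> carrier ?I \<and> ?q g \<in> ?q ` D k"
        thus "g \<in> D k" by (intro D_sat) (erule conjunct1, erule conjunct2)
      next
        assume g: "g \<in> D k"
        show "g \<in> carrier ?I \<and> ?q g \<in> ?q ` D k" by (rule conjI[OF subsetD[OF Dc g] imageI[OF g]])
      qed
    qed
    ultimately show ?thesis using D_open[of k] by (simp only: simp_thms)
  qed
  moreover have "topspace Q \<subseteq> \<Union> (range (\<lambda>k. ?q ` D k))"
  proof
    fix y assume "y \<in> topspace Q"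
    then obtain g where g: "g \<in> carrier ?I" "y = ?q g" using qtop by blast
    obtain k :: nat where "norm (\<iota> (snd g) - \<iota> (snd \<one>\<^bsub>?I\<^esub>)) < real k" using reals_Archimedean2 by blast
    hence "g \<in> D k" using g(1) subgroup.one_closed[OF \<Gamma>] unfolding D_def by blast
    thus "y \<in> \<Union> (range (\<lambda>k. ?q ` D k))" using g(2) by blast
  qed
  moreover have "compactin Q (topspace Q)" using Q(2) by (simp add: compact_space_def)
  ultimately obtain \<F> where F: "finite \<F>" "\<F> \<subseteq> range (\<lambda>k. ?q ` D k)" "topspace Q \<subseteq> \<Union>\<F>"
    using compactinD[of Q "topspace Q" "range (\<lambda>k. ?q ` D k)"] by blast
  obtain K where K: "finite K" "\<F> = (\<lambda>k. ?q ` D k) ` K"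
    using finite_subset_image[OF F(1,2)] by blast
  have mono: "D k \<subseteq> D (Max K)" if "k \<in> K" for k
  proof -
    have "real k \<le> real (Max K)" using K(1) that by simp
    show ?thesis
    proof
      fix g assume "g \<in> D k"
      then obtain h where h: "g \<in> carrier ?I" "h \<in> \<Gamma>" "norm (\<iota> (snd g) - \<iota> (snd h)) < real k" by (auto simp: D_def)
      have "norm (\<iota> (snd g) - \<iota> (snd h)) < real (Max K)" using h(3) \<open>real k \<le> real (Max K)\<close> by linarith
      thus "g \<in> D (Max K)" using h(1,2) unfolding D_def by blast
    qed
  qed
  have all: "g \<in> D (Max K)" if g: "g \<in> carrier ?I" for g
  proof (rule D_sat[OF g])
    have "?q g \<in> \<Union>\<F>" using F(3) qtop g by blast
    then obtain k where "k \<in> K" "?q g \<in> ?q ` D k" using K(2) by blast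
    thus "?q g \<in> ?q ` D (Max K)" using mono by blast
  qed
  show ?thesis
  proof (intro exI[of _ "real (Max K)"] ballI)
    fix v :: "real Matrix.vec" assume v: "v \<in> carrier_vec n"
    have "(1\<^sub>m n, v) \<in> carrier ?I" using v by (simp add: isometry_group_simps orthogonal_group_carrier_def)
    from all[OF this] obtain h where "h \<in> \<Gamma>" "norm (\<iota> v - \<iota> (snd h)) < real (Max K)" by (auto simp: D_def)
    thus "\<exists>h\<in>\<Gamma>. norm (\<iota> (snd h) - \<iota> v) \<le> real (Max K)" by (auto simp: norm_minus_commute intro: less_imp_le)
  qed
qed


lemma (in coordinates) lin_eq_one:
  assumes A: "A \<in> carrier_mat n n" and eq: "lin A = lin (1\<^sub>m n)"
  shows "A = 1\<^sub>m n"
proof (rule eq_matI)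
  fix i j assume "i < dim_row (1\<^sub>m n :: real mat)" "j < dim_col (1\<^sub>m n :: real mat)"
  hence ij: "i < n" "j < n" by simp_all
  have "vec_index (M *\<^sub>v \<pi> (e j)) i = M $$ (i, j)" if M: "M \<in> carrier_mat n n" for M
  proof -
    have "\<pi> (e j) = unit_vec n j" by (rule eq_vecI) (auto simp: \<pi>_def e_inner ij(2))
    thus ?thesis using M ij by simp
  qed
  moreover have "lin A (e j) \<bullet> e i = lin (1\<^sub>m n) (e j) \<bullet> e i" by (simp only: eq)
  ultimately show "A $$ (i, j) = 1\<^sub>m n $$ (i, j)"
    using A ij by (simp only: lin_apply one_carrier_mat \<iota>_inner_e)
qed (use A in auto)

text \<open>Converts the operator norm to entries, so that the box given by discreteness serves as a
  radius for the abstract action.\<close>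

lemma (in coordinates) lin_entry:
  assumes A: "A \<in> carrier_mat n n" and ij: "i < n" "j < n"
  shows "\<bar>A $$ (i, j) - (1\<^sub>m n) $$ (i, j)\<bar> \<le> norm (lin A - lin (1\<^sub>m n))"
proof -
  have entry: "lin M (e j) \<bullet> e i = M $$ (i, j)" if M: "M \<in> carrier_mat n n" for M
  proof -
    have "\<pi> (e j) = unit_vec n j" by (rule eq_vecI) (auto simp: \<pi>_def e_inner ij(2))
    thus ?thesis using M ij by (simp add: lin_apply \<iota>_inner_e)
  qed
  have nb: "e i \<in> Basis" "e j \<in> Basis" using basis ij by auto
  have "A $$ (i, j) - (1\<^sub>m n) $$ (i, j) = (lin A - lin (1\<^sub>m n)) (e j) \<bullet> e i"
    unfolding entry[OF A, symmetric] entry[OF one_carrier_mat, symmetric] by (simp only: blinfun.diff_left inner_diff_left)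
  hence "\<bar>A $$ (i, j) - (1\<^sub>m n) $$ (i, j)\<bar> \<le> norm ((lin A - lin (1\<^sub>m n)) (e j))"
    using Basis_le_norm[OF nb(1), of "(lin A - lin (1\<^sub>m n)) (e j)"] by (simp only:)
  also have "\<dots> \<le> norm (lin A - lin (1\<^sub>m n)) * norm (e j)" by (rule norm_blinfun)
  finally show ?thesis using nb by simp
qed

theorem Bieberbach_diffuse_low_dimension:
  assumes n: "n \<le> 4" and B: "Bieberbach_group n \<Gamma>"
    and no: "\<not> contains_subgroup_isomorphic ((isometry_group n)\<lparr>carrier := \<Gamma>\<rparr>) Hantzsche_Wendt_group"
  shows "diffuse_group ((isometry_group n)\<lparr>carrier := \<Gamma>\<rparr>)"
proof -
  let ?I = "isometry_group n"
  let ?G = "?I\<lparr>carrier := \<Gamma>\<rparr>"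
  have \<Gamma>: "subgroup \<Gamma> ?I" and disc: "discrete_in_isometries n \<Gamma>" and coco: "cocompact_in_isometries n \<Gamma>"
    and tf: "torsion_free_group ?G"
    using B by (simp_all add: Bieberbach_group_def crystallographic_group_def)
  interpret I: group ?I by (rule group_isometry_group)
  interpret G: group ?G by (rule I.subgroup_imp_group[OF \<Gamma>])
  have \<Gamma>c: "\<Gamma> \<subseteq> carrier ?I" using \<Gamma> by (rule subgroup.subset)
  \<comment> \<open>\<open>complex \<times> complex\<close> serves as the Euclidean space of
    dimension 4.\<close>
  have card4: "card (Basis :: (complex \<times> complex) set) = 4" by (simp add: DIM_prod)
  have "finite (Basis :: (complex \<times> complex) set)" by simp
  from ex_bij_betw_nat_finite[OF this] obtain e :: "nat \<Rightarrow> complex \<times> complex" where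
    e: "bij_betw e {0..<4} Basis" unfolding card4 ..
  have co: "coordinates n e"
  proof
    have "{..<n} \<subseteq> {0..<4}" using n by auto
    thus "inj_on e {..<n}" "e ` {..<n} \<subseteq> Basis"
      using e unfolding bij_betw_def by (auto intro: inj_on_subset)
  qed
  interpret coordinates n e by (rule co)
  define \<rho> where "\<rho> g = lin (fst g)" for g :: "real mat \<times> real Matrix.vec"
  define \<tau> where "\<tau> g = \<iota> (snd g)" for g :: "real mat \<times> real Matrix.vec"
  have one: "\<one>\<^bsub>?G\<^esub> = (1\<^sub>m n, 0\<^sub>v n)" by (simp add: isometry_group_simps)
  have car: "fst g \<in> orthogonal_group_carrier n" "fst g \<in> carrier_mat n n" "snd g \<in> carrier_vec n" if "g \<in> \<Gamma>" for g
    using that \<Gamma>c by (auto simp: isometry_group_simps orthogonal_group_carrier_def)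
  have \<rho>1: "\<rho> \<one>\<^bsub>?G\<^esub> = lin (1\<^sub>m n)" by (simp only: one \<rho>_def fst_conv)
  have \<rho>1': "\<rho> \<one>\<^bsub>?I\<^esub> = lin (1\<^sub>m n)" using \<rho>1 by simp
  have mult: "g \<otimes>\<^bsub>?I\<^esub> h = (fst g * fst h, snd g + fst g *\<^sub>v snd h)" for g h
    by (cases g; cases h) (simp add: isometry_group_simps)
  interpret A: isometric_action ?G \<rho> \<tau>
  proof
    fix g h assume "g \<in> carrier ?G" "h \<in> carrier ?G"
    hence gh: "g \<in> \<Gamma>" "h \<in> \<Gamma>" by simp_all
    note c = car[OF gh(1)] car[OF gh(2)]
    show "\<rho> (g \<otimes>\<^bsub>?G\<^esub> h) = \<rho> g o\<^sub>L \<rho> h"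
    proof (rule blinfun_eqI)
      fix x
      have "fst g * fst h *\<^sub>v \<pi> x = fst g *\<^sub>v (fst h *\<^sub>v \<pi> x)"
        by (rule assoc_mult_mat_vec[of _ n n _ n]) (use c in auto)
      thus "\<rho> (g \<otimes>\<^bsub>?G\<^esub> h) x = (\<rho> g o\<^sub>L \<rho> h) x" using c by (simp add: mult \<rho>_def lin_apply)
    qed
    show "\<tau> (g \<otimes>\<^bsub>?G\<^esub> h) = \<tau> g + \<rho> g (\<tau> h)"
      using c by (simp add: mult \<tau>_def \<rho>_def lin_apply \<iota>_add)
  next
    fix g v w assume "g \<in> carrier ?G"
    hence "\<rho> g v \<bullet> \<rho> g w = scalar_prod (\<pi> v) (\<pi> w)" using car(1)[of g] by (simp add: \<rho>_def lin_inner)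
    also have "\<dots> = \<rho> \<one>\<^bsub>?G\<^esub> v \<bullet> w" by (simp only: \<rho>1 lin_apply[OF one_carrier_mat] \<iota>_inner one_mult_mat_vec \<pi>_carrier)
    finally show "\<rho> g v \<bullet> \<rho> g w = \<rho> \<one>\<^bsub>?G\<^esub> v \<bullet> w" .
  next
    fix g assume "g \<in> carrier ?G"
    thus "\<rho> \<one>\<^bsub>?G\<^esub> (\<tau> g) = \<tau> g" using car(3)[of g] by (simp add: \<tau>_def \<rho>1' lin_apply)
  qed
  obtain \<epsilon> where eps: "\<epsilon> > 0" "box_nbhd n \<one>\<^bsub>?G\<^esub> \<epsilon> \<inter> \<Gamma> \<subseteq> {\<one>\<^bsub>?G\<^esub>}"
  proof -
    have "\<one>\<^bsub>?G\<^esub> \<in> \<Gamma>" using G.one_closed by simp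
    from bspec[OF disc[unfolded discrete_in_isometries_iff[OF \<Gamma>c]] this] show thesis using that by blast
  qed
  have discrete: "g = \<one>\<^bsub>?G\<^esub>" if g: "g \<in> carrier ?G" "A.rot g < \<epsilon>" "norm (\<tau> g) < \<epsilon>" for g
  proof -
    have gG: "g \<in> \<Gamma>" using g by simp
    note c = car[OF gG]
    have rot: "norm (lin (fst g) - lin (1\<^sub>m n)) < \<epsilon>" using g(2) by (simp only: A.rot_def \<rho>_def one fst_conv)
    have "\<bar>fst g $$ (i, j) - (1\<^sub>m n) $$ (i, j)\<bar> < \<epsilon>" if "i < n" "j < n" for i j
      using lin_entry[OF c(2) that] rot by (rule le_less_trans)
    moreover have "\<bar>vec_index (snd g) i - vec_index (0\<^sub>v n) i\<bar> < \<epsilon>" if i: "i < n" for i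
    proof -
      have "e i \<in> Basis" using basis i by auto
      from Basis_le_norm[OF this, of "\<tau> g"] have "\<bar>vec_index (snd g) i\<bar> \<le> norm (\<tau> g)" by (simp add: \<tau>_def \<iota>_inner_e i)
      thus ?thesis using g(3) i by simp
    qed
    ultimately have "g \<in> box_nbhd n \<one>\<^bsub>?G\<^esub> \<epsilon>" using gG \<Gamma>c unfolding box_nbhd_def one by auto
    thus ?thesis using eps(2) gG by blast
  qed
  obtain R where R: "\<And>v. v \<in> carrier_vec n \<Longrightarrow> \<exists>h\<in>\<Gamma>. norm (\<iota> (snd h) - \<iota> v) \<le> R"
    using cocompact_covering[OF co \<Gamma> coco] by blast
  have cocompact: "\<exists>h\<in>carrier ?G. norm (\<tau> h - v) \<le> R" if "\<rho> \<one>\<^bsub>?G\<^esub> v = v" for v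
  proof -
    have "\<iota> (\<pi> v) = v" using that unfolding \<rho>1 lin_apply[OF one_carrier_mat] by simp
    thus ?thesis using R[of "\<pi> v"] by (simp add: \<tau>_def)
  qed
  interpret D: discrete_isometries ?G \<rho> \<tau>
  proof
    show "torsion_free_group ?G" by (rule tf)
    show "finite (\<rho> ` carrier ?G)" by (rule A.Bieberbach_finite_holonomy[OF eps(1) discrete cocompact])
    show "g = \<one>\<^bsub>?G\<^esub>" if "g \<in> carrier ?G" "\<rho> g = \<rho> \<one>\<^bsub>?G\<^esub>" "\<tau> g = 0" for g
      by (rule discrete) (use that eps(1) in \<open>simp_all only: A.rot_def right_minus_eq norm_zero simp_thms diff_self\<close>)
    show "\<exists>\<epsilon>>0. \<forall>g\<in>carrier ?G. \<rho> g = \<rho> \<one>\<^bsub>?G\<^esub> \<longrightarrow> norm (\<tau> g) < \<epsilon> \<longrightarrow> \<tau> g = 0"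
    proof (intro exI[of _ \<epsilon>] conjI ballI impI eps(1))
      fix g assume g: "g \<in> carrier ?G" "\<rho> g = \<rho> \<one>\<^bsub>?G\<^esub>" "norm (\<tau> g) < \<epsilon>"
      have "A.rot g < \<epsilon>" using eps(1) by (simp only: A.rot_def g(2) diff_self norm_zero)
      from discrete[OF g(1) this g(3)] show "\<tau> g = 0" by (simp only: A.\<tau>_one)
    qed
    have "dim (range (\<rho> \<one>\<^bsub>?G\<^esub>)) \<le> DIM(complex \<times> complex)" by (rule dim_subset_UNIV)
    thus "dim (range (\<rho> \<one>\<^bsub>?G\<^esub>)) \<le> 4" unfolding card4 .
  qed
  have no_pair: "\<nexists>x y. HW_pair ?G x y \<and> x \<noteq> \<one>\<^bsub>?G\<^esub> \<and> y \<noteq> \<one>\<^bsub>?G\<^esub>"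
    using HW_pair.contains_Hantzsche_Wendt_group[OF _ tf] no by blast
  have "diffuse_group (?G\<lparr>carrier := carrier ?G\<rparr>)" by (rule D.subgroup_diffuse[OF no_pair G.subgroup_self])
  thus ?thesis by simp
qed

section \<open>A five-dimensional group\<close>

text \<open>\<open>sg k\<close> is the \<open>k\<close>-th power of -1, and \<open>co k\<close>,
  \<open>si k\<close> are the cosine and sine of \<open>k\<close> right angles, as integers.\<close>

definition sg :: "int \<Rightarrow> int" where "sg k = (if even k then 1 else - 1)"
definition co :: "int \<Rightarrow> int" where "co k = (if k mod 4 = 0 then 1 else if k mod 4 = 2 then - 1 else 0)"
definition si :: "int \<Rightarrow> int" where "si k = (if k mod 4 = 1 then 1 else if k mod 4 = 3 then - 1 else 0)"

lemma mod4_cases: "k mod 4 = 0 \<or> k mod 4 = 1 \<or> k mod 4 = 2 \<or> k mod 4 = (3::int)" by presburger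

lemma sg_add: "sg (k + l) = sg k * sg l" by (simp add: sg_def)

lemma sg_square [simp]: "sg k * sg k = 1" "sg k * (sg k * x) = x" by (simp_all add: sg_def)

lemma co_si_add: "co (k + l) = co k * co l - si k * si l" "si (k + l) = si k * co l + co k * si l"
proof -
  have "(k + l) mod 4 = (k mod 4 + l mod 4) mod 4" by (simp add: mod_add_eq)
  thus "co (k + l) = co k * co l - si k * si l" "si (k + l) = si k * co l + co k * si l"
    unfolding co_def si_def using mod4_cases[of k] mod4_cases[of l] by (elim disjE; simp)+
qed

lemma co_si_minus: "sg (- k) = sg k" "co (- k) = co k" "si (- k) = - si k"
proof -
  have "(- k) mod 4 = (- (k mod 4)) mod 4" by (simp add: mod_minus_eq)
  thus "co (- k) = co k" "si (- k) = - si k"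
    unfolding co_def si_def using mod4_cases[of k] by (elim disjE; simp)+
qed (simp add: sg_def)

lemma sg_co_si_zero: "sg 0 = 1" "co 0 = 1" "si 0 = 0" by (simp_all add: sg_def co_def si_def)

text \<open>The holonomy is generated by \<open>diag(-1, 1, -1, J)\<close> and \<open>diag(1, -1, -1, 1, 1)\<close>, with \<open>J\<close> the
  rotation by a right angle. All translation parts are measured in quarters.\<close>

definition hol_entry :: "int \<Rightarrow> int \<Rightarrow> nat \<Rightarrow> nat \<Rightarrow> int" where
  "hol_entry k e i j = [[sg k, 0, 0, 0, 0], [0, sg e, 0, 0, 0], [0, 0, sg (k + e), 0, 0],
     [0, 0, 0, co k, - si k], [0, 0, 0, si k, co k]] ! i ! j"

definition hol :: "int \<Rightarrow> int \<Rightarrow> real mat" where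
  "hol k e = Matrix.mat 5 5 (\<lambda>(i, j). of_int (hol_entry k e i j))"

definition transl :: "int \<Rightarrow> int \<Rightarrow> int \<Rightarrow> int \<Rightarrow> int \<Rightarrow> real Matrix.vec" where
  "transl a b c d f = Matrix.vec 5 (\<lambda>i. of_int ([a, b, c, d, f] ! i) / 4)"

text \<open>The exponents \<open>k\<close> and \<open>e\<close> of the two holonomy generators count
  only modulo 4 and 2; as integers they simply add up under multiplication.\<close>

definition el where "el k e a b c d f = (hol k e, transl a b c d f)"

lemma less_5: "i < 5 \<longleftrightarrow> i = 0 \<or> i = 1 \<or> i = 2 \<or> i = 3 \<or> i = (4::nat)" by auto

lemma all_less_5: "(\<forall>i<5. P i) \<longleftrightarrow> P 0 \<and> P 1 \<and> P 2 \<and> P 3 \<and> P (4::nat)"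
  unfolding less_5 by auto

lemma sum_5: "sum F {0..<5::nat} = F 0 + F 1 + F 2 + F 3 + F 4" for F :: "nat \<Rightarrow> 'b::comm_monoid_add"
  by (simp add: eval_nat_numeral)

lemma hol_entry_mult:
  assumes "i < 5" "j < 5"
  shows "(\<Sum>l\<in>{0..<5}. hol_entry k e i l * hol_entry k' e' l j) = hol_entry (k + k') (e + e') i j"
proof -
  have 1: "sg (k + k' + (e + e')) = sg (k + e) * sg (k' + e')" by (simp only: sg_add mult_ac)
  show ?thesis
    unfolding sum_5 using assms unfolding less_5
    by (elim disjE) (simp_all add: hol_entry_def sg_add[of k k'] sg_add[of e e'] 1 co_si_add)
qed

lemma hol_carrier [simp]: "hol k e \<in> carrier_mat 5 5" "dim_row (hol k e) = 5" "dim_col (hol k e) = 5"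
  by (simp_all add: hol_def)

lemma hol_index: "i < 5 \<Longrightarrow> j < 5 \<Longrightarrow> hol k e $$ (i, j) = of_int (hol_entry k e i j)"
  by (simp add: hol_def)

lemma hol_mult: "hol k e * hol k' e' = hol (k + k') (e + e')"
proof (rule eq_matI)
  fix i j assume "i < dim_row (hol (k + k') (e + e'))" "j < dim_col (hol (k + k') (e + e'))"
  hence ij: "i < 5" "j < 5" by simp_all
  have "(hol k e * hol k' e') $$ (i, j) = (\<Sum>l\<in>{0..<5}. hol k e $$ (i, l) * hol k' e' $$ (l, j))"
    using ij by (simp add: scalar_prod_def)
  also have "\<dots> = (\<Sum>l\<in>{0..<5}. of_int (hol_entry k e i l * hol_entry k' e' l j))"
    by (rule sum.cong) (use ij in \<open>simp_all add: hol_index\<close>)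
  also have "\<dots> = hol (k + k') (e + e') $$ (i, j)"
    unfolding of_int_sum[symmetric] hol_entry_mult[OF ij] hol_index[OF ij] ..
  finally show "(hol k e * hol k' e') $$ (i, j) = hol (k + k') (e + e') $$ (i, j)" .
qed simp_all

lemma hol_zero: "hol 0 0 = 1\<^sub>m 5"
  by (rule eq_matI) (auto simp: hol_def hol_entry_def less_5 sg_co_si_zero)

lemma hol_transpose: "transpose_mat (hol k e) = hol (- k) (- e)"
proof (rule eq_matI)
  fix i j assume "i < dim_row (hol (- k) (- e))" "j < dim_col (hol (- k) (- e))"
  hence ij: "i < 5" "j < 5" by simp_all
  have "sg (- k - e) = sg (k + e)" by (simp add: sg_def)
  thus "transpose_mat (hol k e) $$ (i, j) = hol (- k) (- e) $$ (i, j)"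
    using ij unfolding less_5
    by (elim disjE) (simp_all add: hol_index hol_entry_def co_si_minus)
qed simp_all

lemma hol_orthogonal: "hol k e \<in> orthogonal_group_carrier 5"
  by (simp add: orthogonal_group_carrier_def hol_transpose hol_mult hol_zero)

lemma hol_transl:
  "transl a b c d f + hol k e *\<^sub>v transl a' b' c' d' f' =
     transl (a + sg k * a') (b + sg e * b') (c + sg (k + e) * c') (d + (co k * d' - si k * f')) (f + (si k * d' + co k * f'))"
proof (rule eq_vecI)
  fix i assume "i < dim_vec (transl (a + sg k * a') (b + sg e * b') (c + sg (k + e) * c') (d + (co k * d' - si k * f')) (f + (si k * d' + co k * f')))"
  hence i: "i < 5" by (simp add: transl_def)
  have "vec_index (hol k e *\<^sub>v transl a' b' c' d' f') i = (\<Sum>l\<in>{0..<5}. hol k e $$ (i, l) * vec_index (transl a' b' c' d' f') l)"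
    using i by (simp add: scalar_prod_def transl_def)
  also have "\<dots> = (\<Sum>l\<in>{0..<5}. of_int (hol_entry k e i l * [a', b', c', d', f'] ! l) / 4)"
    by (rule sum.cong) (use i in \<open>simp_all add: hol_index transl_def\<close>)
  finally have "vec_index (hol k e *\<^sub>v transl a' b' c' d' f') i = of_int (\<Sum>l\<in>{0..<5}. hol_entry k e i l * [a', b', c', d', f'] ! l) / 4"
    by (simp add: sum_divide_distrib)
  thus "vec_index (transl a b c d f + hol k e *\<^sub>v transl a' b' c' d' f') i
      = vec_index (transl (a + sg k * a') (b + sg e * b') (c + sg (k + e) * c') (d + (co k * d' - si k * f')) (f + (si k * d' + co k * f'))) i"
    using i unfolding sum_5 unfolding less_5
    by (elim disjE) (simp_all add: transl_def hol_entry_def field_simps)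
qed (simp add: transl_def)

lemma el_mult:
  "el k e a b c d f \<otimes>\<^bsub>isometry_group 5\<^esub> el k' e' a' b' c' d' f' =
     el (k + k') (e + e') (a + sg k * a') (b + sg e * b') (c + sg (k + e) * c')
       (d + (co k * d' - si k * f')) (f + (si k * d' + co k * f'))"
  by (simp add: el_def isometry_group_simps hol_mult hol_transl)

lemma el_one: "\<one>\<^bsub>isometry_group 5\<^esub> = el 0 0 0 0 0 0 0"
proof -
  have "transl 0 0 0 0 0 = 0\<^sub>v 5" by (rule eq_vecI) (auto simp: transl_def less_5)
  thus ?thesis by (simp add: el_def isometry_group_simps hol_zero)
qed

lemma el_carrier: "el k e a b c d f \<in> carrier (isometry_group 5)"
  by (simp add: el_def isometry_group_simps hol_orthogonal transl_def)

lemma hol_eq_iff: "hol k e = hol k' e' \<longleftrightarrow> k mod 4 = k' mod 4 \<and> e mod 2 = e' mod 2"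
proof
  assume eq: "hol k e = hol k' e'"
  have "of_int (hol_entry k e i j) = (of_int (hol_entry k' e' i j) :: real)" if "i < 5" "j < 5" for i j
    using arg_cong[OF eq, of "\<lambda>A. A $$ (i, j)"] that by (simp only: hol_index)
  note entry = this
  have "sg e = sg e'" using entry[of 1 1] by (simp add: hol_entry_def)
  hence "e mod 2 = e' mod 2" unfolding sg_def mod2_eq_if by (simp split: if_splits)
  moreover have "co k = co k'" "si k = si k'" using entry[of 3 3] entry[of 4 3] by (simp_all add: hol_entry_def)
  hence "k mod 4 = k' mod 4"
    unfolding co_def si_def using mod4_cases[of k] mod4_cases[of k'] by (elim disjE) simp_all
  ultimately show "k mod 4 = k' mod 4 \<and> e mod 2 = e' mod 2" by (rule conjI[rotated])
next
  assume eq: "k mod 4 = k' mod 4 \<and> e mod 2 = e' mod 2"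
  hence "even e = even e'" "even k = even k'" by presburger+
  hence "sg e = sg e'" "sg k = sg k'" "sg (k + e) = sg (k' + e')" "co k = co k'" "si k = si k'"
    using eq by (simp_all add: sg_def co_def si_def)
  hence "hol_entry k e = hol_entry k' e'" by (simp add: hol_entry_def fun_eq_iff)
  thus "hol k e = hol k' e'" by (simp add: hol_def)
qed

lemma transl_eq_iff:
  "transl a b c d f = transl a' b' c' d' f' \<longleftrightarrow> a = a' \<and> b = b' \<and> c = c' \<and> d = d' \<and> f = f'"
proof
  assume eq: "transl a b c d f = transl a' b' c' d' f'"
  have "real_of_int ([a, b, c, d, f] ! i) / 4 = of_int ([a', b', c', d', f'] ! i) / 4" if "i < 5" for i
    using arg_cong[OF eq, of "\<lambda>v. vec_index v i"] that by (simp add: transl_def)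
  from this[of 0] this[of 1] this[of 2] this[of 3] this[of 4]
  show "a = a' \<and> b = b' \<and> c = c' \<and> d = d' \<and> f = f'" by simp
qed simp

lemma el_eq_iff:
  "el k e a b c d f = el k' e' a' b' c' d' f' \<longleftrightarrow>
     k mod 4 = k' mod 4 \<and> e mod 2 = e' mod 2 \<and> a = a' \<and> b = b' \<and> c = c' \<and> d = d' \<and> f = f'"
  by (simp add: el_def hol_eq_iff transl_eq_iff)

text \<open>The lattice consists of the integer vectors and their shifts by
  \<open>(0, 1/2, 1/2, 1/2, 1/2)\<close>; \<open>(b - k) / 2\<close> counts such shifts. Over the
  two holonomy generators lie the translations \<open>(0, 1/4, 1/4, 0, 0)\<close> and
  \<open>(1/2, 0, 0, 1/2, 0)\<close>. An odd \<open>k\<close> turns the fourth coordinate of the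
  latter into the fifth, whence the factors with \<open>k mod 2\<close>.\<close>

definition admissible where
  "admissible k e a b c d f \<longleftrightarrow> 4 dvd a - 2 * e \<and> 2 dvd b - k \<and> 4 dvd c - k mod 2 - (b - k) \<and>
     4 dvd d - 2 * e * (1 - k mod 2) - (b - k) \<and> 4 dvd f - 2 * e * (k mod 2) - (b - (k::int))"

definition example_group where
  "example_group = {el k e a b c d f |k e a b c d f. admissible k e a b c d f}"

text \<open>With explicit quotients for all divisibilities, splitting by residues leaves polynomial
  identities. The split concerns \<open>k\<close> modulo 4 and \<open>k'\<close>, \<open>e\<close>
  modulo 2, while \<open>e'\<close> enters linearly and stays symbolic.\<close>

lemma admissible_mult:
  assumes "admissible k e a b c d f" "admissible k' e' a' b' c' d' f'"
  shows "admissible (k + k') (e + e') (a + sg k * a') (b + sg e * b') (c + sg (k + e) * c')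
       (d + (co k * d' - si k * f')) (f + (si k * d' + co k * f'))"
proof -
  obtain x1 x2 x3 x4 x5 where x: "a - 2 * e = 4 * x1" "b - k = 2 * x2" "c - k mod 2 - (b - k) = 4 * x3"
    "d - 2 * e * (1 - k mod 2) - (b - k) = 4 * x4" "f - 2 * e * (k mod 2) - (b - k) = 4 * x5"
    using assms(1) unfolding admissible_def by (elim conjE dvdE)
  obtain y1 y2 y3 y4 y5 where y: "a' - 2 * e' = 4 * y1" "b' - k' = 2 * y2" "c' - k' mod 2 - (b' - k') = 4 * y3"
    "d' - 2 * e' * (1 - k' mod 2) - (b' - k') = 4 * y4" "f' - 2 * e' * (k' mod 2) - (b' - k') = 4 * y5"
    using assms(2) unfolding admissible_def by (elim conjE dvdE)
  have X: "a = 2 * e + 4 * x1" "b = k + 2 * x2" "c = k mod 2 + 2 * x2 + 4 * x3"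
    "d = 2 * e * (1 - k mod 2) + 2 * x2 + 4 * x4" "f = 2 * e * (k mod 2) + 2 * x2 + 4 * x5" using x by linarith+
  have Y: "a' = 2 * e' + 4 * y1" "b' = k' + 2 * y2" "c' = k' mod 2 + 2 * y2 + 4 * y3"
    "d' = 2 * e' * (1 - k' mod 2) + 2 * y2 + 4 * y4" "f' = 2 * e' * (k' mod 2) + 2 * y2 + 4 * y5" using y by linarith+
  obtain m i where k: "k = 4 * m + i" and i: "i = 0 \<or> i = 1 \<or> i = 2 \<or> i = 3"
    using mod4_cases[of k] mult_div_mod_eq[of 4 k] by metis
  obtain m' i' where k': "k' = 2 * m' + i'" and i': "i' = 0 \<or> i' = 1"
    by (metis mult_div_mod_eq mod2_eq_if)
  obtain n j where e: "e = 2 * n + j" and j: "j = 0 \<or> j = 1"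
    by (metis mult_div_mod_eq mod2_eq_if)
  have mods: "(4 * m + i) mod 4 = i mod 4" "(4 * m + i) mod 2 = i mod 2" "(2 * m' + i') mod 2 = i' mod 2"
    "(4 * m + i + (2 * m' + i')) mod 2 = (i + i') mod 2" "even (4 * m + i) = even i" "even (2 * n + j) = even j"
    "even (4 * m + i + (2 * n + j)) = even (i + j)"
    by presburger+
  show ?thesis
    unfolding admissible_def X Y k k' e sg_def co_def si_def mods
    using i i' j by (elim disjE; simp; intro conjI; algebra)
qed

lemma example_groupI: "admissible k e a b c d f \<Longrightarrow> el k e a b c d f \<in> example_group"
  unfolding example_group_def by blast

lemma example_groupE:
  assumes "g \<in> example_group"
  obtains k e a b c d f where "g = el k e a b c d f" "admissible k e a b c d f"
  using assms unfolding example_group_def by blast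

lemma example_group_carrier: "example_group \<subseteq> carrier (isometry_group 5)"
  unfolding example_group_def using el_carrier by blast

lemma el_inv:
  "inv\<^bsub>isometry_group 5\<^esub> (el k e a b c d f) =
     el (- k) (- e) (- sg k * a) (- sg e * b) (- sg (k + e) * c) (- co k * d - si k * f) (si k * d - co k * f)"
proof (rule group.inv_equality[OF group_isometry_group])
  have "sg (- k - e) = sg (k + e)" by (simp add: sg_def)
  moreover have "co (- k) * d - si (- k) * f = co k * d + si k * f" "si (- k) * d + co (- k) * f = - si k * d + co k * f"
    by (simp_all add: co_si_minus)
  ultimately show "el (- k) (- e) (- sg k * a) (- sg e * b) (- sg (k + e) * c) (- co k * d - si k * f) (si k * d - co k * f)
      \<otimes>\<^bsub>isometry_group 5\<^esub> el k e a b c d f = \<one>\<^bsub>isometry_group 5\<^esub>"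
    unfolding el_mult el_one el_eq_iff by (simp add: co_si_minus)
qed (rule el_carrier)+

text \<open>The parities used later. In particular \<open>d - f\<close> modulo 4 shows the parity of
  \<open>e\<close> for every \<open>k\<close>, since the half step of the second generator sits in
  exactly one of the two coordinates.\<close>

lemma admissible_facts:
  assumes "admissible k e a b c d f"
  shows "even d" "even f" "4 dvd d - f - 2 * e" "4 dvd a - 2 * e" "2 dvd b - k" "4 dvd c - k mod 2 - (b - k)" "even (b - c)"
proof -
  have A: "4 dvd a - 2 * e" "2 dvd b - k" "4 dvd c - k mod 2 - (b - k)"
     "4 dvd d - 2 * e * (1 - k mod 2) - (b - k)" "4 dvd f - 2 * e * (k mod 2) - (b - k)"
    using assms by (simp_all add: admissible_def)
  show "4 dvd a - 2 * e" "2 dvd b - k" "4 dvd c - k mod 2 - (b - k)" by fact+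
  have B: "4 dvd d - 2 * e - (b - k) \<and> 4 dvd f - (b - k) \<or> 4 dvd d - (b - k) \<and> 4 dvd f - 2 * e - (b - k)"
    using A(4,5) by (cases "even k") (simp_all add: even_iff_mod_2_eq_zero odd_iff_mod_2_eq_one)
  show "even d" using B A(2) by presburger
  show "even f" using B A(2) by presburger
  show "4 dvd d - f - 2 * e" using B A(2) by presburger
  show "even (b - c)" using A(2,3) by presburger
qed

lemma admissible_inverse:
  assumes "admissible k e a b c d f"
  shows "admissible (- k) (- e) (- sg k * a) (- sg e * b) (- sg (k + e) * c) (- co k * d - si k * f) (si k * d - co k * f)"
proof -
  obtain x1 x2 x3 x4 x5 where x: "a - 2 * e = 4 * x1" "b - k = 2 * x2" "c - k mod 2 - (b - k) = 4 * x3"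
    "d - 2 * e * (1 - k mod 2) - (b - k) = 4 * x4" "f - 2 * e * (k mod 2) - (b - k) = 4 * x5"
    using assms unfolding admissible_def by (elim conjE dvdE)
  have X: "a = 2 * e + 4 * x1" "b = k + 2 * x2" "c = k mod 2 + 2 * x2 + 4 * x3"
    "d = 2 * e * (1 - k mod 2) + 2 * x2 + 4 * x4" "f = 2 * e * (k mod 2) + 2 * x2 + 4 * x5" using x by linarith+
  obtain m i where k: "k = 4 * m + i" and i: "i = 0 \<or> i = 1 \<or> i = 2 \<or> i = 3"
    using mod4_cases[of k] mult_div_mod_eq[of 4 k] by metis
  obtain n j where e: "e = 2 * n + j" and j: "j = 0 \<or> j = 1"
    by (metis mult_div_mod_eq mod2_eq_if)
  have mods: "(4 * m + i) mod 4 = i mod 4" "(4 * m + i) mod 2 = i mod 2" "(- (4 * m + i)) mod 2 = i mod 2"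
    "even (4 * m + i) = even i" "even (2 * n + j) = even j" "even (4 * m + i + (2 * n + j)) = even (i + j)"
    by presburger+
  show ?thesis
    unfolding admissible_def X k e sg_def co_def si_def mods
    using i j by (elim disjE; simp; intro conjI; algebra)
qed

lemma subgroup_example_group: "subgroup example_group (isometry_group 5)"
proof (rule group.subgroupI[OF group_isometry_group])
  show "example_group \<subseteq> carrier (isometry_group 5)" by (rule example_group_carrier)
  have "admissible 0 0 0 0 0 0 0" by (simp add: admissible_def)
  thus "example_group \<noteq> {}" using example_groupI by blast
  fix g h assume "g \<in> example_group" "h \<in> example_group"
  thus "g \<otimes>\<^bsub>isometry_group 5\<^esub> h \<in> example_group"
    by (elim example_groupE) (simp add: el_mult example_groupI admissible_mult)
next
  fix g assume g: "g \<in> example_group"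
  obtain k e a b c d f where eq: "g = el k e a b c d f" and adm: "admissible k e a b c d f"
    using g by (rule example_groupE)
  show "inv\<^bsub>isometry_group 5\<^esub> g \<in> example_group"
    unfolding eq el_inv by (intro example_groupI admissible_inverse adm)
qed

lemma hol_entry_int_diff:
  assumes "\<And>i j. i < 5 \<Longrightarrow> j < 5 \<Longrightarrow> \<bar>hol k e $$ (i, j) - hol k' e' $$ (i, j)\<bar> < 1"
  shows "hol k e = hol k' e'"
proof (rule eq_matI)
  fix i j assume "i < dim_row (hol k' e')" "j < dim_col (hol k' e')"
  hence ij: "i < 5" "j < 5" by simp_all
  have "\<bar>hol_entry k e i j - hol_entry k' e' i j\<bar> < 1"
    using assms[OF ij] unfolding hol_index[OF ij] of_int_diff[symmetric] of_int_abs[symmetric] of_int_less_1_iff .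
  thus "hol k e $$ (i, j) = hol k' e' $$ (i, j)" by (simp add: hol_index ij)
qed simp_all

text \<open>Linear parts have integer entries and translations are measured in quarters, so the
  radius \<open>1 / 4\<close> isolates every element.\<close>

lemma discrete_example_group: "discrete_in_isometries 5 example_group"
  unfolding discrete_in_isometries_iff[OF example_group_carrier]
proof
  fix g assume "g \<in> example_group"
  then obtain k e a b c d f where g: "g = el k e a b c d f" by (rule example_groupE)
  have "h = g" if h: "h \<in> box_nbhd 5 g (1 / 4)" "h \<in> example_group" for h
  proof -
    obtain k' e' a' b' c' d' f' where h': "h = el k' e' a' b' c' d' f'" using h(2) by (rule example_groupE)
    have "\<bar>hol k' e' $$ (i, j) - hol k e $$ (i, j)\<bar> < 1" if "i < 5" "j < 5" for i j
      using h(1) that unfolding box_nbhd_def by (fastforce simp: g h' el_def)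
    hence 1: "hol k' e' = hol k e" by (rule hol_entry_int_diff)
    have "\<bar>vec_index (snd h) i - vec_index (snd g) i\<bar> < 1 / 4" if "i < 5" for i
      using h(1) that unfolding box_nbhd_def by blast
    from this[of 0] this[of 1] this[of 2] this[of 3] this[of 4]
    have "\<bar>real_of_int (a' - a)\<bar> < 1" "\<bar>real_of_int (b' - b)\<bar> < 1" "\<bar>real_of_int (c' - c)\<bar> < 1"
      "\<bar>real_of_int (d' - d)\<bar> < 1" "\<bar>real_of_int (f' - f)\<bar> < 1"
      by (simp_all add: g h' el_def transl_def diff_divide_distrib[symmetric])
    hence "a' = a" "b' = b" "c' = c" "d' = d" "f' = f" by linarith+
    thus ?thesis using 1 by (simp add: g h' el_def)
  qed
  thus "\<exists>\<epsilon>>0. box_nbhd 5 g \<epsilon> \<inter> example_group \<subseteq> {g}" by (intro exI[of _ "1 / 4"]) auto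
qed

text \<open>A coordinate axis fixed by the linear part of \<open>g\<close> detects that the powers of \<open>g\<close> are nontrivial.\<close>

lemma pow_fixed_coordinate:
  assumes "g \<in> example_group" "i < 5" "Matrix.row (fst g) i = unit_vec 5 i"
  shows "vec_index (snd (g [^]\<^bsub>isometry_group 5\<^esub> (n::nat))) i = real n * vec_index (snd g) i"
proof -
  interpret group "isometry_group 5" by (rule group_isometry_group)
  have gc: "g \<in> carrier (isometry_group 5)" using assms(1) example_group_carrier by blast
  show ?thesis
  proof (induction n)
    case 0
    show ?case using assms(2) by (simp add: isometry_group_simps)
  next
    case (Suc n)
    define h where "h = g [^]\<^bsub>isometry_group 5\<^esub> n"
    have hc: "h \<in> carrier (isometry_group 5)" using gc by (simp add: h_def)
    obtain A v where A: "g = (A, v)" by (cases g)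
    obtain B w where B: "h = (B, w)" by (cases h)
    have c: "A \<in> carrier_mat 5 5" "v \<in> carrier_vec 5" "w \<in> carrier_vec 5"
      using gc hc by (auto simp: A B isometry_group_simps orthogonal_group_carrier_def)
    have "g [^]\<^bsub>isometry_group 5\<^esub> Suc n = g \<otimes>\<^bsub>isometry_group 5\<^esub> h"
      unfolding h_def by (rule nat_pow_Suc2[OF gc])
    hence "snd (g [^]\<^bsub>isometry_group 5\<^esub> Suc n) = v + A *\<^sub>v w" by (simp add: A B isometry_group_simps)
    moreover have "vec_index (v + A *\<^sub>v w) i = vec_index v i + vec_index w i"
      using c assms(2,3) by (simp add: A)
    ultimately show ?case using Suc[folded h_def] by (simp add: A B algebra_simps)
  qed
qed

lemma row_hol:
  assumes "i < 5" "\<And>j. j < 5 \<Longrightarrow> hol_entry k e i j = (if j = i then 1 else 0)"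
  shows "Matrix.row (hol k e) i = unit_vec 5 i"
  by (rule eq_vecI) (use assms in \<open>auto simp: hol_index unit_vec_def\<close>)

text \<open>For an element of finite order the translation vanishes along each axis fixed by the
  linear part. An odd \<open>k\<close> fixes the second or third axis, where \<open>b\<close> or
  \<open>c\<close> is odd. For even \<open>k\<close> the first axis gives \<open>a = 0\<close>, so
  \<open>e\<close> is even; then \<open>b = c = 0\<close> makes \<open>k\<close> divisible by 4, and
  finally \<open>d = f = 0\<close>.\<close>

lemma torsion_free_example_group: "torsion_free_group ((isometry_group 5)\<lparr>carrier := example_group\<rparr>)"
  unfolding torsion_free_group_def
proof (intro ballI allI impI)
  let ?I = "isometry_group 5"
  interpret group ?I by (rule group_isometry_group)
  fix g n assume "g \<in> carrier (?I\<lparr>carrier := example_group\<rparr>)" and n: "0 < (n::nat)"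
    and pow: "g [^]\<^bsub>?I\<lparr>carrier := example_group\<rparr>\<^esub> n = \<one>\<^bsub>?I\<lparr>carrier := example_group\<rparr>\<^esub>"
  hence g: "g \<in> example_group" and pow1: "g [^]\<^bsub>?I\<^esub> n = \<one>\<^bsub>?I\<^esub>"
    using nat_pow_consistent[of g n example_group] by simp_all
  obtain k e a b c d f where eq: "g = el k e a b c d f" and adm: "admissible k e a b c d f"
    using g by (rule example_groupE)
  note F = admissible_facts[OF adm]
  have zero: "[a, b, c, d, f] ! i = 0"
    if i: "i < 5" and fixed: "\<forall>j<5. hol_entry k e i j = (if j = i then 1 else 0)" for i
  proof -
    have "Matrix.row (fst g) i = unit_vec 5 i" using row_hol[OF i fixed[rule_format]] by (simp add: eq el_def)
    from pow_fixed_coordinate[OF g i this, of n]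
    have "real n * vec_index (snd g) i = 0" unfolding pow1 using i by (simp add: isometry_group_simps)
    thus ?thesis using n i by (simp add: eq el_def transl_def)
  qed
  have za: "a = 0" if "even k"
    using zero[of 0] that by (simp add: hol_entry_def all_less_5 sg_def)
  have zb: "b = 0" if "even e"
    using zero[of 1] that by (simp add: hol_entry_def all_less_5 sg_def)
  have zc: "c = 0" if "even (k + e)"
    using zero[of 2] that by (simp add: hol_entry_def all_less_5 sg_def)
  have zd: "d = 0" "f = 0" if "k mod 4 = 0"
    using zero[of 3] zero[of 4] that by (simp_all add: hol_entry_def all_less_5 co_def si_def)
  have k: "even k"
  proof (rule ccontr)
    assume "odd k"
    show False
    proof (cases "even e")
      case True
      thus False using zb F(5) \<open>odd k\<close> by simp
    next
      case False
      hence "c = 0" using zc \<open>odd k\<close> by simp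
      thus False using F(5,6) \<open>odd k\<close> by presburger
    qed
  qed
  have e: "even e" using za[OF k] F(4) by presburger
  have bc: "b = 0" "c = 0" using zb[OF e] zc k e by simp_all
  have k4: "k mod 4 = 0" using F(6) k bc by presburger
  have "e mod 2 = 0" using e by presburger
  thus "g = \<one>\<^bsub>?I\<lparr>carrier := example_group\<rparr>\<^esub>"
    using za[OF k] bc zd[OF k4] k4 by (simp add: eq el_one el_eq_iff)
qed

section \<open>Excluding the Hantzsche-Wendt relations by parities\<close>

lemma (in HW_pair) square_sandwich:
  "y \<otimes> y \<otimes> x \<otimes> (y \<otimes> y) = x" "x \<otimes> x \<otimes> y \<otimes> (x \<otimes> x) = y"
proof -
  have aux: "v \<otimes> v \<otimes> u \<otimes> (v \<otimes> v) = u"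
    if u: "u \<in> carrier G" and v: "v \<in> carrier G" and rel: "inv u \<otimes> (v \<otimes> v) \<otimes> u = inv (v \<otimes> v)" for u v
  proof -
    have w: "v \<otimes> v \<in> carrier G" using v by simp
    have "v \<otimes> v \<otimes> u = u \<otimes> (inv u \<otimes> (v \<otimes> v) \<otimes> u)" using u v by (simp add: m_assoc inv_cancel)
    hence "v \<otimes> v \<otimes> u \<otimes> (v \<otimes> v) = u \<otimes> (inv (v \<otimes> v) \<otimes> (v \<otimes> v))"
      unfolding rel using u w by (simp only: m_assoc inv_closed)
    thus ?thesis using u w by simp
  qed
  show "y \<otimes> y \<otimes> x \<otimes> (y \<otimes> y) = x" by (rule aux[OF x y rel1])
  show "x \<otimes> x \<otimes> y \<otimes> (x \<otimes> x) = y" by (rule aux[OF y x rel2])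
qed

lemma sg_double: "sg (k + k) = 1" "co (k + k) = sg k" "si (k + k) = 0"
proof -
  show "sg (k + k) = 1" by (simp add: sg_def)
  have "(k + k) mod 4 = (if even k then 0 else 2)" by presburger
  thus "co (k + k) = sg k" "si (k + k) = 0" by (simp_all add: sg_def co_def si_def)
qed

text \<open>The square of \<open>y\<close> enters once directly and once transformed by
  \<open>x\<close>, so the first coordinate reads \<open>(1 + sg k) * (1 + sg k') * a' = 0\<close>,
  and similarly for the next two. The pair \<open>(D, F)\<close> is the translation of the square of
  \<open>y\<close> in the rotated plane.\<close>

lemma el_square_sandwich:
  fixes k e a b c d f k' e' a' b' c' d' f' :: int
  defines "D \<equiv> d' + (co k' * d' - si k' * f')" and "F \<equiv> f' + (si k' * d' + co k' * f')"
  assumes "el k' e' a' b' c' d' f' \<otimes>\<^bsub>isometry_group 5\<^esub> el k' e' a' b' c' d' f' \<otimes>\<^bsub>isometry_group 5\<^esub> el k e a b c d f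
    \<otimes>\<^bsub>isometry_group 5\<^esub> (el k' e' a' b' c' d' f' \<otimes>\<^bsub>isometry_group 5\<^esub> el k' e' a' b' c' d' f') = el k e a b c d f"
  shows "even k \<Longrightarrow> even k' \<Longrightarrow> a' = 0" "even e \<Longrightarrow> even e' \<Longrightarrow> b' = 0"
    "even (k + e) \<Longrightarrow> even (k' + e') \<Longrightarrow> c' = 0"
    "D + sg k' * d + sg k' * (co k * D - si k * F) = d" "F + sg k' * f + sg k' * (si k * D + co k * F) = f"
proof -
  have s: "sg (k' + k' + k) = sg k" "sg (e' + e' + e) = sg e" "sg (k' + k' + (e' + e')) = 1"
    "sg (k' + k' + k + (e' + e' + e)) = sg (k + e)" by (simp_all add: sg_def)
  have t: "co (k' + k' + k) = sg k' * co k" "si (k' + k' + k) = sg k' * si k"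
    unfolding co_si_add(1)[of "k' + k'" k] co_si_add(2)[of "k' + k'" k] sg_double by (simp_all only: mult_zero_left add_0 diff_zero)
  have "a' + sg k' * a' + a + sg k * (a' + sg k' * a') = a"
    "b' + sg e' * b' + b + sg e * (b' + sg e' * b') = b"
    "c' + sg (k' + e') * c' + c + sg (k + e) * (c' + sg (k' + e') * c') = c"
    and 1: "D + sg k' * d + (sg k' * co k * D - sg k' * si k * F) = d"
      "F + sg k' * f + (sg k' * si k * D + sg k' * co k * F) = f"
    using assms(3) unfolding el_mult el_eq_iff s t sg_double D_def[symmetric] F_def[symmetric] by simp_all
  thus "even k \<Longrightarrow> even k' \<Longrightarrow> a' = 0" "even e \<Longrightarrow> even e' \<Longrightarrow> b' = 0" "even (k + e) \<Longrightarrow> even (k' + e') \<Longrightarrow> c' = 0"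
    by (simp_all add: sg_def)
  show "D + sg k' * d + sg k' * (co k * D - si k * F) = d" "F + sg k' * f + sg k' * (si k * D + co k * F) = f"
    using 1 by (simp_all only: right_diff_distrib distrib_left mult.assoc)
qed

lemma si_odd: "odd k \<Longrightarrow> co k = 0 \<and> (si k = 1 \<or> si k = - 1)"
  using mod4_cases[of k] unfolding co_def si_def by presburger

text \<open>On the last two coordinates \<open>x\<close> is a quarter turn. If \<open>y\<close> is
  trivial there, a quarter turn would reverse the vector \<open>2 (d', f')\<close>, which therefore
  vanishes. If \<open>y\<close> is minus the identity there, \<open>(d', f')\<close> is the
  translation of the square of \<open>x\<close>, and 4 divides \<open>d' - f'\<close>. But for odd
  \<open>e'\<close> this difference is 2 modulo 4.\<close>

lemma no_HW_pair_mixed: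
  fixes k e d f k' e' d' f' :: int
  defines "D \<equiv> d' + (co k' * d' - si k' * f')" and "F \<equiv> f' + (si k' * d' + co k' * f')"
    and "D' \<equiv> d + (co k * d - si k * f)" and "F' \<equiv> f + (si k * d + co k * f)"
  assumes k: "odd k" "even k'" and e': "odd e'" and d: "even d" "even f" "4 dvd d' - f' - 2 * e'"
    and 1: "D + sg k' * d + sg k' * (co k * D - si k * F) = d" "F + sg k' * f + sg k' * (si k * D + co k * F) = f"
    and 2: "D' + sg k * d' + sg k * (co k' * D' - si k' * F') = d'" "F' + sg k * f' + sg k * (si k' * D' + co k' * F') = f'"
  shows False
proof -
  have k': "k' mod 4 = 0 \<or> k' mod 4 = 2" using k(2) by presburger
  have s: "co k = 0" "si k = 1 \<or> si k = - 1" "sg k = - 1" "sg k' = 1" using si_odd[OF k(1)] k by (simp_all add: sg_def)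
  from k' show False
  proof
    assume "k' mod 4 = 0"
    hence "D = 2 * d'" "F = 2 * f'" by (simp_all add: D_def F_def co_def si_def)
    hence "d' = si k * f'" "f' = - si k * d'" using 1 s by simp_all
    hence "d' = 0" "f' = 0" using s(2) by auto
    thus False using d(3) e' by presburger
  next
    assume "k' mod 4 = 2"
    hence "d' = D'" "f' = F'" using 2 s by (simp_all add: co_def si_def)
    hence "d' = d - si k * f" "f' = f + si k * d" using s by (simp_all add: D'_def F'_def)
    thus False using s(2) d e' by (elim disjE) (simp, presburger)+
  qed
qed

text \<open>Both elements turn the plane by a right angle, and the relation makes
  \<open>(d, f)\<close> equal to \<open>(d', f')\<close> up to quarter turns. As \<open>d'\<close>
  and \<open>f'\<close> are even, \<open>d - f\<close> and \<open>d' - f'\<close> agree modulo 4, so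
  \<open>e\<close> and \<open>e'\<close> would have equal parity.\<close>

lemma no_HW_pair_odd:
  fixes k e d f k' e' d' f' :: int
  defines "D \<equiv> d' + (co k' * d' - si k' * f')" and "F \<equiv> f' + (si k' * d' + co k' * f')"
  assumes k: "odd k" "odd k'" and e: "even e \<noteq> even e'" and d: "even d'" "even f'" "4 dvd d - f - 2 * e" "4 dvd d' - f' - 2 * e'"
    and 1: "D + sg k' * d + sg k' * (co k * D - si k * F) = d" "F + sg k' * f + sg k' * (si k * D + co k * F) = f"
  shows False
proof -
  have s: "co k = 0" "co k' = 0" "sg k = - 1" "sg k' = - 1" using si_odd k by (simp_all add: sg_def)
  have t: "si k = 1 \<or> si k = - 1" "si k' = 1 \<or> si k' = - 1" using si_odd k by simp_all
  have "D = d' - si k' * f'" "F = f' + si k' * d'" using s by (simp_all add: D_def F_def)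
  hence "d = d' \<and> f = f' \<or> d = f' \<and> f = - d' \<or> d = - f' \<and> f = d'"
    using 1 t unfolding s by (elim disjE) simp_all
  thus False using d e by (elim disjE) (simp, presburger)+
qed

text \<open>The parities of \<open>k\<close>, \<open>e\<close>, \<open>k + e\<close> belong to the
  first three axes. If one of them is even for both elements, both translations vanish along its
  axis; the congruences then lead back to even \<open>k\<close> and \<open>k'\<close>, and from
  there to \<open>x = \<one>\<close>. The remaining parities are settled on the rotated
  plane.\<close>

lemma no_HW_pair_example_group:
  assumes HW: "HW_pair ((isometry_group 5)\<lparr>carrier := example_group\<rparr>) x y"
    and x1: "x \<noteq> \<one>\<^bsub>isometry_group 5\<^esub>"
  shows False
proof -
  interpret H: HW_pair "(isometry_group 5)\<lparr>carrier := example_group\<rparr>" x y by fact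
  obtain k e a b c d f where x: "x = el k e a b c d f" and A: "admissible k e a b c d f"
    using H.x by (auto elim: example_groupE)
  obtain k' e' a' b' c' d' f' where y: "y = el k' e' a' b' c' d' f'" and A': "admissible k' e' a' b' c' d' f'"
    using H.y by (auto elim: example_groupE)
  have S: "y \<otimes>\<^bsub>isometry_group 5\<^esub> y \<otimes>\<^bsub>isometry_group 5\<^esub> x \<otimes>\<^bsub>isometry_group 5\<^esub> (y \<otimes>\<^bsub>isometry_group 5\<^esub> y) = x"
    "x \<otimes>\<^bsub>isometry_group 5\<^esub> x \<otimes>\<^bsub>isometry_group 5\<^esub> y \<otimes>\<^bsub>isometry_group 5\<^esub> (x \<otimes>\<^bsub>isometry_group 5\<^esub> x) = y"
    using H.square_sandwich by simp_all
  note E1 = el_square_sandwich[OF S(1)[unfolded x y]] and E2 = el_square_sandwich[OF S(2)[unfolded x y]]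
  note F = admissible_facts[OF A] and F' = admissible_facts[OF A']
  have notA: "\<not> (even k \<and> even k')"
  proof
    assume ev: "even k \<and> even k'"
    hence a: "a = 0" "a' = 0" using E1(1) E2(1) by simp_all
    have e: "even e" "even e'" using F(4) F'(4) unfolding a by presburger+
    have b: "b = 0" "b' = 0" using E1(2) E2(2) e by simp_all
    have c: "c = 0" "c' = 0" using E1(3) E2(3) e ev by simp_all
    have k: "k mod 4 = 0" "k' mod 4 = 0" using F(6) F'(6) ev unfolding b c by presburger+
    have df: "d = 0" "f = 0" using E2(4,5) k ev by (simp_all add: co_def si_def sg_def)
    have "e mod 2 = 0" using e by presburger
    thus False using x1 k unfolding x a b c df el_one el_eq_iff by simp
  qed
  have notB: "\<not> (even e \<and> even e')"
  proof
    assume ev: "even e \<and> even e'"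
    have b: "b = 0" "b' = 0" using E1(2) E2(2) ev by simp_all
    thus False using F(5) F'(5) notA by simp
  qed
  have notC: "\<not> (even (k + e) \<and> even (k' + e'))"
  proof
    assume ev: "even (k + e) \<and> even (k' + e')"
    have "c = 0" "c' = 0" using E1(3) E2(3) ev by simp_all
    hence "even b" "even b'" using F(7) F'(7) by simp_all
    thus False using F(5) F'(5) notA by simp
  qed
  consider "odd k" "even k'" "odd e'" | "odd k'" "even k" "odd e" | "odd k" "odd k'" "even e \<noteq> even e'"
    using notA notB notC by auto
  thus False
  proof cases
    case 1
    show False by (rule no_HW_pair_mixed[OF 1 F(1,2) F'(3) E1(4,5) E2(4,5)])
  next
    case 2
    show False by (rule no_HW_pair_mixed[OF 2 F'(1,2) F(3) E2(4,5) E1(4,5)])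
  next
    case 3
    show False by (rule no_HW_pair_odd[OF 3 F'(1,2) F(3) F'(3) E1(4,5)])
  qed
qed

section \<open>A finite set without extremal point\<close>

definition in_box :: "int \<Rightarrow> int \<Rightarrow> int \<Rightarrow> int \<Rightarrow> int \<Rightarrow> bool" where
  "in_box a b c d f \<longleftrightarrow> \<bar>a\<bar> \<le> 2 \<and> \<bar>b\<bar> \<le> 2 \<and> \<bar>c\<bar> \<le> 3 \<and> \<bar>d\<bar> \<le> 2 \<and> \<bar>f\<bar> \<le> 2"

definition box_set where
  "box_set = {g \<in> example_group. \<exists>k e a b c d f. g = el k e a b c d f \<and> in_box a b c d f}"

lemma finite_box_set: "finite box_set"
proof (rule finite_subset)
  let ?F = "\<lambda>(k, e, a, b, c, d, f). el k e a b c d f"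
  let ?J = "{- 3..3::int}"
  show "finite (?F ` ({0..3} \<times> {0..1} \<times> ?J \<times> ?J \<times> ?J \<times> ?J \<times> ?J))" by (intro finite_imageI finite_cartesian_product) simp_all
  show "box_set \<subseteq> ?F ` ({0..3} \<times> {0..1} \<times> ?J \<times> ?J \<times> ?J \<times> ?J \<times> ?J)"
  proof
    fix g assume "g \<in> box_set"
    then obtain k e a b c d f where g: "g = el k e a b c d f" and B: "in_box a b c d f" unfolding box_set_def by blast
    have "g = ?F (k mod 4, e mod 2, a, b, c, d, f)" by (simp add: g el_eq_iff)
    moreover have "(k mod 4, e mod 2, a, b, c, d, f) \<in> {0..3} \<times> {0..1} \<times> ?J \<times> ?J \<times> ?J \<times> ?J \<times> ?J"
      using B pos_mod_bound[of 4 k] pos_mod_bound[of 2 e] by (auto simp: in_box_def)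
    ultimately show "g \<in> ?F ` ({0..3} \<times> {0..1} \<times> ?J \<times> ?J \<times> ?J \<times> ?J \<times> ?J)" by (rule image_eqI)
  qed
qed

lemma quarter_turns: "sg 1 = - 1" "co 1 = 0" "si 1 = 1" "sg (- 1) = - 1" "co (- 1) = 0" "si (- 1) = - 1" "sg 2 = 1" "sg (- 2) = 1"
  by (simp_all add: sg_def co_def si_def)

text \<open>The element \<open>h\<close> always makes a quarter turn, \<open>k = 1\<close>. With
  \<open>e' = 0\<close> the coordinate \<open>b\<close> moves by 1 in both directions, which fails
  only for \<open>b = 2\<close> and \<open>b = - 2\<close>. There \<open>e' = 1\<close> reflects
  \<open>b\<close>, and \<open>c\<close> moves by 1 both ways instead. This is the origin of the
  bound 3 for \<open>c\<close>: in that case \<open>c\<close> is even, hence at most 2 in absolute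
  value before the move.\<close>

lemma box_step:
  assumes adm: "admissible k e a b c d f" and box: "in_box a b c d f"
  obtains h where "h \<in> example_group" "h \<noteq> \<one>\<^bsub>isometry_group 5\<^esub>"
    "h \<otimes>\<^bsub>isometry_group 5\<^esub> el k e a b c d f \<in> box_set" "inv\<^bsub>isometry_group 5\<^esub> h \<otimes>\<^bsub>isometry_group 5\<^esub> el k e a b c d f \<in> box_set"
proof -
  let ?I = "isometry_group 5"
  note F = admissible_facts[OF adm]
  note result = that
  \<comment> \<open>The two box conditions are the coordinates of \<open>h \<otimes> g\<close> and
    \<open>inv h \<otimes> g\<close>, for \<open>h\<close> with \<open>k = 1\<close> and
    \<open>g\<close> the given element.\<close>
  have thesis_if: thesis
    if h: "admissible 1 e' a' b' c' d' f'" "e' = 0 \<or> e' = 1"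
      and 1: "in_box (a' - a) (b' + sg e' * b) (c' - sg e' * c) (d' - f) (f' + d)"
      and 2: "in_box (a' - a) (- sg e' * b' + sg e' * b) (sg e' * c' - sg e' * c) (f - f') (d' - d)" for e' a' b' c' d' f'
  proof -
    let ?h = "el 1 e' a' b' c' d' f'"
    have hG: "?h \<in> example_group" using h(1) by (rule example_groupI)
    have gG: "el k e a b c d f \<in> example_group" using adm by (rule example_groupI)
    note sub = subgroup_example_group
    have s: "sg (1 + e') = - sg e'" "sg (- 1 - e') = - sg e'" using h(2) by (auto simp: sg_def)
    have "?h \<otimes>\<^bsub>?I\<^esub> el k e a b c d f = el (1 + k) (e' + e) (a' - a) (b' + sg e' * b) (c' - sg e' * c) (d' - f) (f' + d)"
      unfolding el_mult quarter_turns s by simp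
    hence P: "?h \<otimes>\<^bsub>?I\<^esub> el k e a b c d f \<in> box_set"
      unfolding box_set_def using subgroup.m_closed[OF sub hG gG] 1 by blast
    have "inv\<^bsub>?I\<^esub> ?h \<otimes>\<^bsub>?I\<^esub> el k e a b c d f
        = el (- 1 + k) (- e' + e) (a' - a) (- sg e' * b' + sg e' * b) (sg e' * c' - sg e' * c) (f - f') (d' - d)"
      unfolding el_inv el_mult quarter_turns s diff_conv_add_uminus[symmetric] by (simp add: s co_si_minus)
    hence Q: "inv\<^bsub>?I\<^esub> ?h \<otimes>\<^bsub>?I\<^esub> el k e a b c d f \<in> box_set"
      unfolding box_set_def using subgroup.m_closed[OF sub subgroup.m_inv_closed[OF sub hG] gG] 2 by blast
    have "?h \<noteq> \<one>\<^bsub>?I\<^esub>" by (simp add: el_one el_eq_iff)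
    from result[OF hG this P Q] show thesis .
  qed
  have B: "\<bar>a\<bar> \<le> 2" "\<bar>b\<bar> \<le> 2" "\<bar>c\<bar> \<le> 3" "\<bar>d\<bar> \<le> 2" "\<bar>f\<bar> \<le> 2" using box by (simp_all add: in_box_def)
  have d: "d = - 2 \<or> d = 0 \<or> d = 2" and f: "f = - 2 \<or> f = 0 \<or> f = 2"
    using B F(1,2) by presburger+
  define a' :: int where "a' = (if a \<ge> 0 then 2 else - 2)"
  have a': "\<bar>a' - a\<bar> \<le> 2" "a' = 2 \<or> a' = - 2" using B(1) by (auto simp: a'_def)
  consider "\<bar>b\<bar> \<le> 1" | "b = 2" | "b = - 2" using B(2) by linarith
  thus thesis
  proof cases
    case 1
    \<comment> \<open>Admissibility with \<open>e' = 0\<close> and \<open>b' = 1\<close> confines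
      \<open>c'\<close> to the class of 1 modulo 4. Both products have the third coordinate
      \<open>c' - c\<close>, so the value is taken on the side of \<open>c\<close>.\<close>
    define c' :: int where "c' = (if c \<ge> 0 then 1 else - 3)"
    have c': "c' = 1 \<or> c' = - 3" "\<bar>c' - c\<bar> \<le> 3" using B(3) by (auto simp: c'_def)
    show thesis
    proof (rule thesis_if[of 0 0 1 c' 0 0])
      show "admissible 1 0 0 1 c' 0 0" using c' by (auto simp: admissible_def)
    qed (use c'(2) 1 B in \<open>simp_all add: in_box_def quarter_turns sg_co_si_zero abs_le_iff\<close>)
  next
    case 2
    have c: "\<bar>c\<bar> \<le> 2" using F(7) B(3) 2 by presburger
    show thesis
    proof (cases "d * f \<ge> 0")
      case True
      define d' :: int where "d' = (if d + f \<ge> 0 then 2 else - 2)"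
      have d': "d' = 2 \<or> d' = - 2" "\<bar>d' - f\<bar> \<le> 2" "\<bar>d' - d\<bar> \<le> 2" unfolding d'_def using d f True by (elim disjE; simp)+
      show thesis
      proof (rule thesis_if[of 1 a' 3 "- 1" d' 0])
        show "admissible 1 1 a' 3 (- 1) d' 0" using d' a' by (auto simp: admissible_def)
      qed (use c d'(2,3) a'(1) 2 B in \<open>simp_all add: in_box_def quarter_turns sg_co_si_zero abs_le_iff\<close>)
    next
      case False
      \<comment> \<open>Opposite signs leave only \<open>d = - f\<close>; the choice
        \<open>f' = f\<close> cancels both \<open>f' + d\<close> and \<open>f - f'\<close>.\<close>
      define f' where "f' = f"
      have f': "f' = 2 \<or> f' = - 2" "\<bar>f - f'\<bar> \<le> 2" "\<bar>f' + d\<bar> \<le> 2" unfolding f'_def using d f False by (elim disjE; simp)+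
      show thesis
      proof (rule thesis_if[of 1 a' 1 1 0 f'])
        show "admissible 1 1 a' 1 1 0 f'" using f' a' by (auto simp: admissible_def)
      qed (use c f'(2,3) a'(1) 2 B in \<open>simp_all add: in_box_def quarter_turns sg_co_si_zero abs_le_iff\<close>)
    qed
  next
    case 3
    have c: "\<bar>c\<bar> \<le> 2" using F(7) B(3) 3 by presburger
    show thesis
    proof (cases "d * f \<ge> 0")
      case True
      define d' :: int where "d' = (if d + f \<ge> 0 then 2 else - 2)"
      have d': "d' = 2 \<or> d' = - 2" "\<bar>d' - f\<bar> \<le> 2" "\<bar>d' - d\<bar> \<le> 2" unfolding d'_def using d f True by (elim disjE; simp)+
      show thesis
      proof (rule thesis_if[of 1 a' "- 1" "- 1" d' 0])
        show "admissible 1 1 a' (- 1) (- 1) d' 0" using d' a' by (auto simp: admissible_def)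
      qed (use c d'(2,3) a'(1) 3 B in \<open>simp_all add: in_box_def quarter_turns sg_co_si_zero abs_le_iff\<close>)
    next
      case False
      define f' where "f' = f"
      have f': "f' = 2 \<or> f' = - 2" "\<bar>f - f'\<bar> \<le> 2" "\<bar>f' + d\<bar> \<le> 2" unfolding f'_def using d f False by (elim disjE; simp)+
      show thesis
      proof (rule thesis_if[of 1 a' "- 3" 1 0 f'])
        show "admissible 1 1 a' (- 3) 1 0 f'" using f' a' by (auto simp: admissible_def)
      qed (use c f'(2,3) a'(1) 3 B in \<open>simp_all add: in_box_def quarter_turns sg_co_si_zero abs_le_iff\<close>)
    qed
  qed
qed

lemma not_diffuse_example_group: "\<not> diffuse_group ((isometry_group 5)\<lparr>carrier := example_group\<rparr>)"
proof
  let ?I = "isometry_group 5"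
  let ?G = "?I\<lparr>carrier := example_group\<rparr>"
  assume D: "diffuse_group ?G"
  have "admissible 0 0 0 0 0 0 0" "in_box 0 0 0 0 0" by (simp_all add: admissible_def in_box_def)
  hence "el 0 0 0 0 0 0 0 \<in> box_set" unfolding box_set_def using example_groupI[of 0 0 0 0 0 0 0] by blast
  hence "box_set \<noteq> {}" by auto
  moreover have "box_set \<subseteq> carrier ?G" unfolding box_set_def by simp
  ultimately have "\<exists>g. extremal_point ?G box_set g"
    using D[unfolded diffuse_group_def, rule_format, of box_set] finite_box_set by simp
  then obtain g where g: "extremal_point ?G box_set g" ..
  hence "g \<in> box_set" by (simp add: extremal_point_def)
  then obtain k e a b c d f where eq: "g = el k e a b c d f" "in_box a b c d f" and gG: "g \<in> example_group"
    unfolding box_set_def by blast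
  obtain k' e' a' b' c' d' f' where eq': "g = el k' e' a' b' c' d' f'" "admissible k' e' a' b' c' d' f'"
    using gG by (rule example_groupE)
  have "in_box a' b' c' d' f'" using eq eq'(1) by (simp add: el_eq_iff)
  from eq'(2) this obtain h where h: "h \<in> example_group" "h \<noteq> \<one>\<^bsub>?I\<^esub>"
    "h \<otimes>\<^bsub>?I\<^esub> g \<in> box_set" "inv\<^bsub>?I\<^esub> h \<otimes>\<^bsub>?I\<^esub> g \<in> box_set"
    unfolding eq'(1) by (rule box_step)
  have inv: "inv\<^bsub>?G\<^esub> h = inv\<^bsub>?I\<^esub> h"
    by (rule group.m_inv_consistent[OF group_isometry_group subgroup_example_group h(1)])
  have "h \<in> carrier ?G - {\<one>\<^bsub>?G\<^esub>}" using h(1,2) by simp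
  hence "h \<otimes>\<^bsub>?G\<^esub> g \<notin> box_set \<or> inv\<^bsub>?G\<^esub> h \<otimes>\<^bsub>?G\<^esub> g \<notin> box_set"
    using g unfolding extremal_point_def by (elim conjE) (rule bspec)
  thus False using h(3,4) by (simp add: inv)
qed

section \<open>Cocompactness\<close>

lemma orthogonal_group_carrier_iff:
  assumes "A \<in> carrier_mat n n"
  shows "A \<in> orthogonal_group_carrier n \<longleftrightarrow> (\<forall>i<n. \<forall>j<n.
    (\<Sum>l\<in>{0..<n}. A $$ (l, i) * A $$ (l, j)) = (if i = j then 1 else 0) \<and>
    (\<Sum>l\<in>{0..<n}. A $$ (i, l) * A $$ (j, l)) = (if i = j then 1 else 0))"
  using assms by (auto simp: orthogonal_group_carrier_def mat_eq_iff scalar_prod_def)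

lemma orthogonal_entry_le:
  assumes "A \<in> orthogonal_group_carrier n" "i < n" "j < n"
  shows "\<bar>A $$ (i, j)\<bar> \<le> 1"
proof -
  have A: "A \<in> carrier_mat n n" using assms(1) by (simp add: orthogonal_group_carrier_def)
  have "(A $$ (i, j))\<^sup>2 \<le> (\<Sum>l\<in>{0..<n}. (A $$ (l, j))\<^sup>2)"
    by (rule member_le_sum) (use assms in auto)
  also have "\<dots> = 1"
    using assms(1)[unfolded orthogonal_group_carrier_iff[OF A]] assms(3) by (simp add: power2_eq_square)
  finally show ?thesis by (simp add: abs_square_le_1)
qed

text \<open>The topology is pulled back along \<open>E\<close>, and \<open>r\<close> rebuilds matrix
  and vector from functions. The set is the image under \<open>r\<close> of the part of a compact
  cube cut out by the single equation \<open>F p = 0\<close>, where \<open>F\<close> is the sum of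
  squares of all orthogonality relations.\<close>

lemma compactin_bounded_isometries:
  "compactin (isometry_topology n) {g \<in> carrier (isometry_group n). \<forall>i<n. \<bar>vec_index (snd g) i\<bar> \<le> 1}"
    (is "compactin ?X ?K")
proof -
  let ?IJ = "{..<n} \<times> {..<n}"
  define P where "P = prod_topology (product_topology (\<lambda>_. euclideanreal) ?IJ) (product_topology (\<lambda>_. euclideanreal) {..<n})"
  define E where "E = (\<lambda>(A :: real mat, v :: real Matrix.vec). (\<lambda>ij\<in>?IJ. A $$ ij, \<lambda>i\<in>{..<n}. vec_index v i))"
  have X: "?X = pullback_topology (carrier (isometry_group n)) E P"
    unfolding isometry_topology_def E_def P_def ..
  define r where "r = (\<lambda>(a, w). (Matrix.mat n n a :: real mat, Matrix.vec n w :: real Matrix.vec))"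
  define F :: "(nat \<times> nat \<Rightarrow> real) \<times> (nat \<Rightarrow> real) \<Rightarrow> real" where
    "F p = (\<Sum>ij\<in>?IJ. ((\<Sum>l\<in>{0..<n}. fst p (l, fst ij) * fst p (l, snd ij)) - (if fst ij = snd ij then 1 else 0))\<^sup>2
       + ((\<Sum>l\<in>{0..<n}. fst p (fst ij, l) * fst p (snd ij, l)) - (if fst ij = snd ij then 1 else 0))\<^sup>2)" for p
  define B where "B = (\<Pi>\<^sub>E ij\<in>?IJ. {- 1..1::real}) \<times> (\<Pi>\<^sub>E i\<in>{..<n}. {- 1..1::real})"
  define C where "C = B \<inter> {p \<in> topspace P. F p \<in> {0}}"
  have B: "compactin P B"
    unfolding P_def B_def compactin_Times compactin_PiE by simp
  have proj: "continuous_map P euclideanreal (\<lambda>p. fst p ij)" if "ij \<in> ?IJ" for ij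
    unfolding P_def
    by (rule continuous_map_compose[OF continuous_map_fst continuous_map_product_projection[OF that], unfolded comp_def])
  have "continuous_map P euclideanreal F"
    unfolding F_def
    by (intro continuous_map_sum continuous_map_add continuous_map_real_pow continuous_map_diff
        continuous_map_real_mult proj) auto
  hence "closedin P {p \<in> topspace P. F p \<in> {0}}" by (rule closedin_continuous_map_preimage) simp
  hence C: "compactin P C" unfolding C_def using compact_Int_closedin[OF B] by blast
  have F_iff: "r p \<in> carrier (isometry_group n) \<longleftrightarrow> F p = 0" for p
  proof -
    let ?M = "Matrix.mat n n (fst p)"
    have s: "(\<Sum>l\<in>{0..<n}. ?M $$ (l, i) * ?M $$ (l, j)) = (\<Sum>l\<in>{0..<n}. fst p (l, i) * fst p (l, j))"
      "(\<Sum>l\<in>{0..<n}. ?M $$ (i, l) * ?M $$ (j, l)) = (\<Sum>l\<in>{0..<n}. fst p (i, l) * fst p (j, l))"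
      if "i < n" "j < n" for i j
      by (rule sum.cong; use that in simp)+
    let ?c = "\<lambda>ij :: nat \<times> nat. if fst ij = snd ij then 1 else 0 :: real"
    have "F p = 0 \<longleftrightarrow> (\<forall>ij\<in>?IJ. (\<Sum>l\<in>{0..<n}. fst p (l, fst ij) * fst p (l, snd ij)) - ?c ij = 0 \<and>
        (\<Sum>l\<in>{0..<n}. fst p (fst ij, l) * fst p (snd ij, l)) - ?c ij = 0)"
      unfolding F_def sum_power2_eq_zero_iff[symmetric]
      by (rule sum_nonneg_eq_0_iff) (simp_all only: finite_cartesian_product finite_lessThan sum_power2_ge_zero)
    also have "\<dots> \<longleftrightarrow> (\<forall>i<n. \<forall>j<n. (\<Sum>l\<in>{0..<n}. fst p (l, i) * fst p (l, j)) = ?c (i, j) \<and>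
        (\<Sum>l\<in>{0..<n}. fst p (i, l) * fst p (j, l)) = ?c (i, j))"
      by (simp only: Ball_def mem_Times_iff split_paired_All fst_conv snd_conv lessThan_iff eq_iff_diff_eq_0[symmetric]) blast
    also have "\<dots> \<longleftrightarrow> ?M \<in> orthogonal_group_carrier n"
      by (simp only: orthogonal_group_carrier_iff[OF mat_carrier] s fst_conv snd_conv cong: imp_cong)
    also have "\<dots> \<longleftrightarrow> r p \<in> carrier (isometry_group n)"
      by (simp add: r_def isometry_group_simps case_prod_beta)
    finally show ?thesis by simp
  qed
  have E_r: "E (r p) = p" if p: "p \<in> topspace P" for p
  proof -
    obtain a w where aw: "p = (a, w)" by (cases p)
    have "a \<in> extensional ?IJ" "w \<in> extensional {..<n}" using p by (simp_all add: P_def aw PiE_def)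
    hence ext: "restrict a ?IJ = a" "restrict w {..<n} = w" by (simp_all only: extensional_restrict)
    have "(\<lambda>ij\<in>?IJ. Matrix.mat n n a $$ ij) = restrict a ?IJ" "(\<lambda>i\<in>{..<n}. vec_index (Matrix.vec n w) i) = restrict w {..<n}"
      by (rule restrict_ext; auto)+
    thus ?thesis by (simp only: E_def r_def aw prod.case ext)
  qed
  \<comment> \<open>Continuity into a pullback topology means continuity of
    \<open>E \<circ> r\<close>, which is the identity here.\<close>
  have "continuous_map (subtopology P C) ?X r"
    unfolding X
  proof (rule continuous_map_pullback')
    have id: "continuous_map (subtopology P C) P id" by (intro continuous_map_from_subtopology continuous_map_id)
    show "continuous_map (subtopology P C) P (E \<circ> r)"
    proof (rule continuous_map_eq[OF id])
      fix p assume "p \<in> topspace (subtopology P C)"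
      hence "p \<in> topspace P" by simp
      thus "id p = (E \<circ> r) p" by (simp add: E_r)
    qed
    show "topspace (subtopology P C) \<subseteq> r -` carrier (isometry_group n)"
    proof
      fix p assume "p \<in> topspace (subtopology P C)"
      hence "F p = 0" by (simp add: C_def)
      thus "p \<in> r -` carrier (isometry_group n)" using F_iff by simp
    qed
  qed
  hence "compactin ?X (r ` C)"
    by (rule image_compactin[rotated]) (use C in \<open>simp add: compactin_subtopology\<close>)
  moreover have "r ` C = ?K"
  proof (intro equalityI subsetI)
    fix g assume "g \<in> r ` C"
    then obtain p where p: "p \<in> C" and g: "g = r p" by blast
    have "\<bar>vec_index (snd g) i\<bar> \<le> 1" if "i < n" for i
    proof -
      have "p \<in> B" using p unfolding C_def by (rule IntD1)
      hence "snd p \<in> (\<Pi>\<^sub>E i\<in>{..<n}. {- 1..1})" unfolding B_def mem_Times_iff by (rule conjunct2)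
      hence "snd p i \<in> {- 1..1}" by (rule PiE_mem) (simp add: that)
      hence "\<bar>snd p i\<bar> \<le> 1" by (simp add: abs_le_iff)
      thus ?thesis using that by (simp add: g r_def case_prod_beta)
    qed
    moreover have "g \<in> carrier (isometry_group n)" using p F_iff[of p] by (simp add: g C_def)
    ultimately show "g \<in> ?K" by blast
  next
    fix g assume g: "g \<in> ?K"
    obtain A v where Av: "g = (A, v)" by (cases g)
    have A: "A \<in> orthogonal_group_carrier n" and v: "v \<in> carrier_vec n" "\<forall>i<n. \<bar>vec_index v i\<bar> \<le> 1"
      using g by (simp_all add: Av isometry_group_simps)
    have A': "A \<in> carrier_mat n n" using A by (simp add: orthogonal_group_carrier_def)
    have "Matrix.mat n n (\<lambda>ij\<in>?IJ. A $$ ij) = A" "Matrix.vec n (\<lambda>i\<in>{..<n}. vec_index v i) = v"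
      using A' v by (auto intro!: eq_matI eq_vecI)
    hence r: "r (E g) = g" by (simp add: r_def E_def Av)
    have "(\<lambda>ij\<in>?IJ. A $$ ij) \<in> (\<Pi>\<^sub>E ij\<in>?IJ. {- 1..1})" "(\<lambda>i\<in>{..<n}. vec_index v i) \<in> (\<Pi>\<^sub>E i\<in>{..<n}. {- 1..1})"
      unfolding restrict_PiE_iff
      using orthogonal_entry_le[OF A] v(2) by (simp_all add: abs_le_iff minus_le_iff Ball_def)
    hence B: "E g \<in> B" unfolding E_def B_def Av prod.case by (rule SigmaI)
    have "E g \<in> topspace P" using compactin_subset_topspace[OF \<open>compactin P B\<close>] B by (rule subsetD)
    moreover have "F (E g) = 0" using F_iff[of "E g"] g unfolding r by simp
    ultimately have "E g \<in> C" using B unfolding C_def by simp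
    thus "g \<in> r ` C" using r by (metis imageI)
  qed
  ultimately show ?thesis by simp
qed

text \<open>The definition asks for some quotient topology, so one is built explicitly; the quotient
  is the image of a compact set meeting every coset.\<close>

lemma cocompact_in_isometriesI:
  assumes \<Gamma>: "subgroup \<Gamma> (isometry_group n)"
    and bounded: "\<And>g. g \<in> carrier (isometry_group n) \<Longrightarrow>
      \<exists>h\<in>\<Gamma>. \<forall>i<n. \<bar>vec_index (snd (h \<otimes>\<^bsub>isometry_group n\<^esub> g)) i\<bar> \<le> 1"
  shows "cocompact_in_isometries n \<Gamma>"
proof -
  let ?X = "isometry_topology n" and ?I = "isometry_group n"
  interpret group ?I by (rule group_isometry_group)
  define q where "q g = \<Gamma> #>\<^bsub>?I\<^esub> g" for g
  define op where "op U \<longleftrightarrow> U \<subseteq> q ` topspace ?X \<and> openin ?X {x \<in> topspace ?X. q x \<in> U}" for U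
  define Q where "Q = topology op"
  have "istopology op"
    unfolding istopology_def
  proof (intro conjI allI impI)
    fix U V assume U: "op U" and V: "op V"
    have "{x \<in> topspace ?X. q x \<in> U \<inter> V} = {x \<in> topspace ?X. q x \<in> U} \<inter> {x \<in> topspace ?X. q x \<in> V}" by auto
    thus "op (U \<inter> V)" using U V unfolding op_def by auto
  next
    fix \<U> assume U: "\<forall>U\<in>\<U>. op U"
    have "{x \<in> topspace ?X. q x \<in> \<Union>\<U>} = (\<Union>U\<in>\<U>. {x \<in> topspace ?X. q x \<in> U})" by auto
    thus "op (\<Union>\<U>)" using U unfolding op_def by auto
  qed
  hence openin: "openin Q U \<longleftrightarrow> op U" for U unfolding Q_def by (simp add: topology_inverse')
  have "{x \<in> topspace ?X. q x \<in> q ` topspace ?X} = topspace ?X" by auto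
  hence op_top: "op (q ` topspace ?X)" unfolding op_def by simp
  have top: "topspace Q = q ` topspace ?X"
  proof (rule equalityI)
    have "op (topspace Q)" using openin_topspace[of Q] by (simp only: openin)
    thus "topspace Q \<subseteq> q ` topspace ?X" unfolding op_def by (rule conjunct1)
    show "q ` topspace ?X \<subseteq> topspace Q" by (rule openin_subset) (simp only: openin op_top)
  qed
  have quot: "quotient_map ?X Q q" unfolding quotient_map_def top openin op_def by auto
  let ?K = "{g \<in> carrier ?I. \<forall>i<n. \<bar>vec_index (snd g) i\<bar> \<le> 1}"
  have "q ` topspace ?X \<subseteq> q ` ?K"
  proof
    fix U assume "U \<in> q ` topspace ?X"
    then obtain g where g: "g \<in> carrier ?I" "U = q g" unfolding topspace_isometry_topology by blast
    obtain h where h: "h \<in> \<Gamma>" "\<forall>i<n. \<bar>vec_index (snd (h \<otimes>\<^bsub>?I\<^esub> g)) i\<bar> \<le> 1" using bounded[OF g(1)] by blast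
    have hc: "h \<in> carrier ?I" using h(1) \<Gamma> subgroup.subset by blast
    have "q (h \<otimes>\<^bsub>?I\<^esub> g) = \<Gamma> #>\<^bsub>?I\<^esub> h #>\<^bsub>?I\<^esub> g"
      unfolding q_def by (rule coset_mult_assoc[symmetric]) (use \<Gamma> hc g(1) subgroup.subset in blast)+
    also have "\<dots> = U" unfolding coset_join2[OF hc \<Gamma> h(1)] g(2) q_def ..
    finally have "U = q (h \<otimes>\<^bsub>?I\<^esub> g)" ..
    moreover have "h \<otimes>\<^bsub>?I\<^esub> g \<in> ?K" using h(2) hc g(1) by simp
    ultimately show "U \<in> q ` ?K" by (rule image_eqI)
  qed
  hence "topspace Q = q ` ?K" unfolding top topspace_isometry_topology by auto
  moreover have "compactin Q (q ` ?K)"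
    by (rule image_compactin[OF compactin_bounded_isometries quotient_imp_continuous_map[OF quot]])
  ultimately have "compact_space Q" by (simp add: compact_space_def)
  thus ?thesis using quot unfolding cocompact_in_isometries_def q_def by blast
qed

lemma cocompact_example_group: "cocompact_in_isometries 5 example_group"
proof (rule cocompact_in_isometriesI[OF subgroup_example_group])
  let ?I = "isometry_group 5"
  fix g assume g: "g \<in> carrier ?I"
  obtain A v where Av: "g = (A, v)" by (cases g)
  have A: "A \<in> carrier_mat 5 5" and v: "v \<in> carrier_vec 5"
    using g by (auto simp: Av isometry_group_simps orthogonal_group_carrier_def)
  \<comment> \<open>The integer vectors belong to the lattice; the factor 4 expresses them in
    quarters.\<close>
  define m where "m i = - 4 * \<lfloor>vec_index v i\<rfloor>" for i
  define h where "h = el 0 0 (m 0) (m 1) (m 2) (m 3) (m 4)"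
  have "h \<in> example_group" unfolding h_def
    by (rule example_groupI) (simp add: admissible_def m_def)
  moreover have "\<bar>vec_index (snd (h \<otimes>\<^bsub>?I\<^esub> g)) i\<bar> \<le> 1" if i: "i < 5" for i
  proof -
    have "snd (h \<otimes>\<^bsub>?I\<^esub> g) = transl (m 0) (m 1) (m 2) (m 3) (m 4) + v"
      using v by (simp add: h_def el_def Av isometry_group_simps hol_zero)
    hence "vec_index (snd (h \<otimes>\<^bsub>?I\<^esub> g)) i = of_int (m i) / 4 + vec_index v i"
      using v i unfolding less_5 by (elim disjE) (simp_all add: transl_def)
    also have "\<dots> = vec_index v i - of_int \<lfloor>vec_index v i\<rfloor>" by (simp add: m_def)
    finally show ?thesis by linarith
  qed
  ultimately show "\<exists>h\<in>example_group. \<forall>i<5. \<bar>vec_index (snd (h \<otimes>\<^bsub>?I\<^esub> g)) i\<bar> \<le> 1" by blast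
qed

lemma Bieberbach_example_group: "Bieberbach_group 5 example_group"
  unfolding Bieberbach_group_def crystallographic_group_def
  by (intro conjI subgroup_example_group discrete_example_group cocompact_example_group torsion_free_example_group)

lemma example_group_no_Hantzsche_Wendt:
  "\<not> contains_subgroup_isomorphic ((isometry_group 5)\<lparr>carrier := example_group\<rparr>) Hantzsche_Wendt_group"
proof
  let ?G = "(isometry_group 5)\<lparr>carrier := example_group\<rparr>"
  have "group ?G" by (rule subgroup.subgroup_is_group[OF subgroup_example_group group_isometry_group])
  moreover assume "contains_subgroup_isomorphic ?G Hantzsche_Wendt_group"
  ultimately obtain x y where "HW_pair ?G x y" "x \<noteq> \<one>\<^bsub>?G\<^esub>" by (rule Hantzsche_Wendt_pair_of_subgroup)
  thus False using no_HW_pair_example_group[of x y] by simp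
qed

text \<open>The existence clause is stated because \<open>LEAST\<close> says nothing about a
  property that never holds.\<close>

theorem mainTheorem2:
  shows "(\<exists>n. nondiffuse_Bieberbach_dimension n) \<and> (LEAST n. nondiffuse_Bieberbach_dimension n) = 5"
proof -
  have 5: "nondiffuse_Bieberbach_dimension 5"
    unfolding nondiffuse_Bieberbach_dimension_def
    by (intro exI[of _ example_group] conjI Bieberbach_example_group not_diffuse_example_group
        example_group_no_Hantzsche_Wendt)
  have "5 \<le> n" if "nondiffuse_Bieberbach_dimension n" for n
  proof (rule ccontr)
    assume "\<not> 5 \<le> n"
    hence "n \<le> 4" by simp
    with that show False
      unfolding nondiffuse_Bieberbach_dimension_def using Bieberbach_diffuse_low_dimension[of n] by blast
  qed
  thus ?thesis using 5 by (auto intro: Least_equality)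
qed


end
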